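(* There is an absolute constant $C>0$ such that the following holds. Let $x_1,\dots,x_n\in\mathbb{R}^d$, let $\gamma>0$, let each $l_j:\mathbb{R}\to\mathbb{R}$ be convex and twice differentiable, and let $F(w)=\frac1n\sum_{j=1}^n l_j(x_j^Tw)+\frac{\gamma}{2}\|w\|_2^2$ with unique minimizer $w^\star$. Assume $\|\nabla^2F(w)-\nabla^2F(w')\|_2\le L\|w-w'\|_2$ for all $w,w'\in\mathbb{R}^d$. Let $w_t\in\mathbb{R}^d$ be the current iterate, let $A_t\in\mathbb{R}^{n\times d}$ have $j$-th row $\sqrt{l_j''(x_j^Tw_t)}\,x_j^T$, let $H_t=\nabla^2F(w_t)=\frac1nA_t^TA_t+\gamma I_d$ and $\kappa_t=\sigma_{\max}(H_t)/\sigma_{\min}(H_t)$, and let $d_{\mathrm{eff}}^\gamma$ and $\mu^\gamma$ be the $\gamma$-effective dimension and row $\gamma$-ridge coherence of $A_t$. Let the $n$ samples be partitioned uniformly at random among $m$ worker machines, each receiving $s=n/m$ samples. Let $\varepsilon\in(0,\frac14)$, $\delta\in(0,1)$, and suppose $$ s\ \ge\ C\,\frac{\mu^\gamma d_{\mathrm{eff}}^\gamma}{\varepsilon}\log\frac{m\,d_{\mathrm{eff}}^\gamma}{\delta}. $$ Let $w_{t+1}=w_t-\frac1m\sum_{i=1}^m\widetilde H_{t,i}^{-1}\nabla F(w_t)$ be the GIANT update with unit step size, where $\widetilde H_{t,i}=\frac1sA_{t,i}^TA_{t,i}+\gamma I_d$ and $A_{t,i}\in\mathbb{R}^{s\times d}$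 consists of the rows of $A_t$ assigned to worker $i$. Then, with probability at least $1-\delta$ over the random partition, $$ \|w_{t+1}-w^\star\|_2\ \le\ \varepsilon\sqrt{\kappa_t}\,\|w_t-w^\star\|_2+\frac{L}{\sigma_{\min}(H_t)}\|w_t-w^\star\|_2^2 . $$
   Context: For $A=[a_1^T;\dots;a_n^T]\in\mathbb{R}^{n\times d}$ and $\gamma\ge0$, the row $\gamma$-ridge leverage scores are $l_j^\gamma=a_j^T(A^TA+n\gamma I_d)^\dagger a_j$, $j=1,\dots,n$. The $\gamma$-effective dimension is $d_{\mathrm{eff}}^\gamma(A)=\sum_{j=1}^n l_j^\gamma=\sum_{k=1}^d\frac{\sigma_k^2}{\sigma_k^2+n\gamma}$, where $\sigma_1,\dots,\sigma_d$ are the singular values of $A$. The row $\gamma$-ridge coherence is $\mu^\gamma(A)=\frac{n}{d_{\mathrm{eff}}^\gamma}\max_{i}l_i^\gamma$. It is assumed that $m$ divides $n$. The iterate $w_t$ is regarded as given (the probability is over the random partition). $\sigma_{\max},\sigma_{\min}$ denote largest and smallest singular values.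
   Formalization: In the condition on s, the logarithm log(m d_eff/δ) is replaced by max(1, log(m d_eff/δ)); with the bare logarithm the claim is false when m d_eff/δ ≤ 1, since the condition is then vacuous. *)

theory Defs
  imports
    "HOL-Analysis.Derivative"
    "HOL-Probability.Probability_Mass_Function"
    "Jordan_Normal_Form.Gauss_Jordan_Elimination"
    "Jordan_Normal_Form.Char_Poly"
begin

(* Vectors and matrices are those of Jordan_Normal_Form, whose dimensions are natural numbers
   rather than types. This makes it possible to quantify over the dimensions inside a formula, and
   hence to state that a constant does not depend on them. *)

hide_type (open) Finite_Cartesian_Product.vec
hide_const (open) Finite_Cartesian_Product.vec Finite_Cartesian_Product.mat
  Finite_Cartesian_Product.row Finite_Cartesian_Product.transpose
no_notation Finite_Cartesian_Product.vec_nth (infixl \<open>$\<close> 90)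
no_notation Inner_Product.real_inner_class.inner (infix \<open>\<bullet>\<close> 70)

definition vnorm :: "real vec \<Rightarrow> real" where
  "vnorm v = sqrt (v \<bullet> v)"

definition spectral_norm :: "real mat \<Rightarrow> real" where
  "spectral_norm M = (SUP v\<in>{v \<in> carrier_vec (dim_col M). vnorm v = 1}. vnorm (M *\<^sub>v v))"

(* The square roots of the eigenvalues of M^T M. A matrix with fewer rows than columns thus gets
   the additional singular value 0; for square and for tall matrices all conventions agree. *)
definition singular_values :: "real mat \<Rightarrow> real set" where
  "singular_values M = {\<sigma>. 0 \<le> \<sigma> \<and> eigenvalue (M\<^sup>T * M) (\<sigma>\<^sup>2)}"

definition sigma_max :: "real mat \<Rightarrow> real" where
  "sigma_max M = Max (singular_values M)"

definition sigma_min :: "real mat \<Rightarrow> real" where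
  "sigma_min M = Min (singular_values M)"

(* The Moore-Penrose inverse, characterised by the four Penrose equations. *)
definition pseudoinverse :: "real mat \<Rightarrow> real mat" where
  "pseudoinverse M = (THE B. B \<in> carrier_mat (dim_col M) (dim_row M) \<and>
     M * B * M = M \<and> B * M * B = B \<and> (M * B)\<^sup>T = M * B \<and> (B * M)\<^sup>T = B * M)"

definition partial :: "nat \<Rightarrow> (real vec \<Rightarrow> real) \<Rightarrow> real vec \<Rightarrow> real" where
  "partial i f w = deriv (\<lambda>t. f (w + t \<cdot>\<^sub>v unit_vec (dim_vec w) i)) 0"

definition gradient :: "(real vec \<Rightarrow> real) \<Rightarrow> real vec \<Rightarrow> real vec" where
  "gradient f w = vec (dim_vec w) (\<lambda>i. partial i f w)"

definition hessian :: "(real vec \<Rightarrow> real) \<Rightarrow> real vec \<Rightarrow> real mat" where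
  "hessian f w = mat (dim_vec w) (dim_vec w) (\<lambda>(i, j). partial i (partial j f) w)"

definition ridge_leverage :: "real mat \<Rightarrow> real \<Rightarrow> nat \<Rightarrow> real" where
  "ridge_leverage A \<gamma> j = row A j \<bullet>
     (pseudoinverse (A\<^sup>T * A + (real (dim_row A) * \<gamma>) \<cdot>\<^sub>m 1\<^sub>m (dim_col A)) *\<^sub>v row A j)"

(* The effective dimension can be arbitrarily small, so ln (m * eff_dim A g / delta) can be zero or
   negative. A sample-size condition whose right-hand side is a multiple of this bare logarithm is
   then vacuous and does not control the sampling error; such logarithmic factors have to be
   read as max 1 (ln ...). *)
definition eff_dim :: "real mat \<Rightarrow> real \<Rightarrow> real" where
  "eff_dim A \<gamma> = (\<Sum>j<dim_row A. ridge_leverage A \<gamma> j)"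

(* If A = 0, then eff_dim A g = 0 and division by zero makes the coherence 0. *)
definition ridge_coherence :: "real mat \<Rightarrow> real \<Rightarrow> real" where
  "ridge_coherence A \<gamma> =
     real (dim_row A) / eff_dim A \<gamma> * Max (ridge_leverage A \<gamma> ` {..<dim_row A})"

definition objective ::
  "nat \<Rightarrow> (nat \<Rightarrow> real \<Rightarrow> real) \<Rightarrow> (nat \<Rightarrow> real vec) \<Rightarrow> real \<Rightarrow> real vec \<Rightarrow> real" where
  "objective n l x \<gamma> w = 1 / real n * (\<Sum>j<n. l j (x j \<bullet> w)) + \<gamma> / 2 * (vnorm w)\<^sup>2"

definition scaled_data ::
  "nat \<Rightarrow> nat \<Rightarrow> (nat \<Rightarrow> real \<Rightarrow> real) \<Rightarrow> (nat \<Rightarrow> real vec) \<Rightarrow> real vec \<Rightarrow> real mat" where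
  "scaled_data n d l x w =
     mat_of_rows d (map (\<lambda>j. sqrt (deriv (deriv (l j)) (x j \<bullet> w)) \<cdot>\<^sub>v x j) [0..<n])"

(* A partition of n samples among m labelled workers is the function p that sends each sample to
   its worker; all workers receive the same number of samples. *)
definition partitions :: "nat \<Rightarrow> nat \<Rightarrow> (nat \<Rightarrow> nat) set" where
  "partitions n m =
     {p \<in> {..<n} \<rightarrow>\<^sub>E {..<m}. \<forall>i<m. card {j. j < n \<and> p j = i} = n div m}"

definition worker_rows :: "real mat \<Rightarrow> (nat \<Rightarrow> nat) \<Rightarrow> nat \<Rightarrow> real mat" where
  "worker_rows A p i =
     mat_of_rows (dim_col A) (map (row A) (filter (\<lambda>j. p j = i) [0..<dim_row A]))"

definition local_hessian :: "real mat \<Rightarrow> real \<Rightarrow> nat \<Rightarrow> (nat \<Rightarrow> nat) \<Rightarrow> nat \<Rightarrow> real mat" where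
  "local_hessian A \<gamma> s p i =
     (1 / real s) \<cdot>\<^sub>m ((worker_rows A p i)\<^sup>T * worker_rows A p i) + \<gamma> \<cdot>\<^sub>m 1\<^sub>m (dim_col A)"

(* The Newton-type step from w with gradient g and unit step size. *)
definition giant_update ::
  "real mat \<Rightarrow> real \<Rightarrow> nat \<Rightarrow> (nat \<Rightarrow> nat) \<Rightarrow> real vec \<Rightarrow> real vec \<Rightarrow> real vec" where
  "giant_update A \<gamma> m p g w = w - (1 / real m) \<cdot>\<^sub>v
     finsum_vec TYPE(real) (dim_vec w)
       (\<lambda>i. the (mat_inverse (local_hessian A \<gamma> (dim_row A div m) p i)) *\<^sub>v g) {..<m}"

end

(* Whiten by a matrix P with P^T H P = 1 and put y_j = P^T a_j for the rows a_j of A. Then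
   |y_j|^2 is n times the j-th leverage score, so it is at most M = mu * d_eff, and worker i sees
   the whitened Hessian 1 + E_i, where E_i is the deviation of the sample mean of the matrices
   y_j y_j^T from their population mean. The workers partition the data, hence the E_i sum to 0
   and the average of the inverses (1 + E_i)^(-1) differs from 1 only in second order: it suffices
   that |E_i| <= eta with eta^2 of order epsilon, which is why s has to grow only like 1/epsilon.

   The bound on E_i is a matrix Bernstein inequality for sampling without replacement whose
   prefactor is d_eff instead of d. Drawing the sample one index at a time and dividing the centred
   sum by the number of remaining indices gives a matrix martingale Z. The trace of
   exp Z + exp (-Z) - 2 is followed along this martingale. The Golden-Thompson inequality splits
   off one increment, and since the traced matrix is positive semidefinite and vanishes for Z = 0,
   only the trace of the variance, i.e. d_eff, enters the recursion. The matrix exponential is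
   replaced by the powers (1 + S / 2^k)^(2^k), for which Golden-Thompson holds up to an error that
   tends to 0 as k grows. *)

theory Submission
  imports Defs
begin

section \<open>Norms and traces of real matrices\<close>

text \<open>The sample size hypothesis does not contain d, so a prefactor d cannot be absorbed. The
  recursion for the potential closes because the whitening includes the regulariser: the population
  matrix B of the whitened rows satisfies B <= 1, so tr((exp Z + exp (-Z) - 2) B) is at most the
  potential itself. The increments of the martingale are under control only while at most half of
  the indices have been drawn, which holds for m >= 2; for m = 1 the single worker has the exact
  Hessian. Constants: let M = mu * d_eff and a = eta^2 s / (96 M). Scaled by n eta / (48 M), the
  martingale lets the potential grow by a factor of at most exp a over the s draws, whereas an error
  above eta forces an eigenvalue of modulus at least 2a. Markov's inequality leaves 4 d_eff exp
  (-a). The union over the workers asks for a to be at least 4 times the logarithmic factor, and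
  eta^2 = epsilon / 4, so C = 4 * 4 * 96 = 1536. Spectral calculus is avoided: a trace against an
  even power is a sum of quadratic forms, and only eigenvectors for extreme eigenvalues are
  constructed.\<close>

definition mtrace :: "real mat \<Rightarrow> real" where
  "mtrace A = (\<Sum>i<dim_row A. A $$ (i, i))"

lemma vnorm_L2_set: "vnorm v = L2_set (\<lambda>i. v $ i) {..<dim_vec v}"
  by (simp add: vnorm_def L2_set_def scalar_prod_def power2_eq_square lessThan_atLeast0)

lemma vnorm_nonneg [simp]: "0 \<le> vnorm v"
  by (simp add: vnorm_L2_set)

lemma vnorm_square: "(vnorm v)\<^sup>2 = v \<bullet> v"
  by (simp add: vnorm_def scalar_prod_def sum_nonneg)

lemma vnorm_triangle:
  assumes "u \<in> carrier_vec d" "v \<in> carrier_vec d"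
  shows "vnorm (u + v) \<le> vnorm u + vnorm v"
proof -
  have "vnorm (u + v) = L2_set (\<lambda>i. u $ i + v $ i) {..<d}"
    using assms unfolding vnorm_L2_set by (auto intro!: L2_set_cong)
  then show ?thesis
    using L2_set_triangle_ineq[of "\<lambda>i. u $ i" "\<lambda>i. v $ i" "{..<d}"] assms
    by (simp add: vnorm_L2_set)
qed

lemma vnorm_smult: "vnorm (c \<cdot>\<^sub>v v) = \<bar>c\<bar> * vnorm v"
proof -
  have "L2_set (\<lambda>i. (c \<cdot>\<^sub>v v) $ i) {..<dim_vec v} = L2_set (\<lambda>i. c * v $ i) {..<dim_vec v}"
    by (intro L2_set_cong) auto
  also have "\<dots> = \<bar>c\<bar> * L2_set (\<lambda>i. v $ i) {..<dim_vec v}"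
    by (simp add: L2_set_def power_mult_distrib flip: sum_distrib_left)
       (simp add: real_sqrt_mult)
  finally show ?thesis by (simp add: vnorm_L2_set)
qed

lemma vnorm_zero [simp]: "vnorm (0\<^sub>v d) = 0"
  by (simp add: vnorm_def)

lemma vnorm_eq_0_iff:
  assumes "v \<in> carrier_vec d"
  shows "vnorm v = 0 \<longleftrightarrow> v = 0\<^sub>v d"
  using assms by (auto simp: vnorm_L2_set L2_set_eq_0_iff intro!: eq_vecI)

lemma vnorm_pos: "v \<in> carrier_vec d \<Longrightarrow> v \<noteq> 0\<^sub>v d \<Longrightarrow> 0 < vnorm v"
  by (metis less_le vnorm_eq_0_iff vnorm_nonneg)

lemma vnorm_minus:
  assumes "u \<in> carrier_vec d" "v \<in> carrier_vec d"
  shows "vnorm (u - v) \<le> vnorm u + vnorm v"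
proof -
  have "u - v = u + (-1) \<cdot>\<^sub>v v" using assms by auto
  then show ?thesis
    using vnorm_triangle[of u d "(-1) \<cdot>\<^sub>v v"] assms by (simp add: vnorm_smult)
qed

lemma scalar_prod_le_vnorm:
  assumes "u \<in> carrier_vec d" "v \<in> carrier_vec d"
  shows "\<bar>u \<bullet> v\<bar> \<le> vnorm u * vnorm v"
proof -
  have "\<bar>u \<bullet> v\<bar> \<le> (\<Sum>i<d. \<bar>u $ i\<bar> * \<bar>v $ i\<bar>)"
    using assms sum_abs[of "\<lambda>i. u $ i * v $ i" "{..<d}"]
    by (simp add: scalar_prod_def abs_mult lessThan_atLeast0)
  also have "\<dots> \<le> vnorm u * vnorm v"
    using L2_set_mult_ineq[of "\<lambda>i. u $ i" "\<lambda>i. v $ i" "{..<d}"] assms by (simp add: vnorm_L2_set)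
  finally show ?thesis .
qed

section \<open>Powers, transposes and traces of square matrices\<close>

lemma mult_square_mat_closed [simp, intro]:
  "A \<in> carrier_mat d d \<Longrightarrow> B \<in> carrier_mat d d \<Longrightarrow> A * B \<in> carrier_mat d d"
  by (rule mult_carrier_mat)

declare pow_carrier_mat [simp]

lemma transpose_mult_square_mat:
  fixes A B :: "real mat"
  shows "A \<in> carrier_mat d d \<Longrightarrow> B \<in> carrier_mat d d \<Longrightarrow> (A * B)\<^sup>T = B\<^sup>T * A\<^sup>T"
  by (simp add: transpose_mult[of _ d d _ d])

lemma pow_mat_add:
  assumes "A \<in> carrier_mat d d"
  shows "A ^\<^sub>m (a + b) = A ^\<^sub>m a * A ^\<^sub>m b"
  using assms
  by (induction b) (auto simp: assoc_mult_mat[of _ d d _ d _ d])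

lemma pow_mat_Suc_left:
  assumes "A \<in> carrier_mat d d"
  shows "A ^\<^sub>m Suc a = A * A ^\<^sub>m a"
  using pow_mat_add[OF assms, of 1 a] assms by simp

lemma pow_mat_square:
  assumes "A \<in> carrier_mat d d"
  shows "(A * A) ^\<^sub>m a = A ^\<^sub>m (2 * a)"
proof (induction a)
  case (Suc a)
  have "A ^\<^sub>m (2 * Suc a) = A ^\<^sub>m (2 * a + (1 + 1))" by simp
  also have "\<dots> = A ^\<^sub>m (2 * a) * (A * A)"
    using assms by (subst pow_mat_add[OF assms], subst pow_mat_add[OF assms]) simp
  finally show ?case using Suc by simp
qed (use assms in simp)

lemma transpose_pow_mat:
  fixes A :: "real mat"
  assumes "A \<in> carrier_mat d d"
  shows "(A ^\<^sub>m a)\<^sup>T = A\<^sup>T ^\<^sub>m a"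
proof (induction a)
  case (Suc a)
  have "(A ^\<^sub>m Suc a)\<^sup>T = (A * A ^\<^sub>m a)\<^sup>T"
    using assms by (simp only: pow_mat_Suc_left)
  then show ?case using assms Suc by (simp add: transpose_mult_square_mat[of _ d])
qed (use assms in simp)

lemma mtrace_add:
  "A \<in> carrier_mat d d \<Longrightarrow> B \<in> carrier_mat d d \<Longrightarrow> mtrace (A + B) = mtrace A + mtrace B"
  by (auto simp: mtrace_def sum.distrib)

lemma mtrace_diff:
  "A \<in> carrier_mat d d \<Longrightarrow> B \<in> carrier_mat d d \<Longrightarrow> mtrace (A - B) = mtrace A - mtrace B"
  by (auto simp: mtrace_def sum_subtractf)

lemma mtrace_smult: "A \<in> carrier_mat d d \<Longrightarrow> mtrace (c \<cdot>\<^sub>m A) = c * mtrace A"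
  by (auto simp: mtrace_def sum_distrib_left)

lemma mtrace_one: "mtrace (1\<^sub>m d) = d"
  by (simp add: mtrace_def)

lemma mtrace_mult:
  assumes "A \<in> carrier_mat d d" "B \<in> carrier_mat d d"
  shows "mtrace (A * B) = (\<Sum>i<d. \<Sum>j<d. A $$ (i, j) * B $$ (j, i))"
  using assms by (auto simp: mtrace_def scalar_prod_def lessThan_atLeast0 intro!: sum.cong)

lemma mtrace_comm:
  assumes "A \<in> carrier_mat d d" "B \<in> carrier_mat d d"
  shows "mtrace (A * B) = mtrace (B * A)"
  unfolding mtrace_mult[OF assms] mtrace_mult[OF assms(2,1)]
  by (subst sum.swap) (simp add: mult.commute)

lemma mtrace_pow_comm:
  assumes "A \<in> carrier_mat d d" "B \<in> carrier_mat d d"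
  shows "mtrace ((A * B) ^\<^sub>m a) = mtrace ((B * A) ^\<^sub>m a)"
proof (cases a)
  case (Suc b)
  have *: "A * (B * A) ^\<^sub>m b = (A * B) ^\<^sub>m b * A"
  proof (induction b)
    case (Suc b)
    have "A * (B * A) ^\<^sub>m Suc b = (A * (B * A) ^\<^sub>m b) * (B * A)"
      using assms by (simp add: assoc_mult_mat[of _ d d _ d _ d])
    also have "\<dots> = (A * B) ^\<^sub>m Suc b * A"
      using assms by (subst Suc) (simp add: assoc_mult_mat[of _ d d _ d _ d])
    finally show ?case .
  qed (use assms in simp)
  have "mtrace ((A * B) ^\<^sub>m Suc b) = mtrace (((A * B) ^\<^sub>m b * A) * B)"
    using assms by (simp add: assoc_mult_mat[of _ d d _ d _ d])
  also have "\<dots> = mtrace (((B * A) ^\<^sub>m b * B) * A)"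
    using assms unfolding *[symmetric]
    by (subst assoc_mult_mat[of _ d d _ d _ d], simp_all, subst mtrace_comm[of A d])
       (simp_all add: assoc_mult_mat[of _ d d _ d _ d])
  also have "\<dots> = mtrace ((B * A) ^\<^sub>m Suc b)"
    using assms by (simp add: assoc_mult_mat[of _ d d _ d _ d])
  finally show ?thesis using Suc by simp
qed (use assms in simp)

section \<open>The Cauchy-Schwarz inequality for the trace and its iteration along powers of
  two\<close>

lemma mtrace_transpose_mult_self:
  assumes "A \<in> carrier_mat d d"
  shows "mtrace (A\<^sup>T * A) = (\<Sum>i<d. \<Sum>j<d. (A $$ (j, i))\<^sup>2)"
  using assms by (subst mtrace_mult[of _ d]) (auto simp: power2_eq_square intro!: sum.cong)

lemma mtrace_mult_square_le:
  assumes A: "A \<in> carrier_mat d d" and B: "B \<in> carrier_mat d d"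
  shows "(mtrace (A * B))\<^sup>2 \<le> mtrace (A\<^sup>T * A) * mtrace (B * B\<^sup>T)"
proof -
  have *: "mtrace (A * B) = (\<Sum>(i, j)\<in>{..<d} \<times> {..<d}. A $$ (i, j) * B $$ (j, i))"
    by (simp add: mtrace_mult[OF assms] sum.cartesian_product)
  have a: "mtrace (A\<^sup>T * A) = (\<Sum>(i, j)\<in>{..<d} \<times> {..<d}. (A $$ (i, j))\<^sup>2)"
    unfolding mtrace_transpose_mult_self[OF A] by (subst sum.swap) (simp add: sum.cartesian_product)
  have b: "mtrace (B * B\<^sup>T) = (\<Sum>(i, j)\<in>{..<d} \<times> {..<d}. (B $$ (j, i))\<^sup>2)"
    using mtrace_transpose_mult_self[OF B] mtrace_comm[of "B\<^sup>T" d B] B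
    by (simp add: sum.cartesian_product)
  show ?thesis unfolding * a b
    using Cauchy_Schwarz_ineq_sum[of "\<lambda>(i,j). A $$ (i, j)" "\<lambda>(i,j). B $$ (j, i)" "{..<d} \<times> {..<d}"]
    by (simp add: case_prod_beta)
qed

lemma transpose_mult_self_symmetric:
  fixes A :: "real mat"
  assumes "A \<in> carrier_mat d d"
  shows "(A\<^sup>T * A)\<^sup>T = A\<^sup>T * A" "(A * A\<^sup>T)\<^sup>T = A * A\<^sup>T"
  using assms by (simp_all add: transpose_mult_square_mat[of _ d])

text \<open>Doubling the exponent turns M = A B into M M. The induction hypothesis for the pair (M,
  M) produces M^T M and M M^T, whose power traces agree by cyclicity. A cyclic shift rewrites M M^T
  as the product of B B^T and A^T A, and the hypothesis applies to that pair as well. The induction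
  therefore runs over arbitrary A and B.\<close>

lemma mtrace_pow2_square_le:
  assumes "A \<in> carrier_mat d d" "B \<in> carrier_mat d d"
  shows "(mtrace ((A * B) ^\<^sub>m (2 ^ k)))\<^sup>2
    \<le> mtrace ((A\<^sup>T * A) ^\<^sub>m (2 ^ k)) * mtrace ((B * B\<^sup>T) ^\<^sub>m (2 ^ k))"
  using assms
proof (induction k arbitrary: A B)
  case 0
  then show ?case using mtrace_mult_square_le[of A d B] by simp
next
  case (Suc k)
  note [simp] = Suc.prems
  let ?q = "2 ^ k :: nat"
  let ?M = "A * B" and ?U = "A\<^sup>T * A" and ?V = "B * B\<^sup>T"
  have [simp]: "?M \<in> carrier_mat d d" "?U \<in> carrier_mat d d" "?V \<in> carrier_mat d d"
    by simp_all
  have cyc: "mtrace ((?M\<^sup>T * ?M) ^\<^sub>m ?q) = mtrace ((?M * ?M\<^sup>T) ^\<^sub>m ?q)"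
    by (rule mtrace_pow_comm[of _ d]) simp_all
  have "?M * ?M\<^sup>T = A * (?V * A\<^sup>T)"
    by (simp add: transpose_mult_square_mat[of _ d] assoc_mult_mat[of _ d d _ d _ d])
  then have "mtrace ((?M * ?M\<^sup>T) ^\<^sub>m ?q) = mtrace (((?V * A\<^sup>T) * A) ^\<^sub>m ?q)"
    using mtrace_pow_comm[of A d "?V * A\<^sup>T"] by simp
  also have "(?V * A\<^sup>T) * A = ?V * ?U"
    by (simp add: assoc_mult_mat[of _ d d _ d _ d])
  finally have 1: "mtrace ((?M * ?M\<^sup>T) ^\<^sub>m ?q) = mtrace ((?V * ?U) ^\<^sub>m ?q)" .
  have "(mtrace (?M ^\<^sub>m (2 * ?q)))\<^sup>2 = (mtrace ((?M * ?M) ^\<^sub>m ?q))\<^sup>2"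
    by (simp add: pow_mat_square[of _ d])
  also have "\<dots> \<le> mtrace ((?V * ?U) ^\<^sub>m ?q) ^ 2"
    using Suc.IH[of ?M ?M] unfolding cyc 1 by (simp add: power2_eq_square)
  also have "\<dots> \<le> mtrace ((?V\<^sup>T * ?V) ^\<^sub>m ?q) * mtrace ((?U * ?U\<^sup>T) ^\<^sub>m ?q)"
    by (rule Suc.IH) simp_all
  also have "\<dots> = mtrace (?U ^\<^sub>m (2 * ?q)) * mtrace (?V ^\<^sub>m (2 * ?q))"
    by (simp add: transpose_mult_self_symmetric[of _ d] pow_mat_square[of _ d])
  finally show ?case by simp
qed

text \<open>Golden-Thompson before the limit. Cauchy-Schwarz and a cyclic shift replace P, Q by P^2,
  Q^2 at half the exponent, so that the exponent gradually moves onto the factors. The induction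
  starts at exponent 2; at exponent 1 the bound fails whenever tr (P Q) is negative, hence
  \<open>Suc k\<close>.\<close>

lemma abs_mtrace_pow2_mult_le:
  assumes "P \<in> carrier_mat d d" "Q \<in> carrier_mat d d" "P\<^sup>T = P" "Q\<^sup>T = Q"
  shows "\<bar>mtrace ((P * Q) ^\<^sub>m (2 ^ Suc k))\<bar> \<le> mtrace (P ^\<^sub>m (2 ^ Suc k) * Q ^\<^sub>m (2 ^ Suc k))"
  using assms
proof (induction k arbitrary: P Q)
  case (0 P Q)
  note [simp] = 0
  let ?M = "P * Q"
  have [simp]: "?M \<in> carrier_mat d d" by simp
  have nn: "0 \<le> mtrace (?M\<^sup>T * ?M)"
    by (simp add: mtrace_transpose_mult_self[of _ d] sum_nonneg)
  have "(mtrace (?M * ?M))\<^sup>2 \<le> mtrace (?M\<^sup>T * ?M) ^ 2"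
    using mtrace_mult_square_le[of ?M d ?M] mtrace_comm[of ?M d "?M\<^sup>T"]
    by (simp add: power2_eq_square)
  then have "\<bar>mtrace (?M * ?M)\<bar> \<le> mtrace (?M\<^sup>T * ?M)"
    using nn by (metis abs_le_square_iff abs_of_nonneg)
  also have "\<dots> = mtrace (Q * (P * (P * Q)))"
    by (simp add: transpose_mult_square_mat[of _ d] assoc_mult_mat[of _ d d _ d _ d])
  also have "\<dots> = mtrace ((P * P) * (Q * Q))"
    using mtrace_comm[of Q d "P * (P * Q)"] by (simp add: assoc_mult_mat[of _ d d _ d _ d])
  finally show ?case
    using pow_mat_square[of ?M d 1] pow_mat_square[of P d 1] pow_mat_square[of Q d 1]
    by (simp add: numeral_2_eq_2 del: pow_mat.simps) simp
next
  case (Suc k P Q)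
  note [simp] = Suc.prems
  let ?q = "2 ^ Suc k :: nat"
  let ?M = "P * Q"
  have [simp]: "?M \<in> carrier_mat d d" by simp
  have cyc: "mtrace ((?M\<^sup>T * ?M) ^\<^sub>m ?q) = mtrace ((?M * ?M\<^sup>T) ^\<^sub>m ?q)"
    by (rule mtrace_pow_comm[of _ d]) simp_all
  have "?M * ?M\<^sup>T = P * (Q * Q * P)"
    by (simp add: transpose_mult_square_mat[of _ d] assoc_mult_mat[of _ d d _ d _ d])
  then have "mtrace ((?M * ?M\<^sup>T) ^\<^sub>m ?q) = mtrace ((Q * Q * P * P) ^\<^sub>m ?q)"
    using mtrace_pow_comm[of P d "Q * Q * P"] by simp
  also have "Q * Q * P * P = (Q * Q) * (P * P)"
    by (simp add: assoc_mult_mat[of _ d d _ d _ d])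
  also have "mtrace (((Q * Q) * (P * P)) ^\<^sub>m ?q) = mtrace (((P * P) * (Q * Q)) ^\<^sub>m ?q)"
    by (rule mtrace_pow_comm[of _ d]) simp_all
  finally have 1: "mtrace ((?M * ?M\<^sup>T) ^\<^sub>m ?q) = mtrace (((P * P) * (Q * Q)) ^\<^sub>m ?q)" .
  have "(mtrace (?M ^\<^sub>m (2 * ?q)))\<^sup>2 = (mtrace ((?M * ?M) ^\<^sub>m ?q))\<^sup>2"
    by (simp add: pow_mat_square[of _ d])
  also have "\<dots> \<le> mtrace (((P * P) * (Q * Q)) ^\<^sub>m ?q) ^ 2"
    using mtrace_pow2_square_le[of ?M d ?M "Suc k"] unfolding cyc 1 by (simp add: power2_eq_square)
  finally have "\<bar>mtrace (?M ^\<^sub>m (2 * ?q))\<bar> \<le> \<bar>mtrace (((P * P) * (Q * Q)) ^\<^sub>m ?q)\<bar>"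
    by (simp only: abs_le_square_iff)
  also have "\<dots> \<le> mtrace ((P * P) ^\<^sub>m ?q * (Q * Q) ^\<^sub>m ?q)"
    by (rule Suc.IH) (simp_all add: transpose_mult_square_mat[of _ d])
  finally show ?case by (simp add: pow_mat_square[of _ d])
qed

text \<open>Moving one factor R to the right-hand end turns the trace into quadratic forms at the
  columns of R. Inequalities between quadratic forms thereby pass to traces against a
  square.\<close>

lemma mtrace_square_mult:
  assumes "R \<in> carrier_mat d d" "R\<^sup>T = R" "Y \<in> carrier_mat d d"
  shows "mtrace (R * R * Y) = (\<Sum>i<d. col R i \<bullet> (Y *\<^sub>v col R i))"
proof -
  have "mtrace (R * R * Y) = mtrace (R * (Y * R))"
    using assms by (simp add: assoc_mult_mat[of _ d d _ d _ d] mtrace_comm[of R d "R * Y"])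
  also have "\<dots> = (\<Sum>i<d. row R i \<bullet> (Y *\<^sub>v col R i))"
    using assms by (auto simp: mtrace_def intro!: sum.cong)
      (simp add: mult_mat_vec_def scalar_prod_def)
  also have "\<dots> = (\<Sum>i<d. col R i \<bullet> (Y *\<^sub>v col R i))"
    using assms by (intro sum.cong) (auto simp flip: row_transpose)
  finally show ?thesis .
qed

section \<open>Positive semidefinite weights in traces\<close>

definition psd :: "nat \<Rightarrow> real mat \<Rightarrow> bool" where
  "psd d Y \<longleftrightarrow> Y \<in> carrier_mat d d \<and> (\<forall>z\<in>carrier_vec d. 0 \<le> z \<bullet> (Y *\<^sub>v z))"

lemma mtrace_square_mult_nonneg:
  assumes "R \<in> carrier_mat d d" "R\<^sup>T = R" "psd d Y"
  shows "0 \<le> mtrace (R * R * Y)"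
  using assms unfolding psd_def by (subst mtrace_square_mult[of _ d]) (auto intro!: sum_nonneg)

(* Since (P^M - 1)^2 has nonnegative trace against Y, the claim for the exponent M gives the claim for 2M. *)
lemma mtrace_pow2_sum_ge:
  assumes "P \<in> carrier_mat d d" "Q \<in> carrier_mat d d" "P\<^sup>T = P" "Q\<^sup>T = Q" "psd d Y"
    and PQ: "P + Q = 2 \<cdot>\<^sub>m 1\<^sub>m d"
  shows "2 * mtrace Y \<le> mtrace (P ^\<^sub>m (2 ^ k) * Y) + mtrace (Q ^\<^sub>m (2 ^ k) * Y)"
proof (induction k)
  case 0
  have [simp]: "Y \<in> carrier_mat d d" using assms by (simp add: psd_def)
  have "mtrace (P * Y) + mtrace (Q * Y) = mtrace ((P + Q) * Y)"
    using assms(1-5) by (simp add: mtrace_add[of _ d] add_mult_distrib_mat[of _ d d _ _ d])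
  also have "\<dots> = 2 * mtrace Y"
    unfolding PQ by (simp add: mtrace_smult[of _ d] mult_smult_assoc_mat[of _ d d _ d] left_mult_one_mat[of Y d d])
  finally show ?case using assms by simp
next
  case (Suc k)
  have [simp]: "Y \<in> carrier_mat d d" using assms by (simp add: psd_def)
  have *: "mtrace (R ^\<^sub>m (2 ^ Suc k) * Y) \<ge> 2 * mtrace (R ^\<^sub>m (2 ^ k) * Y) - mtrace Y"
    if [simp]: "R \<in> carrier_mat d d" "R\<^sup>T = R" for R
  proof -
    let ?U = "R ^\<^sub>m (2 ^ k)"
    let ?D = "?U - 1\<^sub>m d"
    have D: "?D \<in> carrier_mat d d" by (simp add: minus_carrier_mat)
    have "?D\<^sup>T = ?D"
      by (simp add: transpose_minus[of _ d d] transpose_pow_mat[of _ d])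
    then have "0 \<le> mtrace (?D * ?D * Y)"
      using assms D by (intro mtrace_square_mult_nonneg) auto
    also have "?D * ?D * Y = ?U * ?U * Y - ?U * Y - (?U * Y - Y)"
      by (simp add: minus_mult_distrib_mat[of _ d d _ _ d] mult_minus_distrib_mat[of _ d d _ d]
          minus_carrier_mat left_mult_one_mat[of _ d d])
    also have "mtrace \<dots> = mtrace (?U * ?U * Y) - 2 * mtrace (?U * Y) + mtrace Y"
      by (simp add: mtrace_diff[of _ d] minus_carrier_mat)
    also have "?U * ?U = R ^\<^sub>m (2 ^ Suc k)"
      using pow_mat_add[of R d "2 ^ k" "2 ^ k"] by (simp add: mult_2)
    finally show ?thesis by simp
  qed
  show ?case using *[of P] *[of Q] Suc assms by simp
qed

section \<open>The row-sum norm and the perturbation of matrix powers\<close>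

definition row_sum_bound :: "nat \<Rightarrow> real \<Rightarrow> real mat \<Rightarrow> bool" where
  "row_sum_bound d c A \<longleftrightarrow> A \<in> carrier_mat d d \<and> (\<forall>i<d. (\<Sum>j<d. \<bar>A $$ (i, j)\<bar>) \<le> c)"

lemma row_sum_bound_carrier: "row_sum_bound d c A \<Longrightarrow> A \<in> carrier_mat d d"
  by (simp add: row_sum_bound_def)

lemma row_sum_bound_exists:
  assumes "A \<in> carrier_mat d d"
  obtains c where "0 \<le> c" "row_sum_bound d c A"
proof -
  let ?c = "\<Sum>i<d. \<Sum>j<d. \<bar>A $$ (i, j)\<bar>"
  have "(\<Sum>j<d. \<bar>A $$ (i, j)\<bar>) \<le> ?c" if "i < d" for i
    using that by (intro member_le_sum[of i "{..<d}" "\<lambda>i. \<Sum>j<d. \<bar>A $$ (i, j)\<bar>"]) (auto intro!: sum_nonneg)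
  moreover have "0 \<le> ?c" by (intro sum_nonneg) auto
  ultimately show ?thesis using assms by (intro that[of ?c]) (auto simp: row_sum_bound_def)
qed

lemma row_sum_bound_mono: "row_sum_bound d a A \<Longrightarrow> a \<le> b \<Longrightarrow> row_sum_bound d b A"
  unfolding row_sum_bound_def by fastforce

lemma row_sum_bound_one: "row_sum_bound d 1 (1\<^sub>m d)"
  by (auto simp: row_sum_bound_def if_distrib cong: if_cong)

lemma row_sum_bound_add:
  assumes "row_sum_bound d a A" "row_sum_bound d b B"
  shows "row_sum_bound d (a + b) (A + B)"
  unfolding row_sum_bound_def
proof (intro conjI allI impI)
  fix i assume i: "i < d"
  have "(\<Sum>j<d. \<bar>(A + B) $$ (i, j)\<bar>) \<le> (\<Sum>j<d. \<bar>A $$ (i, j)\<bar> + \<bar>B $$ (i, j)\<bar>)"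
    using assms i by (intro sum_mono) (auto simp: row_sum_bound_def)
  also have "\<dots> \<le> a + b"
    using assms i by (auto simp: row_sum_bound_def sum.distrib intro!: add_mono)
  finally show "(\<Sum>j<d. \<bar>(A + B) $$ (i, j)\<bar>) \<le> a + b" .
qed (use assms in \<open>auto simp: row_sum_bound_def\<close>)

lemma row_sum_bound_smult:
  assumes "row_sum_bound d a A"
  shows "row_sum_bound d (\<bar>c\<bar> * a) (c \<cdot>\<^sub>m A)"
  using assms by (auto simp: row_sum_bound_def abs_mult mult_left_mono simp flip: sum_distrib_left)

lemma row_sum_bound_mult:
  assumes "row_sum_bound d a A" "row_sum_bound d b B" "0 \<le> b"
  shows "row_sum_bound d (a * b) (A * B)"
  unfolding row_sum_bound_def
proof (intro conjI allI impI)
  fix i assume i: "i < d"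
  have "(\<Sum>j<d. \<bar>(A * B) $$ (i, j)\<bar>) \<le> (\<Sum>j<d. \<Sum>k<d. \<bar>A $$ (i, k)\<bar> * \<bar>B $$ (k, j)\<bar>)"
  proof (intro sum_mono)
    fix j assume "j \<in> {..<d}"
    then have "(A * B) $$ (i, j) = (\<Sum>k<d. A $$ (i, k) * B $$ (k, j))"
      using assms i by (auto simp: row_sum_bound_def scalar_prod_def lessThan_atLeast0 intro!: sum.cong)
    then show "\<bar>(A * B) $$ (i, j)\<bar> \<le> (\<Sum>k<d. \<bar>A $$ (i, k)\<bar> * \<bar>B $$ (k, j)\<bar>)"
      using sum_abs[of "\<lambda>k. A $$ (i, k) * B $$ (k, j)" "{..<d}"] by (simp add: abs_mult)
  qed
  also have "\<dots> = (\<Sum>k<d. \<bar>A $$ (i, k)\<bar> * (\<Sum>j<d. \<bar>B $$ (k, j)\<bar>))"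
    by (subst sum.swap) (simp add: sum_distrib_left)
  also have "\<dots> \<le> (\<Sum>k<d. \<bar>A $$ (i, k)\<bar> * b)"
    using assms by (intro sum_mono mult_left_mono) (auto simp: row_sum_bound_def)
  also have "\<dots> \<le> a * b"
    using assms i by (auto simp: row_sum_bound_def intro!: mult_right_mono simp flip: sum_distrib_right)
  finally show "(\<Sum>j<d. \<bar>(A * B) $$ (i, j)\<bar>) \<le> a * b" .
qed (use assms in \<open>auto simp: row_sum_bound_def\<close>)

lemma row_sum_bound_pow:
  assumes "row_sum_bound d a A" "0 \<le> a"
  shows "row_sum_bound d (a ^ k) (A ^\<^sub>m k)"
proof (induction k)
  case 0
  then show ?case using assms row_sum_bound_one[of d] by (auto simp: row_sum_bound_def)
next
  case (Suc k)
  then show ?case using row_sum_bound_mult[OF Suc assms] by (simp add: mult.commute)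
qed

lemma abs_mtrace_le:
  assumes "row_sum_bound d a A"
  shows "\<bar>mtrace A\<bar> \<le> d * a"
proof -
  have "\<bar>mtrace A\<bar> \<le> (\<Sum>i<d. \<bar>A $$ (i, i)\<bar>)"
    using assms by (auto simp: mtrace_def row_sum_bound_def)
  also have "\<dots> \<le> (\<Sum>i<d. a)"
  proof (intro sum_mono)
    fix i assume "i \<in> {..<d}"
    then have "\<bar>A $$ (i, i)\<bar> \<le> (\<Sum>j<d. \<bar>A $$ (i, j)\<bar>)"
      by (intro member_le_sum[of i "{..<d}" "\<lambda>j. \<bar>A $$ (i, j)\<bar>"]) auto
    then show "\<bar>A $$ (i, i)\<bar> \<le> a"
      using assms \<open>i \<in> _\<close> by (fastforce simp: row_sum_bound_def)
  qed
  finally show ?thesis by simp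
qed

lemma minus_add_minus_mat:
  fixes A B C :: "real mat"
  assumes "A \<in> carrier_mat n m" "B \<in> carrier_mat n m" "C \<in> carrier_mat n m"
  shows "(A - B) + (B - C) = A - C"
  using assms by (intro eq_matI) auto

text \<open>Telescoping: U^(j+1) - V^(j+1) = U^j (U - V) + (U^j - V^j) V. Each of the
  \<open>Suc k\<close> terms contains one difference and k further factors, which explains the
  exponent of c.\<close>

lemma row_sum_bound_pow_diff:
  fixes c e :: real
  assumes U: "row_sum_bound d c U" and V: "row_sum_bound d c V"
    and e: "row_sum_bound d e (U - V)" and c: "0 \<le> c" and e0: "0 \<le> e"
  shows "row_sum_bound d (Suc k * (c ^ k * e)) (U ^\<^sub>m Suc k - V ^\<^sub>m Suc k)"
proof (induction k)
  case 0
  then show ?case using e U V by (auto simp: row_sum_bound_def)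
next
  case (Suc k)
  note [simp] = row_sum_bound_carrier[OF U] row_sum_bound_carrier[OF V]
  let ?X = "U ^\<^sub>m Suc k" and ?Y = "V ^\<^sub>m Suc k"
  have [simp]: "?X \<in> carrier_mat d d" "?Y \<in> carrier_mat d d" by (simp_all del: pow_mat.simps)
  have "U ^\<^sub>m Suc (Suc k) - V ^\<^sub>m Suc (Suc k) = ?X * U - ?Y * V" by simp
  also have "\<dots> = ?X * (U - V) + (?X - ?Y) * V"
  proof -
    have "?X * (U - V) + (?X - ?Y) * V = (?X * U - ?X * V) + (?X * V - ?Y * V)"
      by (simp add: mult_minus_distrib_mat[of _ d d _ d] minus_mult_distrib_mat[of _ d d _ _ d] del: pow_mat.simps)
    also have "\<dots> = ?X * U - ?Y * V"
      by (rule minus_add_minus_mat[of _ d d]) simp_all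
    finally show ?thesis by simp
  qed
  finally have eq: "U ^\<^sub>m Suc (Suc k) - V ^\<^sub>m Suc (Suc k) = ?X * (U - V) + (?X - ?Y) * V" .
  have "row_sum_bound d (c ^ Suc k * e + (Suc k * (c ^ k * e)) * c) (?X * (U - V) + (?X - ?Y) * V)"
    using Suc U V e c e0
    by (intro row_sum_bound_add row_sum_bound_mult row_sum_bound_pow) auto
  also have "c ^ Suc k * e + (Suc k * (c ^ k * e)) * c = Suc (Suc k) * (c ^ Suc k * e)"
    by (simp add: algebra_simps)
  finally show ?case unfolding eq .
qed

section \<open>A Golden-Thompson inequality\<close>

lemma smult_mat_mult_vec:
  fixes A :: "real mat"
  assumes "A \<in> carrier_mat n m" "v \<in> carrier_vec m"
  shows "(c \<cdot>\<^sub>m A) *\<^sub>v v = c \<cdot>\<^sub>v (A *\<^sub>v v)"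
  using assms by (intro eq_vecI) auto

lemma transpose_smult: "(c \<cdot>\<^sub>m A)\<^sup>T = c \<cdot>\<^sub>m (A :: real mat)\<^sup>T"
  by (intro eq_matI) auto

lemma smult_smult_mat: "a \<cdot>\<^sub>m (b \<cdot>\<^sub>m A) = (a * b) \<cdot>\<^sub>m (A :: real mat)"
  by (intro eq_matI) auto

text \<open>The exponent is a power of two because the trace inequalities are proved by repeated
  squaring.\<close>

abbreviation approx_exp :: "nat \<Rightarrow> nat \<Rightarrow> real mat \<Rightarrow> real mat" where
  "approx_exp d k S \<equiv> (1\<^sub>m d + (1 / 2 ^ k) \<cdot>\<^sub>m S) ^\<^sub>m (2 ^ k)"

text \<open>With h = 1 / 2^k, the matrices 1 + h (S + X) and (1 + h S) (1 + h X) differ by h^2 S X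
  only. Passing to the power 2^k multiplies the difference by at most a constant times 2^k, so an
  error of order h remains. The trace inequality for products of symmetric matrices then separates
  the two factors.\<close>

lemma perturbed_pow2_trace:
  assumes S: "S \<in> carrier_mat d d" and X: "X \<in> carrier_mat d d"
    and sym: "S\<^sup>T = S" "X\<^sup>T = X" and \<epsilon>: "0 < (\<epsilon>::real)"
  shows "\<forall>\<^sub>F k in sequentially.
    mtrace (approx_exp d k (S + X))
    \<le> mtrace (approx_exp d k S * approx_exp d k X) + \<epsilon>"
proof -
  obtain a1 where a1: "0 \<le> a1" "row_sum_bound d a1 S" by (rule row_sum_bound_exists[OF S])
  obtain a2 where a2: "0 \<le> a2" "row_sum_bound d a2 X" by (rule row_sum_bound_exists[OF X])
  define a where "a = max a1 a2"
  have a: "0 \<le> a" and aS: "row_sum_bound d a S" and aX: "row_sum_bound d a X"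
    using a1 a2 by (auto simp: a_def intro: row_sum_bound_mono)
  have "(\<lambda>k. real d * a\<^sup>2 * exp (2 * a) * (1 / 2 ^ k)) \<longlonglongrightarrow> real d * a\<^sup>2 * exp (2 * a) * 0"
    by (intro tendsto_intros LIMSEQ_divide_realpow_zero) simp
  then have "\<forall>\<^sub>F k in sequentially. real d * a\<^sup>2 * exp (2 * a) * (1 / 2 ^ k) < \<epsilon>"
    using \<epsilon> by (intro order_tendstoD(2)) auto
  moreover have "\<forall>\<^sub>F k::nat in sequentially. 1 \<le> k" by (rule eventually_ge_at_top)
  ultimately show ?thesis
  proof eventually_elim
    case (elim k)
    let ?N = "2 ^ k :: nat"
    define h where "h = 1 / (2 ^ k :: real)"
    have h: "0 < h" by (simp add: h_def)
    let ?P = "1\<^sub>m d + h \<cdot>\<^sub>m S" and ?Q = "1\<^sub>m d + h \<cdot>\<^sub>m X" and ?U = "1\<^sub>m d + h \<cdot>\<^sub>m (S + X)"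
    \<comment> \<open>One bound serves both matrices, because 1 + 2ha <= (1 + ha)^2; its power 2^k
      is at most exp (2a), uniformly in k.\<close>
    define c where "c = (1 + h * a)\<^sup>2"
    have [simp]: "?P \<in> carrier_mat d d" "?Q \<in> carrier_mat d d" "?U \<in> carrier_mat d d"
      using S X by simp_all
    have bP: "row_sum_bound d (1 + h * a) ?P" and bQ: "row_sum_bound d (1 + h * a) ?Q"
      using row_sum_bound_add[OF row_sum_bound_one row_sum_bound_smult, of d a _ h] aS aX h by simp_all
    have bU: "row_sum_bound d c ?U"
    proof -
      have "row_sum_bound d (1 + \<bar>h\<bar> * (a + a)) ?U"
        by (intro row_sum_bound_add row_sum_bound_one row_sum_bound_smult aS aX)
      then show ?thesis
        by (rule row_sum_bound_mono) (use h a in \<open>auto simp: c_def power2_eq_square algebra_simps\<close>)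
    qed
    have bV: "row_sum_bound d c (?P * ?Q)"
      unfolding c_def power2_eq_square using h a by (intro row_sum_bound_mult bP bQ) auto
    have "?U - ?P * ?Q = (- (h * h)) \<cdot>\<^sub>m (S * X)"
    proof -
      have "?P * ?Q = 1\<^sub>m d + h \<cdot>\<^sub>m X + (h \<cdot>\<^sub>m S + (h * h) \<cdot>\<^sub>m (S * X))"
        using S X by (simp add: add_mult_distrib_mat[of _ d d _ _ d] mult_add_distrib_mat[of _ d d _ d]
            mult_smult_distrib[of _ d d _ d] mult_smult_assoc_mat[of _ d d _ d] smult_smult_mat)
          (intro eq_matI; auto simp: algebra_simps simp del: index_mult_mat(1))
      then show ?thesis using S X
        by (intro eq_matI) (auto simp: algebra_simps simp del: index_mult_mat(1))
    qed
    moreover have "row_sum_bound d (\<bar>- (h * h)\<bar> * (a * a)) ((- (h * h)) \<cdot>\<^sub>m (S * X))"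
      by (intro row_sum_bound_smult row_sum_bound_mult aS aX a)
    ultimately have bD: "row_sum_bound d (h\<^sup>2 * a\<^sup>2) (?U - ?P * ?Q)"
      by (simp add: power2_eq_square)
    have c: "1 \<le> c" using h a by (simp add: c_def)
    have N: "?N = Suc (?N - 1)" by simp
    have "row_sum_bound d (Suc (?N - 1) * (c ^ (?N - 1) * (h\<^sup>2 * a\<^sup>2))) (?U ^\<^sub>m ?N - (?P * ?Q) ^\<^sub>m ?N)"
      using row_sum_bound_pow_diff[OF bU bV bD, of "?N - 1"] c N by simp
    from abs_mtrace_le[OF this]
    have "\<bar>mtrace (?U ^\<^sub>m ?N) - mtrace ((?P * ?Q) ^\<^sub>m ?N)\<bar> \<le> d * (?N * (c ^ (?N - 1) * (h\<^sup>2 * a\<^sup>2)))"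
      by (simp add: mtrace_diff[of _ d])
    also have "\<dots> \<le> d * (?N * (exp (2 * a) * (h\<^sup>2 * a\<^sup>2)))"
    proof -
      have "c ^ (?N - 1) \<le> c ^ ?N" using c by (intro power_increasing) auto
      also have "\<dots> = (1 + h * a) ^ (2 * ?N)" by (simp add: c_def power_mult)
      also have "\<dots> \<le> exp (h * a) ^ (2 * ?N)"
        using h a by (intro power_mono) (auto simp: exp_ge_add_one_self)
      also have "\<dots> = exp (2 * a)"
        by (simp add: h_def flip: exp_of_nat_mult)
      finally show ?thesis by (intro mult_left_mono mult_right_mono) auto
    qed
    also have "\<dots> = real d * a\<^sup>2 * exp (2 * a) * h" by (simp add: h_def power2_eq_square)
    also have "\<dots> < \<epsilon>" using elim by (simp add: h_def)
    finally have 1: "mtrace (?U ^\<^sub>m ?N) \<le> mtrace ((?P * ?Q) ^\<^sub>m ?N) + \<epsilon>" by simp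
    \<comment> \<open>The product inequality starts at exponent 2, hence k >= 1.\<close>
    obtain k' where k': "k = Suc k'" using elim by (cases k) auto
    have "mtrace ((?P * ?Q) ^\<^sub>m ?N) \<le> mtrace (?P ^\<^sub>m ?N * ?Q ^\<^sub>m ?N)"
    proof -
      have "?P\<^sup>T = ?P" "?Q\<^sup>T = ?Q"
        using sym S X by (auto simp: transpose_add[of _ d d] transpose_smult)
      then show ?thesis
        using abs_mtrace_pow2_mult_le[of ?P d ?Q k'] by (simp add: k' del: pow_mat.simps power_Suc)
    qed
    with 1 show ?case by (simp add: h_def)
  qed
qed

text \<open>The remainder is kept in the sandwiched form T R T. For symmetric T its quadratic form
  at z is then bounded by a multiple of |T z|^2, the quantity that the variance controls.\<close>

lemma pow_one_plus_second_order:
  assumes T: "T \<in> carrier_mat d d" and t: "0 \<le> t"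
    and bd: "\<And>z. z \<in> carrier_vec d \<Longrightarrow> vnorm (T *\<^sub>v z) \<le> t * vnorm z"
  shows "\<exists>R\<in>carrier_mat d d. (1\<^sub>m d + T) ^\<^sub>m k = 1\<^sub>m d + real k \<cdot>\<^sub>m T + T * R * T
    \<and> (\<forall>z\<in>carrier_vec d. vnorm (R *\<^sub>v z) \<le> (real k)\<^sup>2 * (1 + t) ^ k * vnorm z)"
proof (induction k)
  case 0
  have "0\<^sub>m d d *\<^sub>v z = 0\<^sub>v d" if "z \<in> carrier_vec d" for z :: "real vec"
    using that by (intro eq_vecI) auto
  then show ?case using T by (intro bexI[of _ "0\<^sub>m d d"]) auto
next
  case (Suc k)
  then obtain R where R: "R \<in> carrier_mat d d"
    and eq: "(1\<^sub>m d + T) ^\<^sub>m k = 1\<^sub>m d + real k \<cdot>\<^sub>m T + T * R * T"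
    and le: "\<And>z. z \<in> carrier_vec d \<Longrightarrow> vnorm (R *\<^sub>v z) \<le> (real k)\<^sup>2 * (1 + t) ^ k * vnorm z"
    by blast
  \<comment> \<open>Multiplying 1 + k T + T R T by 1 + T leaves the second-order terms k T^2 + T R T
    + T R T^2 = T (k + R + R T) T.\<close>
  define R' where "R' = real k \<cdot>\<^sub>m 1\<^sub>m d + (R + R * T)"
  have R': "R' \<in> carrier_mat d d" using R T by (simp add: R'_def)
  have "(1\<^sub>m d + T) ^\<^sub>m Suc k = (1\<^sub>m d + real k \<cdot>\<^sub>m T + T * R * T) * (1\<^sub>m d + T)"
    using eq T by simp
  also have "\<dots> = 1\<^sub>m d + real k \<cdot>\<^sub>m T + T * R * T + (T + real k \<cdot>\<^sub>m (T * T) + T * R * T * T)"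
    using T R by (simp add: add_mult_distrib_mat[of _ d d _ _ d] mult_add_distrib_mat[of _ d d _ d]
            mult_smult_assoc_mat[of _ d d _ d])
  also have "\<dots> = 1\<^sub>m d + real (Suc k) \<cdot>\<^sub>m T + (real k \<cdot>\<^sub>m (T * T) + (T * R * T + T * R * T * T))"
    using T R by (intro eq_matI) (auto simp: algebra_simps simp del: index_mult_mat(1))
  also have "real k \<cdot>\<^sub>m (T * T) + (T * R * T + T * R * T * T) = T * R' * T"
    using T R by (simp add: R'_def add_mult_distrib_mat[of _ d d _ _ d] mult_add_distrib_mat[of _ d d _ d]
            mult_smult_assoc_mat[of _ d d _ d] mult_smult_distrib[of _ d d _ d] assoc_mult_mat[of _ d d _ d _ d])
  finally have "(1\<^sub>m d + T) ^\<^sub>m Suc k = 1\<^sub>m d + real (Suc k) \<cdot>\<^sub>m T + T * R' * T" .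
  moreover have "vnorm (R' *\<^sub>v z) \<le> (real (Suc k))\<^sup>2 * (1 + t) ^ Suc k * vnorm z"
    if z: "z \<in> carrier_vec d" for z
  proof -
    have "R' *\<^sub>v z = real k \<cdot>\<^sub>v z + (R *\<^sub>v z + R *\<^sub>v (T *\<^sub>v z))"
      unfolding R'_def using R T z
      by (simp add: add_mult_distrib_mat_vec[of _ d d] smult_mat_mult_vec[of _ d d]
          assoc_mult_mat_vec[of _ d d _ d])
    then have "vnorm (R' *\<^sub>v z) \<le> vnorm (real k \<cdot>\<^sub>v z) + (vnorm (R *\<^sub>v z) + vnorm (R *\<^sub>v (T *\<^sub>v z)))"
      using R T z vnorm_triangle[of "real k \<cdot>\<^sub>v z" d "R *\<^sub>v z + R *\<^sub>v (T *\<^sub>v z)"]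
        vnorm_triangle[of "R *\<^sub>v z" d "R *\<^sub>v (T *\<^sub>v z)"] by simp
    also have "\<dots> \<le> real k * vnorm z + ((real k)\<^sup>2 * (1 + t) ^ k * vnorm z + (real k)\<^sup>2 * (1 + t) ^ k * (t * vnorm z))"
    proof -
      have "vnorm (R *\<^sub>v (T *\<^sub>v z)) \<le> (real k)\<^sup>2 * (1 + t) ^ k * vnorm (T *\<^sub>v z)"
        using T z by (intro le) simp
      also have "\<dots> \<le> (real k)\<^sup>2 * (1 + t) ^ k * (t * vnorm z)"
        using t by (intro mult_left_mono bd z) auto
      finally show ?thesis using le[OF z] by (simp add: vnorm_smult)
    qed
    also have "\<dots> = (real k + (real k)\<^sup>2 * (1 + t) ^ Suc k) * vnorm z"
      by (simp add: algebra_simps)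
    also have "\<dots> \<le> (real k * (1 + t) ^ Suc k + (real k)\<^sup>2 * (1 + t) ^ Suc k) * vnorm z"
      using one_le_power[of "1 + t" "Suc k"] t
      by (intro mult_right_mono add_right_mono) (auto simp: mult_le_cancel_left1 simp del: power_Suc)
    also have "\<dots> = (real k + (real k)\<^sup>2) * (1 + t) ^ Suc k * vnorm z"
      by (simp add: algebra_simps)
    also have "\<dots> \<le> (real (Suc k))\<^sup>2 * (1 + t) ^ Suc k * vnorm z"
      using t by (intro mult_right_mono) (auto simp: power2_eq_square algebra_simps)
    finally show ?thesis .
  qed
  ultimately show ?case using R' by blast
qed

lemma scalar_prod_symmetric_mat:
  fixes A :: "real mat"
  assumes "A \<in> carrier_mat d d" "A\<^sup>T = A" "u \<in> carrier_vec d" "v \<in> carrier_vec d"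
  shows "u \<bullet> (A *\<^sub>v v) = (A *\<^sub>v u) \<bullet> v"
  using assms transpose_vec_mult_scalar[of A d d u v]
  by (metis comm_scalar_prod mult_mat_vec_carrier)

text \<open>The matrix form of exp x <= 1 + x + 3 x^2 for |x| <= 1. With T = X / N, the factor N^2
  in the remainder bound cancels against the two outer factors 1 / N, and (1 + 1 / N)^N <= exp 1 <=
  3.\<close>

lemma quadratic_form_pow_le:
  assumes X: "X \<in> carrier_mat d d" and sym: "X\<^sup>T = X" and N: "0 < N"
    and bd: "\<And>z. z \<in> carrier_vec d \<Longrightarrow> vnorm (X *\<^sub>v z) \<le> vnorm z"
    and z: "z \<in> carrier_vec d"
  shows "z \<bullet> ((1\<^sub>m d + (1 / real N) \<cdot>\<^sub>m X) ^\<^sub>m N *\<^sub>v z) \<le> z \<bullet> z + z \<bullet> (X *\<^sub>v z) + 3 * (vnorm (X *\<^sub>v z))\<^sup>2"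
proof -
  define h where "h = 1 / real N"
  have h: "0 < h" "real N * h = 1" using N by (auto simp: h_def)
  let ?T = "h \<cdot>\<^sub>m X"
  have T: "?T \<in> carrier_mat d d" using X by simp
  have Tz: "?T *\<^sub>v u = h \<cdot>\<^sub>v (X *\<^sub>v u)" if "u \<in> carrier_vec d" for u
    using X that by (simp add: smult_mat_mult_vec[of _ d d])
  have "vnorm (?T *\<^sub>v u) \<le> h * vnorm u" if "u \<in> carrier_vec d" for u
    using h bd[OF that] by (simp add: Tz[OF that] vnorm_smult)
  then obtain R where R: "R \<in> carrier_mat d d"
    and eq: "(1\<^sub>m d + ?T) ^\<^sub>m N = 1\<^sub>m d + real N \<cdot>\<^sub>m ?T + ?T * R * ?T"
    and le: "\<And>z. z \<in> carrier_vec d \<Longrightarrow> vnorm (R *\<^sub>v z) \<le> (real N)\<^sup>2 * (1 + h) ^ N * vnorm z"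
    using pow_one_plus_second_order[OF T, of h N] h by auto
  let ?w = "X *\<^sub>v z"
  have w: "?w \<in> carrier_vec d" using X z by simp
  have [simp]: "R *\<^sub>v ?w \<in> carrier_vec d" using R w by simp
  have NT: "real N \<cdot>\<^sub>m ?T = X" using h by (intro eq_matI) auto
  have "(1\<^sub>m d + ?T) ^\<^sub>m N *\<^sub>v z = z + ?w + ?T *\<^sub>v (R *\<^sub>v (?T *\<^sub>v z))"
    unfolding eq NT using X R z T mult_mat_vec_carrier[OF T z]
    by (simp add: add_mult_distrib_mat_vec[of _ d d] assoc_mult_mat_vec[of _ d d _ d])
  also have "?T *\<^sub>v (R *\<^sub>v (?T *\<^sub>v z)) = (h * h) \<cdot>\<^sub>v (X *\<^sub>v (R *\<^sub>v ?w))"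
    using X R z w by (simp add: Tz mult_mat_vec[of _ d d] smult_smult_assoc mult_mat_vec_carrier)
  finally have "z \<bullet> ((1\<^sub>m d + ?T) ^\<^sub>m N *\<^sub>v z) = z \<bullet> z + z \<bullet> ?w + (h * h) * (?w \<bullet> (R *\<^sub>v ?w))"
    using X R z w scalar_prod_symmetric_mat[OF X sym z, of "R *\<^sub>v ?w"]
    by (simp add: scalar_prod_add_distrib[of _ d] mult_mat_vec_carrier)
  also have "(h * h) * (?w \<bullet> (R *\<^sub>v ?w)) \<le> (h * h) * (vnorm ?w * ((real N)\<^sup>2 * (1 + h) ^ N * vnorm ?w))"
    using scalar_prod_le_vnorm[OF w, of "R *\<^sub>v ?w"] mult_left_mono[OF le[OF w], of "vnorm ?w"] h
    by (intro mult_left_mono) auto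
  also have "\<dots> = (real N * h)\<^sup>2 * (1 + h) ^ N * (vnorm ?w)\<^sup>2"
    by (simp add: power2_eq_square)
  also have "\<dots> \<le> 3 * (vnorm ?w)\<^sup>2"
  proof -
    have "(1 + h) ^ N \<le> exp h ^ N" using h by (intro power_mono) (auto simp: exp_ge_add_one_self)
    also have "\<dots> = exp 1" using h by (simp flip: exp_of_nat_mult)
    also have "\<dots> \<le> 3" by (rule exp_le)
    finally show ?thesis unfolding h by (simp add: mult_right_mono)
  qed
  finally show ?thesis by (simp add: h_def)
qed

(* For k -> infinity this tends to 2 tr (cosh S - 1). *)
definition trace_cosh :: "nat \<Rightarrow> nat \<Rightarrow> real mat \<Rightarrow> real" where
  "trace_cosh d k S = mtrace (approx_exp d k S)
     + mtrace (approx_exp d k (- S)) - 2 * real d"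

section \<open>The potential and one step of its recursion\<close>

lemma psd_one: "psd d (1\<^sub>m d)"
  by (auto simp: psd_def simp flip: vnorm_square)

lemma trace_cosh_nonneg:
  assumes "S \<in> carrier_mat d d" "S\<^sup>T = S"
  shows "0 \<le> trace_cosh d k S"
proof -
  have "2 * mtrace (1\<^sub>m d) \<le> mtrace (approx_exp d k S * 1\<^sub>m d)
     + mtrace (approx_exp d k (- S) * 1\<^sub>m d)"
  proof (intro mtrace_pow2_sum_ge[of _ d] psd_one)
    show "1\<^sub>m d + (1 / 2 ^ k) \<cdot>\<^sub>m S + (1\<^sub>m d + (1 / 2 ^ k) \<cdot>\<^sub>m - S) = 2 \<cdot>\<^sub>m 1\<^sub>m d"
      using assms by (intro eq_matI) auto
  qed (use assms in \<open>simp_all add: transpose_add[of _ d d] transpose_uminus transpose_smult\<close>)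
  then show ?thesis using assms by (simp add: trace_cosh_def mtrace_one)
qed

lemma uminus_add_mat':
  fixes A B :: "real mat"
  assumes "A \<in> carrier_mat n m" "B \<in> carrier_mat n m"
  shows "- (A + B) = - A + - B"
  using assms by (intro eq_matI) auto

text \<open>An even power of the symmetric P is a square, so the trace is a sum of quadratic forms
  at the columns of P^k. At each column the second-order bound is summed over J: the linear terms
  cancel, and the quadratic ones are bounded through B.\<close>

lemma sum_mtrace_pow_le:
  assumes J: "finite J"
    and P: "P \<in> carrier_mat d d" "P\<^sup>T = P" and B: "B \<in> carrier_mat d d" and N: "0 < N"
    and X: "\<And>j. j \<in> J \<Longrightarrow> X j \<in> carrier_mat d d" "\<And>j. j \<in> J \<Longrightarrow> (X j)\<^sup>T = X j"
    and bd: "\<And>j z. j \<in> J \<Longrightarrow> z \<in> carrier_vec d \<Longrightarrow> vnorm (X j *\<^sub>v z) \<le> vnorm z"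
    and mean: "\<And>z. z \<in> carrier_vec d \<Longrightarrow> (\<Sum>j\<in>J. z \<bullet> (X j *\<^sub>v z)) = 0"
    and var: "\<And>z. z \<in> carrier_vec d \<Longrightarrow>
      (\<Sum>j\<in>J. (vnorm (X j *\<^sub>v z))\<^sup>2) \<le> real (card J) * (\<beta> * (z \<bullet> (B *\<^sub>v z)))"
  shows "(\<Sum>j\<in>J. mtrace (P ^\<^sub>m (2 * k) * (1\<^sub>m d + (1 / real N) \<cdot>\<^sub>m X j) ^\<^sub>m N))
    \<le> real (card J) * (mtrace (P ^\<^sub>m (2 * k)) + 3 * \<beta> * mtrace (P ^\<^sub>m (2 * k) * B))"
proof -
  let ?R = "P ^\<^sub>m k"
  let ?Y = "\<lambda>j. (1\<^sub>m d + (1 / real N) \<cdot>\<^sub>m X j) ^\<^sub>m N"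
  define r where "r i = col ?R i" for i
  have R: "?R \<in> carrier_mat d d" "?R\<^sup>T = ?R"
    by (simp only: pow_carrier_mat P(1)) (simp only: transpose_pow_mat[OF P(1)] P(2))
  have r: "r i \<in> carrier_vec d" if "i < d" for i using R(1) that unfolding r_def by (auto intro: col_carrier_vec)
  have sq: "P ^\<^sub>m (2 * k) = ?R * ?R" unfolding mult_2 by (rule pow_mat_add[OF P(1)])
  have tr: "mtrace (P ^\<^sub>m (2 * k) * Y) = (\<Sum>i<d. r i \<bullet> (Y *\<^sub>v r i))" if "Y \<in> carrier_mat d d" for Y
    unfolding sq r_def using R that by (intro mtrace_square_mult)
  have Y: "?Y j \<in> carrier_mat d d" if "j \<in> J" for j using X that by simp
  have "(\<Sum>j\<in>J. mtrace (P ^\<^sub>m (2 * k) * ?Y j)) = (\<Sum>j\<in>J. \<Sum>i<d. r i \<bullet> (?Y j *\<^sub>v r i))"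
    using Y by (intro sum.cong) (auto simp: tr)
  also have "\<dots> = (\<Sum>i<d. \<Sum>j\<in>J. r i \<bullet> (?Y j *\<^sub>v r i))" by (rule sum.swap)
  also have "\<dots> \<le> (\<Sum>i<d. real (card J) * (r i \<bullet> r i + 3 * \<beta> * (r i \<bullet> (B *\<^sub>v r i))))"
  proof (intro sum_mono)
    fix i assume "i \<in> {..<d}"
    then have ri: "r i \<in> carrier_vec d" using r by simp
    have "(\<Sum>j\<in>J. r i \<bullet> (?Y j *\<^sub>v r i))
      \<le> (\<Sum>j\<in>J. r i \<bullet> r i + r i \<bullet> (X j *\<^sub>v r i) + 3 * (vnorm (X j *\<^sub>v r i))\<^sup>2)"
      using X bd N ri by (intro sum_mono quadratic_form_pow_le) auto
    also have "\<dots> = real (card J) * (r i \<bullet> r i) + 3 * (\<Sum>j\<in>J. (vnorm (X j *\<^sub>v r i))\<^sup>2)"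
      by (simp add: sum.distrib mean[OF ri] sum_distrib_left)
    also have "\<dots> \<le> real (card J) * (r i \<bullet> r i) + 3 * (real (card J) * (\<beta> * (r i \<bullet> (B *\<^sub>v r i))))"
      using var[OF ri] by simp
    finally show "(\<Sum>j\<in>J. r i \<bullet> (?Y j *\<^sub>v r i)) \<le> real (card J) * (r i \<bullet> r i + 3 * \<beta> * (r i \<bullet> (B *\<^sub>v r i)))"
      by (simp add: algebra_simps)
  qed
  also have "\<dots> = real (card J) * ((\<Sum>i<d. r i \<bullet> (1\<^sub>m d *\<^sub>v r i)) + 3 * \<beta> * (\<Sum>i<d. r i \<bullet> (B *\<^sub>v r i)))"
    using r by (simp add: sum.distrib sum_distrib_left distrib_left)
  also have "\<dots> = real (card J) * (mtrace (P ^\<^sub>m (2 * k)) + 3 * \<beta> * mtrace (P ^\<^sub>m (2 * k) * B))"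
    using tr[of "1\<^sub>m d"] tr[OF B] P by simp
  finally show ?thesis .
qed

text \<open>As J is finite, one threshold for k makes the Golden-Thompson error small for all
  increments simultaneously.\<close>

lemma sum_mtrace_approx_exp_le:
  assumes J: "finite J"
    and S: "S \<in> carrier_mat d d" "S\<^sup>T = S" and B: "B \<in> carrier_mat d d"
    and X: "\<And>j. j \<in> J \<Longrightarrow> X j \<in> carrier_mat d d" "\<And>j. j \<in> J \<Longrightarrow> (X j)\<^sup>T = X j"
    and bd: "\<And>j z. j \<in> J \<Longrightarrow> z \<in> carrier_vec d \<Longrightarrow> vnorm (X j *\<^sub>v z) \<le> vnorm z"
    and mean: "\<And>z. z \<in> carrier_vec d \<Longrightarrow> (\<Sum>j\<in>J. z \<bullet> (X j *\<^sub>v z)) = 0"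
    and var: "\<And>z. z \<in> carrier_vec d \<Longrightarrow>
      (\<Sum>j\<in>J. (vnorm (X j *\<^sub>v z))\<^sup>2) \<le> real (card J) * (\<beta> * (z \<bullet> (B *\<^sub>v z)))"
    and \<epsilon>: "0 < (\<epsilon>::real)"
  shows "\<forall>\<^sub>F k in sequentially. (\<Sum>j\<in>J. mtrace (approx_exp d k (S + X j)))
    \<le> real (card J) * (mtrace (approx_exp d k S) + 3 * \<beta> * mtrace (approx_exp d k S * B)) + real (card J) * \<epsilon>"
proof -
  have "\<forall>\<^sub>F k in sequentially. \<forall>j\<in>J. mtrace (approx_exp d k (S + X j))
    \<le> mtrace (approx_exp d k S * approx_exp d k (X j)) + \<epsilon>"
    using J X S \<epsilon> by (intro eventually_ball_finite ballI perturbed_pow2_trace) auto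
  moreover have "\<forall>\<^sub>F k::nat in sequentially. 1 \<le> k" by (rule eventually_ge_at_top)
  ultimately show ?thesis
  proof eventually_elim
    case (elim k)
    \<comment> \<open>For k >= 1 the exponent 2^k is twice 2^(k-1), so the weight is a
      square.\<close>
    obtain k' where k': "k = Suc k'" using elim(2) by (cases k) auto
    let ?P = "1\<^sub>m d + (1 / 2 ^ k) \<cdot>\<^sub>m S"
    have P: "?P \<in> carrier_mat d d" "?P\<^sup>T = ?P"
      using S by (simp_all add: transpose_add[of _ d d] transpose_smult)
    have "(\<Sum>j\<in>J. mtrace (approx_exp d k (S + X j)))
      \<le> (\<Sum>j\<in>J. mtrace (approx_exp d k S * approx_exp d k (X j)) + \<epsilon>)"
      using elim by (intro sum_mono) auto
    also have "\<dots> \<le> real (card J) * (mtrace (approx_exp d k S) + 3 * \<beta> * mtrace (approx_exp d k S * B)) + real (card J) * \<epsilon>"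
      using sum_mtrace_pow_le[OF J P B _ X bd mean var, of "2 ^ k" "2 ^ k'"]
      by (simp add: sum.distrib k')
    finally show ?case .
  qed
qed

text \<open>The two signs together contribute 3 \<beta> tr((exp S + exp (-S)) B). The lower bound
  for powers of matrices with P + Q = 2, taken against the weight 1 - B, bounds this by 3 \<beta>
  times \<open>trace_cosh\<close> plus 6 \<beta> tr B. The dimension d has cancelled, and tr B is
  the only inhomogeneous term apart from the error \<open>\<epsilon>\<close>.\<close>

lemma trace_cosh_step:
  assumes J: "finite J"
    and S: "S \<in> carrier_mat d d" "S\<^sup>T = S"
    and B: "psd d B" "psd d (1\<^sub>m d - B)" and \<beta>: "0 \<le> \<beta>"
    and X: "\<And>j. j \<in> J \<Longrightarrow> X j \<in> carrier_mat d d" "\<And>j. j \<in> J \<Longrightarrow> (X j)\<^sup>T = X j"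
    and bd: "\<And>j z. j \<in> J \<Longrightarrow> z \<in> carrier_vec d \<Longrightarrow> vnorm (X j *\<^sub>v z) \<le> vnorm z"
    and mean: "\<And>z. z \<in> carrier_vec d \<Longrightarrow> (\<Sum>j\<in>J. z \<bullet> (X j *\<^sub>v z)) = 0"
    and var: "\<And>z. z \<in> carrier_vec d \<Longrightarrow>
      (\<Sum>j\<in>J. (vnorm (X j *\<^sub>v z))\<^sup>2) \<le> real (card J) * (\<beta> * (z \<bullet> (B *\<^sub>v z)))"
    and \<epsilon>: "0 < (\<epsilon>::real)"
  shows "\<forall>\<^sub>F k in sequentially. (\<Sum>j\<in>J. trace_cosh d k (S + X j))
    \<le> real (card J) * ((1 + 3 * \<beta>) * trace_cosh d k S + 6 * \<beta> * mtrace B + \<epsilon>)"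
proof -
  have Bc: "B \<in> carrier_mat d d" using B by (simp add: psd_def)
  have \<beta>3: "0 \<le> 3 * \<beta>" using \<beta> by simp
  have arith: "a + b - c * (2 * D) \<le> c * ((1 + 3 * \<beta>) * (p + q - 2 * D) + 6 * \<beta> * t + \<epsilon>)"
    if "a \<le> c * (p + 3 * \<beta> * u) + c * (\<epsilon> / 2)" "b \<le> c * (q + 3 * \<beta> * v) + c * (\<epsilon> / 2)"
      "c * (3 * \<beta> * (u + v)) \<le> c * (3 * \<beta> * (p + q - 2 * (D - t)))" for a b c D p q t u v
    using that by (simp add: algebra_simps)
  have arith': "u + v \<le> p + q - 2 * (D - t)" if "x = D - t" "2 * x \<le> p - u + (q - v)"
    for x D t p q u v :: real using that by simp
  have neg: "(- X j) *\<^sub>v z = (-1) \<cdot>\<^sub>v (X j *\<^sub>v z)" if "j \<in> J" "z \<in> carrier_vec d" for j z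
    using X(1)[OF that(1)] that(2) by (intro eq_vecI) auto
  have "\<forall>\<^sub>F k in sequentially. (\<Sum>j\<in>J. mtrace (approx_exp d k (- S + - X j)))
    \<le> real (card J) * (mtrace (approx_exp d k (- S)) + 3 * \<beta> * mtrace (approx_exp d k (- S) * B)) + real (card J) * (\<epsilon> / 2)"
  proof (rule sum_mtrace_approx_exp_le[OF J _ _ Bc])
    fix z :: "real vec" assume z: "z \<in> carrier_vec d"
    have "(\<Sum>j\<in>J. z \<bullet> (- X j *\<^sub>v z)) = (\<Sum>j\<in>J. - (z \<bullet> (X j *\<^sub>v z)))"
      using mult_mat_vec_carrier[OF X(1) z] z by (intro sum.cong) (auto simp: neg)
    then show "(\<Sum>j\<in>J. z \<bullet> (- X j *\<^sub>v z)) = 0" using mean[OF z] by (simp add: sum_negf)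
    show "(\<Sum>j\<in>J. (vnorm (- X j *\<^sub>v z))\<^sup>2) \<le> real (card J) * (\<beta> * (z \<bullet> (B *\<^sub>v z)))"
      using var[OF z] z by (simp add: neg vnorm_smult)
  qed (use S X bd \<epsilon> in \<open>auto simp: neg vnorm_smult transpose_uminus\<close>)
  moreover have "\<forall>\<^sub>F k in sequentially. (\<Sum>j\<in>J. mtrace (approx_exp d k (S + X j)))
    \<le> real (card J) * (mtrace (approx_exp d k S) + 3 * \<beta> * mtrace (approx_exp d k S * B)) + real (card J) * (\<epsilon> / 2)"
    by (rule sum_mtrace_approx_exp_le[OF J S Bc X bd mean var half_gt_zero[OF \<epsilon>]])
  ultimately show ?thesis
  proof eventually_elim
    case (elim k)
    let ?P = "1\<^sub>m d + (1 / 2 ^ k) \<cdot>\<^sub>m S" and ?Q = "1\<^sub>m d + (1 / 2 ^ k) \<cdot>\<^sub>m (- S)"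
    let ?p = "mtrace (approx_exp d k S)" and ?q = "mtrace (approx_exp d k (- S))"
    let ?pB = "mtrace (approx_exp d k S * B)" and ?qB = "mtrace (approx_exp d k (- S) * B)"
    have P: "?P \<in> carrier_mat d d" "?P\<^sup>T = ?P" and Q: "?Q \<in> carrier_mat d d" "?Q\<^sup>T = ?Q"
      using S by (simp_all add: transpose_add[of _ d d] transpose_uminus transpose_smult)
    have 3: "2 * mtrace (1\<^sub>m d - B) \<le> mtrace (?P ^\<^sub>m (2 ^ k) * (1\<^sub>m d - B)) + mtrace (?Q ^\<^sub>m (2 ^ k) * (1\<^sub>m d - B))"
    proof (rule mtrace_pow2_sum_ge[OF P(1) Q(1) P(2) Q(2) B(2)])
      show "?P + ?Q = 2 \<cdot>\<^sub>m 1\<^sub>m d" using S by (intro eq_matI) auto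
    qed
    have PB: "mtrace (U ^\<^sub>m (2 ^ k) * (1\<^sub>m d - B)) = mtrace (U ^\<^sub>m (2 ^ k)) - mtrace (U ^\<^sub>m (2 ^ k) * B)"
      if "U \<in> carrier_mat d d" for U
      using that Bc by (simp add: mult_minus_distrib_mat[of _ d d _ d] mtrace_diff[of _ d])
    have "mtrace (1\<^sub>m d - B) = real d - mtrace B"
      using Bc mtrace_diff[of "1\<^sub>m d" d B] by (simp add: mtrace_one)
    then have "?pB + ?qB \<le> ?p + ?q - 2 * (real d - mtrace B)"
      using 3 unfolding PB[OF P(1)] PB[OF Q(1)] by (rule arith')
    from mult_left_mono[OF mult_left_mono[OF this \<beta>3] of_nat_0_le_iff]
    have 4: "real (card J) * (3 * \<beta> * (?pB + ?qB))
      \<le> real (card J) * (3 * \<beta> * (?p + ?q - 2 * (real d - mtrace B)))" .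
    have "trace_cosh d k (S + X j) = mtrace (approx_exp d k (S + X j))
      + mtrace (approx_exp d k (- S + - X j)) - 2 * real d" if "j \<in> J" for j
      unfolding trace_cosh_def uminus_add_mat'[OF S(1) X(1)[OF that]] by (rule refl)
    then have "(\<Sum>j\<in>J. trace_cosh d k (S + X j)) = (\<Sum>j\<in>J. mtrace (approx_exp d k (S + X j))
      + mtrace (approx_exp d k (- S + - X j)) - 2 * real d)"
      by (rule sum.cong[OF refl])
    also have "\<dots> = (\<Sum>j\<in>J. mtrace (approx_exp d k (S + X j)))
      + (\<Sum>j\<in>J. mtrace (approx_exp d k (- S + - X j))) - real (card J) * (2 * real d)"
      unfolding sum_subtractf sum.distrib sum_constant by (rule refl)
    also have "\<dots> \<le> real (card J) * ((1 + 3 * \<beta>) * trace_cosh d k S + 6 * \<beta> * mtrace B + \<epsilon>)"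
      using elim(2,1) 4 unfolding trace_cosh_def by (rule arith)
    finally show ?case .
  qed
qed

lemma pow_mat_eigenvector:
  fixes A :: "real mat"
  assumes A: "A \<in> carrier_mat d d" and u: "u \<in> carrier_vec d" and eq: "A *\<^sub>v u = a \<cdot>\<^sub>v u"
  shows "A ^\<^sub>m k *\<^sub>v u = a ^ k \<cdot>\<^sub>v u"
proof (induction k)
  case (Suc k)
  have "A ^\<^sub>m Suc k *\<^sub>v u = A ^\<^sub>m k *\<^sub>v (a \<cdot>\<^sub>v u)"
    using A u eq by (simp add: assoc_mult_mat_vec[of _ d d _ d])
  also have "\<dots> = a ^ Suc k \<cdot>\<^sub>v u"
    using A u Suc by (simp add: mult_mat_vec[of _ d d] smult_smult_assoc)
  finally show ?case .
qed (use A u in simp)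

section \<open>Eigenvalues of symmetric matrices\<close>

lemma operator_bound_exists:
  fixes A :: "real mat"
  assumes "A \<in> carrier_mat d d"
  obtains c where "0 < c" "\<And>z. z \<in> carrier_vec d \<Longrightarrow> vnorm (A *\<^sub>v z) \<le> c * vnorm z"
proof -
  let ?c = "\<Sum>i<d. vnorm (row A i)"
  have "vnorm (A *\<^sub>v z) \<le> (?c + 1) * vnorm z" if z: "z \<in> carrier_vec d" for z
  proof -
    have "vnorm (A *\<^sub>v z) = L2_set (\<lambda>i. (A *\<^sub>v z) $ i) {..<d}"
      using carrier_matD(1)[OF assms] by (simp only: vnorm_L2_set dim_mult_mat_vec)
    also have "\<dots> \<le> (\<Sum>i<d. \<bar>(A *\<^sub>v z) $ i\<bar>)"
      by (rule L2_set_le_sum_abs)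
    also have "\<dots> \<le> (\<Sum>i<d. vnorm (row A i) * vnorm z)"
    proof (rule sum_mono)
      fix i assume "i \<in> {..<d}"
      then have i: "i < d" by simp
      then have "(A *\<^sub>v z) $ i = row A i \<bullet> z"
        using carrier_matD(1)[OF assms] by (intro index_mult_mat_vec) (simp only:)
      then show "\<bar>(A *\<^sub>v z) $ i\<bar> \<le> vnorm (row A i) * vnorm z"
        using scalar_prod_le_vnorm[OF row_carrier_vec[OF i assms] z] by (simp only:)
    qed
    also have "\<dots> \<le> (?c + 1) * vnorm z" by (simp add: sum_distrib_right distrib_right)
    finally show ?thesis .
  qed
  moreover have "0 < ?c + 1" by (intro add_nonneg_pos sum_nonneg) auto
  ultimately show ?thesis using that by blast
qed

text \<open>D^2 <= c D for 0 <= D <= c, obtained without a square root of D: positivity of D is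
  evaluated at the vector c z - D z.\<close>

lemma psd_norm_square_le:
  assumes D: "psd d D" "D\<^sup>T = D" and c: "0 < c"
    and bd: "\<And>z. z \<in> carrier_vec d \<Longrightarrow> vnorm (D *\<^sub>v z) \<le> c * vnorm z" and z: "z \<in> carrier_vec d"
  shows "(vnorm (D *\<^sub>v z))\<^sup>2 \<le> c * (z \<bullet> (D *\<^sub>v z))"
proof -
  have Dc: "D \<in> carrier_mat d d" using D by (simp add: psd_def)
  let ?w = "D *\<^sub>v z"
  have w: "?w \<in> carrier_vec d" using Dc z by simp
  have Dw: "D *\<^sub>v ?w \<in> carrier_vec d" using Dc w by simp
  let ?v = "c \<cdot>\<^sub>v z - ?w"
  have "0 \<le> ?v \<bullet> (D *\<^sub>v ?v)" using D z w by (simp add: psd_def)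
  also have "D *\<^sub>v ?v = c \<cdot>\<^sub>v ?w - D *\<^sub>v ?w"
    using Dc z w by (simp add: mult_minus_distrib_mat_vec[of _ d d] mult_mat_vec[of _ d d])
  also have "?v \<bullet> (c \<cdot>\<^sub>v ?w - D *\<^sub>v ?w)
    = c * (c * (z \<bullet> ?w)) - c * (z \<bullet> (D *\<^sub>v ?w)) - (c * (?w \<bullet> ?w) - ?w \<bullet> (D *\<^sub>v ?w))"
    using z w Dw by (simp add: minus_scalar_prod_distrib[of _ d] scalar_prod_minus_distrib[of _ d] right_diff_distrib)
  also have "z \<bullet> (D *\<^sub>v ?w) = ?w \<bullet> ?w"
    using scalar_prod_symmetric_mat[OF Dc D(2) z w] .
  also have "?w \<bullet> (D *\<^sub>v ?w) \<le> c * (?w \<bullet> ?w)"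
  proof -
    have "?w \<bullet> (D *\<^sub>v ?w) \<le> vnorm ?w * vnorm (D *\<^sub>v ?w)"
      using scalar_prod_le_vnorm[OF w Dw] by simp
    also have "\<dots> \<le> vnorm ?w * (c * vnorm ?w)" by (intro mult_left_mono bd w) simp
    finally show ?thesis by (simp add: power2_eq_square mult_ac flip: vnorm_square)
  qed
  finally have "0 \<le> c * (c * (z \<bullet> ?w) - ?w \<bullet> ?w)" by (simp add: algebra_simps)
  then show ?thesis using c by (simp add: zero_le_mult_iff vnorm_square)
qed

(* If l is the supremum of the Rayleigh quotient of K and l - K were invertible, then l - K would be
   bounded below by a positive constant, so l would not be the least upper bound. *)
lemma max_eigenvalue_exists:
  fixes K :: "real mat"
  assumes K: "K \<in> carrier_mat d d" "K\<^sup>T = K" and d: "0 < d"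
  obtains l u where "u \<in> carrier_vec d" "u \<noteq> 0\<^sub>v d" "K *\<^sub>v u = l \<cdot>\<^sub>v u"
    "\<And>z. z \<in> carrier_vec d \<Longrightarrow> z \<bullet> (K *\<^sub>v z) \<le> l * (z \<bullet> z)"
proof -
  define Q where "Q = {z \<bullet> (K *\<^sub>v z) | z. z \<in> carrier_vec d \<and> vnorm z = 1}"
  define l where "l = Sup Q"
  obtain c where c: "0 < c" "\<And>z. z \<in> carrier_vec d \<Longrightarrow> vnorm (K *\<^sub>v z) \<le> c * vnorm z"
    using operator_bound_exists[OF K(1)] by metis
  have bdd: "bdd_above Q"
  proof (rule bdd_aboveI)
    fix q assume "q \<in> Q"
    then obtain z where z: "z \<in> carrier_vec d" "vnorm z = 1" "q = z \<bullet> (K *\<^sub>v z)" by (auto simp: Q_def)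
    have "z \<bullet> (K *\<^sub>v z) \<le> vnorm z * vnorm (K *\<^sub>v z)"
      using scalar_prod_le_vnorm[of z d "K *\<^sub>v z"] K z by simp
    then show "q \<le> c" using c(2)[OF z(1)] z by simp
  qed
  have scale: "\<exists>q\<in>Q. z \<bullet> (K *\<^sub>v z) = q * (z \<bullet> z)" if z: "z \<in> carrier_vec d" "z \<noteq> 0\<^sub>v d" for z
  proof -
    have nz: "0 < vnorm z" using z by (intro vnorm_pos)
    let ?y = "(1 / vnorm z) \<cdot>\<^sub>v z"
    have "?y \<bullet> (K *\<^sub>v ?y) * (z \<bullet> z) = z \<bullet> (K *\<^sub>v z)"
      using z K nz mult_mat_vec_carrier[OF K(1) z(1)]
      by (simp add: mult_mat_vec[of _ d d] field_simps power2_eq_square flip: vnorm_square)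
    moreover have "?y \<bullet> (K *\<^sub>v ?y) \<in> Q"
      unfolding Q_def using z nz by (auto simp: vnorm_smult intro!: exI[of _ ?y])
    ultimately show ?thesis by (metis)
  qed
  have e0: "unit_vec d 0 \<noteq> 0\<^sub>v d" using d by (metis index_unit_vec(2) index_zero_vec(1) zero_neq_one)
  have ne: "Q \<noteq> {}" using scale[OF unit_vec_carrier e0] by blast
  have upper: "z \<bullet> (K *\<^sub>v z) \<le> l * (z \<bullet> z)" if z: "z \<in> carrier_vec d" for z
  proof (cases "z = 0\<^sub>v d")
    case False
    then obtain q where q: "q \<in> Q" "z \<bullet> (K *\<^sub>v z) = q * (z \<bullet> z)" using scale z by blast
    have "q \<le> l" unfolding l_def using q(1) bdd by (rule cSup_upper)
    then show ?thesis unfolding q by (intro mult_right_mono) (simp_all flip: vnorm_square)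
  qed (use K in simp)
  define D where "D = l \<cdot>\<^sub>m 1\<^sub>m d - K"
  have D: "D \<in> carrier_mat d d" using K by (simp add: D_def minus_carrier_mat)
  have Dz: "D *\<^sub>v z = l \<cdot>\<^sub>v z - K *\<^sub>v z" if "z \<in> carrier_vec d" for z
    using that K unfolding D_def
    by (simp add: minus_mult_distrib_mat_vec[of _ d d] smult_mat_mult_vec[of _ d d])
  have zDz: "z \<bullet> (D *\<^sub>v z) = l * (z \<bullet> z) - z \<bullet> (K *\<^sub>v z)" if "z \<in> carrier_vec d" for z
    using that mult_mat_vec_carrier[OF K(1) that] by (simp add: Dz scalar_prod_minus_distrib[of _ d])
  have psdD: "psd d D" using D upper by (simp add: psd_def zDz)
  have symD: "D\<^sup>T = D" using K by (simp add: D_def transpose_minus[of _ d d] transpose_smult)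
  have "Determinant.det D = 0"
  proof (rule ccontr)
    assume "Determinant.det D \<noteq> 0"
    then have "D \<in> Units (ring_mat TYPE(real) d ())"
      by (rule det_non_zero_imp_unit[OF D])
    then obtain D' where D': "D' \<in> carrier_mat d d" "D' * D = 1\<^sub>m d"
      unfolding Units_def by (auto simp: ring_mat_def)
    obtain a where a: "0 < a" "\<And>z. z \<in> carrier_vec d \<Longrightarrow> vnorm (D' *\<^sub>v z) \<le> a * vnorm z"
      using operator_bound_exists[OF D'(1)] by metis
    obtain b where b: "0 < b" "\<And>z. z \<in> carrier_vec d \<Longrightarrow> vnorm (D *\<^sub>v z) \<le> b * vnorm z"
      using operator_bound_exists[OF D] by metis
    \<comment> \<open>The gap: 1 = |z| <= a |D z| by the inverse, and |D z|^2 <= b (z . D z), so z .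
      D z >= 1 / (a^2 b) on the unit sphere.\<close>
    have "q \<le> l - 1 / (a\<^sup>2 * b)" if q: "q \<in> Q" for q
    proof -
      obtain z where z: "z \<in> carrier_vec d" "vnorm z = 1" "q = z \<bullet> (K *\<^sub>v z)" using q by (auto simp: Q_def)
      have "D' *\<^sub>v (D *\<^sub>v z) = z" using D' D z by (simp flip: assoc_mult_mat_vec[of _ d d _ d])
      then have "1 \<le> a * vnorm (D *\<^sub>v z)" using a(2)[of "D *\<^sub>v z"] D z by simp
      then have "1 \<le> (a * vnorm (D *\<^sub>v z))\<^sup>2" by simp
      also have "\<dots> \<le> a\<^sup>2 * (b * (z \<bullet> (D *\<^sub>v z)))"
        unfolding power_mult_distrib
        by (intro mult_left_mono psd_norm_square_le[OF psdD symD] b z) auto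
      finally have "1 / (a\<^sup>2 * b) \<le> z \<bullet> (D *\<^sub>v z)"
        using a(1) b(1) by (simp add: field_simps)
      then show ?thesis using z by (simp add: zDz flip: vnorm_square)
    qed
    then have "l \<le> l - 1 / (a\<^sup>2 * b)" unfolding l_def by (intro cSup_least ne)
    moreover have "0 < 1 / (a\<^sup>2 * b)" using a(1) b(1) by simp
    ultimately show False by linarith
  qed
  then obtain u where u: "u \<in> carrier_vec d" "u \<noteq> 0\<^sub>v d" "D *\<^sub>v u = 0\<^sub>v d"
    using det_0_iff_vec_prod_zero[OF D] by blast
  have "K *\<^sub>v u = l \<cdot>\<^sub>v u"
  proof (rule eq_vecI)
    fix i assume "i < dim_vec (l \<cdot>\<^sub>v u)"
    then have i: "i < d" using u by simp
    have "(l \<cdot>\<^sub>v u - K *\<^sub>v u) $ i = 0" using u i by (simp flip: Dz)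
    then show "(K *\<^sub>v u) $ i = (l \<cdot>\<^sub>v u) $ i" using u i K by simp
  qed (use u K in simp)
  then show ?thesis using that u upper by blast
qed

text \<open>A top eigenvector u of Z^2 has an eigenvalue r^2 >= t^2, and (Z - r) (Z + r) u = 0. So
  either (Z + r) u is an eigenvector of Z for r, or it vanishes and u is an eigenvector for
  -r.\<close>

lemma large_eigenvalue_exists:
  fixes Z :: "real mat"
  assumes Z: "Z \<in> carrier_mat d d" "Z\<^sup>T = Z" and z: "z \<in> carrier_vec d" "z \<noteq> 0\<^sub>v d"
    and t: "0 \<le> t" "t * vnorm z \<le> vnorm (Z *\<^sub>v z)"
  obtains r u where "u \<in> carrier_vec d" "u \<noteq> 0\<^sub>v d" "Z *\<^sub>v u = r \<cdot>\<^sub>v u" "t \<le> \<bar>r\<bar>"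
proof -
  have d: "0 < d" using z by (cases d) auto
  have sym: "(Z * Z)\<^sup>T = Z * Z" using Z by (simp add: transpose_mult_square_mat[of _ d])
  obtain l u where u: "u \<in> carrier_vec d" "u \<noteq> 0\<^sub>v d" "(Z * Z) *\<^sub>v u = l \<cdot>\<^sub>v u"
    and upper: "\<And>z. z \<in> carrier_vec d \<Longrightarrow> z \<bullet> ((Z * Z) *\<^sub>v z) \<le> l * (z \<bullet> z)"
    using max_eigenvalue_exists[OF mult_square_mat_closed[OF Z(1) Z(1)] sym d] by blast
  have nz: "0 < vnorm z" using z by (intro vnorm_pos)
  have Zw: "Z *\<^sub>v w \<in> carrier_vec d" if "w \<in> carrier_vec d" for w using Z that by simp
  have "t\<^sup>2 * (vnorm z)\<^sup>2 \<le> (vnorm (Z *\<^sub>v z))\<^sup>2"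
    using t by (metis power_mono power_mult_distrib mult_nonneg_nonneg vnorm_nonneg)
  also have "\<dots> = z \<bullet> ((Z * Z) *\<^sub>v z)"
    using scalar_prod_symmetric_mat[OF Z z(1) Zw[OF z(1)]] Z z
    by (simp add: vnorm_square assoc_mult_mat_vec[of _ d d _ d])
  also have "\<dots> \<le> l * (vnorm z)\<^sup>2" using upper[OF z(1)] by (simp add: vnorm_square)
  finally have l: "t\<^sup>2 \<le> l" using nz by simp
  define r where "r = sqrt l"
  have r: "t \<le> r" "r * r = l" "0 \<le> r"
    using l t real_le_rsqrt[OF l] order_trans[OF zero_le_power2 l] by (auto simp: r_def)
  have ZZu: "Z *\<^sub>v (Z *\<^sub>v u) = l \<cdot>\<^sub>v u" using assoc_mult_mat_vec[OF Z(1) Z(1) u(1)] u(3) by metis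
  define v where "v = Z *\<^sub>v u + r \<cdot>\<^sub>v u"
  have v: "v \<in> carrier_vec d" using Z u by (simp add: v_def)
  have Zv: "Z *\<^sub>v v = r \<cdot>\<^sub>v v"
  proof -
    have "Z *\<^sub>v v = l \<cdot>\<^sub>v u + r \<cdot>\<^sub>v (Z *\<^sub>v u)"
      using Z u Zw[OF u(1)] ZZu by (simp add: v_def mult_add_distrib_mat_vec[of _ d d] mult_mat_vec[of _ d d])
    also have "\<dots> = r \<cdot>\<^sub>v v"
    proof (rule eq_vecI)
      fix i assume "i < dim_vec (r \<cdot>\<^sub>v v)"
      then have i: "i < d" using v by simp
      show "(l \<cdot>\<^sub>v u + r \<cdot>\<^sub>v (Z *\<^sub>v u)) $ i = (r \<cdot>\<^sub>v v) $ i"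
        using u(1) Zw[OF u(1)] i unfolding v_def r(2)[symmetric]
        by (simp add: distrib_left mult.assoc carrier_matD(1)[OF Z(1)] carrier_vecD[OF u(1)] del: index_mult_mat_vec)
    qed (use carrier_vecD[OF u(1)] carrier_vecD[OF v] carrier_matD(1)[OF Z(1)] in simp)
    finally show ?thesis .
  qed
  show ?thesis
  proof (cases "v = 0\<^sub>v d")
    case True
    have "Z *\<^sub>v u = (- r) \<cdot>\<^sub>v u"
    proof (rule eq_vecI)
      fix i assume "i < dim_vec ((- r) \<cdot>\<^sub>v u)"
      then have i: "i < d" using u by simp
      have "(Z *\<^sub>v u + r \<cdot>\<^sub>v u) $ i = 0" using True i unfolding v_def by simp
      then show "(Z *\<^sub>v u) $ i = ((- r) \<cdot>\<^sub>v u) $ i"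
        using i by (simp add: carrier_matD(1)[OF Z(1)] carrier_vecD[OF u(1)])
    qed (simp add: carrier_matD(1)[OF Z(1)] carrier_vecD[OF u(1)])
    then show ?thesis using r(1,3) by (intro that[OF u(1,2)]) auto
  next
    case False
    then show ?thesis using r(1,3) by (intro that[OF v _ Zv]) auto
  qed
qed

section \<open>Sampling without replacement\<close>

text \<open>The sum of the outer products of the vectors \<open>y t\<close> with themselves. The
  entrywise form carries the dimension even for empty T, and a singleton T provides a single outer
  product.\<close>

definition gram :: "nat \<Rightarrow> (nat \<Rightarrow> real vec) \<Rightarrow> nat set \<Rightarrow> real mat" where
  "gram d y T = mat d d (\<lambda>(i, j). \<Sum>t\<in>T. y t $ i * y t $ j)"

lemma gram_carrier [simp]: "gram d y T \<in> carrier_mat d d"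
  by (simp add: gram_def)

lemma dim_gram [simp]: "dim_row (gram d y T) = d" "dim_col (gram d y T) = d"
  by (simp_all add: gram_def)

lemma index_gram: "i < d \<Longrightarrow> j < d \<Longrightarrow> gram d y T $$ (i, j) = (\<Sum>t\<in>T. y t $ i * y t $ j)"
  by (simp add: gram_def)

lemma transpose_gram [simp]: "(gram d y T)\<^sup>T = gram d y T"
  by (intro eq_matI) (auto simp: index_gram mult.commute)

lemma index_gram_mult_vec:
  assumes "\<And>t. t \<in> T \<Longrightarrow> y t \<in> carrier_vec d" "z \<in> carrier_vec d" "i < d"
  shows "(gram d y T *\<^sub>v z) $ i = (\<Sum>t\<in>T. (y t \<bullet> z) * y t $ i)"
proof -
  have "(gram d y T *\<^sub>v z) $ i = (\<Sum>j<d. (\<Sum>t\<in>T. y t $ i * y t $ j) * z $ j)"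
    using assms by (auto simp: scalar_prod_def index_gram lessThan_atLeast0 intro!: sum.cong)
  also have "\<dots> = (\<Sum>t\<in>T. (y t \<bullet> z) * y t $ i)"
    using assms unfolding sum_distrib_right
    by (subst sum.swap)
      (auto simp: scalar_prod_def lessThan_atLeast0 sum_distrib_right sum_distrib_left mult_ac intro!: sum.cong)
  finally show ?thesis .
qed

lemma quadratic_form_gram:
  assumes "\<And>t. t \<in> T \<Longrightarrow> y t \<in> carrier_vec d" "u \<in> carrier_vec d" "z \<in> carrier_vec d"
  shows "u \<bullet> (gram d y T *\<^sub>v z) = (\<Sum>t\<in>T. (y t \<bullet> u) * (y t \<bullet> z))"
proof -
  have "u \<bullet> (gram d y T *\<^sub>v z) = (\<Sum>i<d. u $ i * (\<Sum>t\<in>T. (y t \<bullet> z) * y t $ i))"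
    unfolding scalar_prod_def[of u] dim_mult_mat_vec dim_gram lessThan_atLeast0
    using assms by (intro sum.cong refl) (simp add: index_gram_mult_vec del: index_mult_mat_vec)
  also have "\<dots> = (\<Sum>t\<in>T. (y t \<bullet> u) * (y t \<bullet> z))"
    using assms unfolding sum_distrib_left
    by (subst sum.swap)
      (auto simp: scalar_prod_def[of _ u] lessThan_atLeast0 sum_distrib_right sum_distrib_left mult_ac intro!: sum.cong)
  finally show ?thesis .
qed

lemma mtrace_gram:
  assumes "\<And>t. t \<in> T \<Longrightarrow> y t \<in> carrier_vec d"
  shows "mtrace (gram d y T) = (\<Sum>t\<in>T. (vnorm (y t))\<^sup>2)"
proof -
  have "mtrace (gram d y T) = (\<Sum>i<d. \<Sum>t\<in>T. y t $ i * y t $ i)"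
    by (simp add: mtrace_def index_gram)
  also have "\<dots> = (\<Sum>t\<in>T. (vnorm (y t))\<^sup>2)"
    using assms by (subst sum.swap) (simp add: vnorm_square scalar_prod_def lessThan_atLeast0 carrier_vecD[OF assms])
  finally show ?thesis .
qed

lemma mtrace_gram_mult:
  assumes A: "A \<in> carrier_mat d d" and y: "y t \<in> carrier_vec d"
  shows "mtrace (A * gram d y {t}) = y t \<bullet> (A *\<^sub>v y t)"
  using assms
  by (auto simp: mtrace_mult[of _ d] index_gram scalar_prod_def[of "y t"] lessThan_atLeast0
      scalar_prod_def sum_distrib_left mult_ac intro!: sum.cong)

text \<open>The identity is split, up to the factor |u|^2, into the outer product of an eigenvector
  u with itself and the positive semidefinite rest. The rest contributes at least its value at Z =
  0, which the subtraction of 2d cancels; the direction of u contributes (1 + r / 2^k)^(2^k) and its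
  counterpart for -r, which tend to exp r and exp (-r). As cosh is even, the sign of r is
  irrelevant.\<close>

lemma trace_cosh_eventually_ge:
  assumes Z: "Z \<in> carrier_mat d d" "Z\<^sup>T = Z" and z: "z \<in> carrier_vec d" "z \<noteq> 0\<^sub>v d"
    and t: "0 \<le> t" "t * vnorm z \<le> vnorm (Z *\<^sub>v z)" and \<epsilon>: "0 < \<epsilon>"
  shows "\<forall>\<^sub>F k in sequentially. 2 * (cosh t - 1) - \<epsilon> \<le> trace_cosh d k Z"
proof -
  obtain r u where u: "u \<in> carrier_vec d" "u \<noteq> 0\<^sub>v d" "Z *\<^sub>v u = r \<cdot>\<^sub>v u" and r: "t \<le> \<bar>r\<bar>"
    using large_eigenvalue_exists[OF Z z t] .
  have nu: "0 < vnorm u" using u by (intro vnorm_pos)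
  define nn where "nn = (vnorm u)\<^sup>2"
  have nn: "0 < nn" using nu by (simp add: nn_def)
  have uu: "u \<bullet> u = nn" by (simp add: nn_def vnorm_square)
  have ge: "(1 + r / 2 ^ k) ^ (2 ^ k) + (1 + (- r) / 2 ^ k) ^ (2 ^ k) - 2 \<le> trace_cosh d k Z" for k
  proof -
    let ?P = "1\<^sub>m d + (1 / 2 ^ k) \<cdot>\<^sub>m Z" and ?Q = "1\<^sub>m d + (1 / 2 ^ k) \<cdot>\<^sub>m (- Z)"
    let ?O = "gram d (\<lambda>_. u) {0::nat}"
    let ?Y = "nn \<cdot>\<^sub>m 1\<^sub>m d - ?O"
    have P: "?P \<in> carrier_mat d d" "?P\<^sup>T = ?P" and Q: "?Q \<in> carrier_mat d d" "?Q\<^sup>T = ?Q"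
      using Z by (simp_all add: transpose_add[of _ d d] transpose_uminus transpose_smult)
    have Y: "?Y \<in> carrier_mat d d" by (simp add: minus_carrier_mat)
    have "psd d ?Y"
      unfolding psd_def
    proof (intro conjI ballI Y)
      fix w :: "real vec" assume w: "w \<in> carrier_vec d"
      have "?Y *\<^sub>v w = nn \<cdot>\<^sub>v w - ?O *\<^sub>v w"
        using w by (simp add: minus_mult_distrib_mat_vec[of _ d d] smult_mat_mult_vec[of _ d d])
      then have "w \<bullet> (?Y *\<^sub>v w) = nn * (w \<bullet> w) - w \<bullet> (?O *\<^sub>v w)"
        using w mult_mat_vec_carrier[OF gram_carrier w, of "\<lambda>_. u" "{0}"]
        by (simp add: scalar_prod_minus_distrib[of _ d])
      also have "w \<bullet> (?O *\<^sub>v w) = (u \<bullet> w)\<^sup>2"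
        using u w by (simp add: quadratic_form_gram power2_eq_square)
      finally have "w \<bullet> (?Y *\<^sub>v w) = nn * (w \<bullet> w) - (u \<bullet> w)\<^sup>2" .
      moreover have "(u \<bullet> w)\<^sup>2 \<le> (vnorm u * vnorm w)\<^sup>2"
        using scalar_prod_le_vnorm[OF u(1) w] by (metis abs_ge_zero power2_abs power_mono)
      moreover have "(vnorm u * vnorm w)\<^sup>2 = nn * (w \<bullet> w)"
        by (simp add: nn_def power_mult_distrib flip: vnorm_square)
      ultimately show "0 \<le> w \<bullet> (?Y *\<^sub>v w)" by linarith
    qed
    then have le: "2 * mtrace ?Y \<le> mtrace (?P ^\<^sub>m (2 ^ k) * ?Y) + mtrace (?Q ^\<^sub>m (2 ^ k) * ?Y)"
    proof (rule mtrace_pow2_sum_ge[OF P(1) Q(1) P(2) Q(2)])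
      show "?P + ?Q = 2 \<cdot>\<^sub>m 1\<^sub>m d" using Z(1) by (intro eq_matI) auto
    qed
    have tr: "mtrace (A * ?Y) = nn * mtrace A - u \<bullet> (A *\<^sub>v u)" if "A \<in> carrier_mat d d" for A
    proof -
      have "A * ?Y = nn \<cdot>\<^sub>m A - A * ?O"
        using that by (simp add: mult_minus_distrib_mat[of _ d d _ d] mult_smult_distrib[of _ d d _ d])
      then show ?thesis using that u
        by (simp add: mtrace_diff[of _ d] mtrace_smult[of _ d] mtrace_gram_mult)
    qed
    have "mtrace ?Y = nn * d - nn"
      using tr[of "1\<^sub>m d"] u Y by (simp add: mtrace_one uu)
    moreover have "?P *\<^sub>v u = (1 + r / 2 ^ k) \<cdot>\<^sub>v u" "?Q *\<^sub>v u = (1 + (- r) / 2 ^ k) \<cdot>\<^sub>v u"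
    proof -
      have *: "(1\<^sub>m d + c \<cdot>\<^sub>m Z) *\<^sub>v u = (1 + c * r) \<cdot>\<^sub>v u" for c
        using Z(1) u by (simp add: add_mult_distrib_mat_vec[of _ d d] smult_mat_mult_vec[of _ d d]
            add_smult_distrib_vec smult_smult_assoc)
      have "(1 / 2 ^ k) \<cdot>\<^sub>m (- Z) = (- 1 / 2 ^ k) \<cdot>\<^sub>m Z" using Z(1) by (intro eq_matI) auto
      then show "?P *\<^sub>v u = (1 + r / 2 ^ k) \<cdot>\<^sub>v u" "?Q *\<^sub>v u = (1 + (- r) / 2 ^ k) \<cdot>\<^sub>v u"
        using *[of "1 / 2 ^ k"] *[of "- 1 / 2 ^ k"] by simp_all
    qed
    ultimately have "2 * (nn * d - nn) \<le> nn * mtrace (?P ^\<^sub>m (2 ^ k)) - (1 + r / 2 ^ k) ^ (2 ^ k) * nn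
      + (nn * mtrace (?Q ^\<^sub>m (2 ^ k)) - (1 + (- r) / 2 ^ k) ^ (2 ^ k) * nn)"
      using le P Q u by (simp only: tr pow_carrier_mat pow_mat_eigenvector[OF P(1) u(1)]
          pow_mat_eigenvector[OF Q(1) u(1)] scalar_prod_smult_right uu)
    then have "nn * ((1 + r / 2 ^ k) ^ (2 ^ k) + (1 + (- r) / 2 ^ k) ^ (2 ^ k) - 2) \<le> nn * trace_cosh d k Z"
      unfolding trace_cosh_def by (simp only: algebra_simps)
    then show ?thesis using nn by simp
  qed
  have sub: "filterlim (\<lambda>k. 2 ^ k :: nat) sequentially sequentially"
    by (rule filterlim_subseq) (simp add: strict_mono_def)
  have lim: "(\<lambda>k. (1 + x / 2 ^ k) ^ (2 ^ k)) \<longlonglongrightarrow> exp x" for x :: real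
    using filterlim_compose[OF tendsto_exp_limit_sequentially[of x] sub] by simp
  have "(\<lambda>k. (1 + r / 2 ^ k) ^ (2 ^ k) + (1 + (- r) / 2 ^ k) ^ (2 ^ k) - 2) \<longlonglongrightarrow> exp r + exp (- r) - 2"
    by (intro tendsto_intros lim)
  moreover have "2 * (cosh t - 1) - \<epsilon> < exp r + exp (- r) - 2"
  proof -
    have "cosh t \<le> cosh \<bar>r\<bar>" using r t by (subst cosh_real_nonneg_le_iff) auto
    also have "cosh \<bar>r\<bar> = (exp r + exp (- r)) / 2" by (simp add: cosh_def abs_if)
    finally show ?thesis using \<epsilon> by simp
  qed
  ultimately have "\<forall>\<^sub>F k in sequentially.
    2 * (cosh t - 1) - \<epsilon> < (1 + r / 2 ^ k) ^ (2 ^ k) + (1 + (- r) / 2 ^ k) ^ (2 ^ k) - 2"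
    by (rule order_tendstoD)
  then show ?thesis
    by eventually_elim (use ge in \<open>meson less_le_trans less_imp_le\<close>)
qed

section \<open>Uniform subsets and their one-element extensions\<close>

definition k_subsets :: "nat \<Rightarrow> nat \<Rightarrow> nat set set" where
  "k_subsets n k = {T. T \<subseteq> {..<n} \<and> card T = k}"

lemma finite_k_subsets [simp]: "finite (k_subsets n k)"
  by (simp add: k_subsets_def)

lemma card_k_subsets: "card (k_subsets n k) = n choose k"
  using n_subsets[of "{..<n}" k] by (simp add: k_subsets_def)

text \<open>Double counting of pairs (set, new index): every set of size k + 1 arises from k + 1
  pairs. This takes the place of conditioning on the first k draws.\<close>

lemma sum_k_subsets_Suc:
  "real (Suc k) * (\<Sum>T\<in>k_subsets n (Suc k). f T) = (\<Sum>T\<in>k_subsets n k. \<Sum>j\<in>{..<n} - T. f (insert j T))"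
proof -
  have "(\<Sum>T\<in>k_subsets n k. \<Sum>j\<in>{..<n} - T. f (insert j T))
    = (\<Sum>(T, j)\<in>Sigma (k_subsets n k) (\<lambda>T. {..<n} - T). f (insert j T))"
    by (subst sum.Sigma) auto
  also have "\<dots> = (\<Sum>(T, j)\<in>Sigma (k_subsets n (Suc k)) (\<lambda>T. T). f T)"
    by (rule sum.reindex_bij_witness[of _ "\<lambda>(T, j). (T - {j}, j)" "\<lambda>(T, j). (insert j T, j)"])
      (auto simp: k_subsets_def card_insert_if insert_absorb finite_subset[of _ "{..<n}"])
  also have "\<dots> = (\<Sum>T\<in>k_subsets n (Suc k). \<Sum>j\<in>T. f T)"
    by (subst sum.Sigma) (auto simp: k_subsets_def intro: finite_subset[of _ "{..<n}"])
  also have "\<dots> = (\<Sum>T\<in>k_subsets n (Suc k). real (Suc k) * f T)"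
    by (intro sum.cong) (auto simp: k_subsets_def)
  finally show ?thesis by (simp add: sum_distrib_left)
qed

lemma binomial_Suc_real: "k \<le> n \<Longrightarrow> real (Suc k) * real (n choose Suc k) = (real n - real k) * real (n choose k)"
  using sum_k_subsets_Suc[where k = k and n = n and f = "\<lambda>_. 1"]
  by (simp add: card_k_subsets)
     (auto simp: k_subsets_def card_Diff_subset finite_subset[of _ "{..<n}"] of_nat_diff
       card_k_subsets[unfolded k_subsets_def])

(* Dividing by the number of unsampled indices turns the centred sample sum into a martingale. *)
definition centred :: "nat \<Rightarrow> (nat \<Rightarrow> real vec) \<Rightarrow> nat \<Rightarrow> real \<Rightarrow> nat set \<Rightarrow> real mat" where
  "centred d y n c T = (c / (real n - real (card T))) \<cdot>\<^sub>m
     (gram d y T - (real (card T) / real n) \<cdot>\<^sub>m gram d y {..<n})"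

text \<open>The deviation of the outer product of a newly drawn row from the mean over the unsampled
  rows, in the scaling that applies after the draw.\<close>

definition increment :: "nat \<Rightarrow> (nat \<Rightarrow> real vec) \<Rightarrow> nat \<Rightarrow> real \<Rightarrow> nat set \<Rightarrow> nat \<Rightarrow> real mat" where
  "increment d y n c T j = (c / (real n - real (card T) - 1)) \<cdot>\<^sub>m
     (gram d y {j} - (1 / (real n - real (card T))) \<cdot>\<^sub>m gram d y ({..<n} - T))"

lemma centred_carrier [simp]: "centred d y n c T \<in> carrier_mat d d"
  by (simp add: centred_def minus_carrier_mat)

lemma increment_carrier [simp]: "increment d y n c T j \<in> carrier_mat d d"
  by (simp add: increment_def minus_carrier_mat)

lemma transpose_centred: "(centred d y n c T)\<^sup>T = centred d y n c T"
  by (simp add: centred_def transpose_minus[of _ d d] transpose_smult)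

lemma transpose_increment: "(increment d y n c T j)\<^sup>T = increment d y n c T j"
  by (simp add: increment_def transpose_minus[of _ d d] transpose_smult)

lemma centred_insert:
  assumes T: "T \<subseteq> {..<n}" "j < n" "j \<notin> T" and k: "card T + 1 < n"
  shows "centred d y n c (insert j T) = centred d y n c T + increment d y n c T j"
proof (rule eq_matI)
  have fin: "finite T" using T(1) finite_subset by blast
  fix a b assume "a < dim_row (centred d y n c T + increment d y n c T j)"
    "b < dim_col (centred d y n c T + increment d y n c T j)"
  then have ab: "a < d" "b < d" by (auto simp: increment_def)
  define g where "g S = (\<Sum>t\<in>S. y t $ a * y t $ b)" for S
  define k r where "k = real (card T)" and "r = real n"
  have kr: "k + 1 < r" "0 \<le> k" using assms by (auto simp: k_def r_def)
  have ins: "g (insert j T) = g {j} + g T" "real (card (insert j T)) = k + 1"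
    using fin T by (auto simp: g_def k_def)
  have diff: "g ({..<n} - T) = g {..<n} - g T"
    using T(1) by (simp add: g_def sum_diff)
  have "c / (r - (k + 1)) * (g {j} + g T - (k + 1) / r * g {..<n})
    = c / (r - k) * (g T - k / r * g {..<n}) + c / (r - k - 1) * (g {j} - 1 / (r - k) * (g {..<n} - g T))"
  proof -
    \<comment> \<open>In terms of p the denominators are p, p + 1 and p + 1 + k. The strict
      hypothesis \<open>card T + 1 < n\<close> makes p positive.\<close>
    define p where "p = r - k - 1"
    have p: "0 < p" "r - (k + 1) = p" "r - k = p + 1" "r - k - 1 = p" "r = p + 1 + k" using kr by (auto simp: p_def)
    have "p + 1 + k \<noteq> 0" "p + 1 \<noteq> 0" "p \<noteq> 0" using p kr by auto
    then have "c / p * (u + v - (k + 1) / (p + 1 + k) * w)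
      = c / (p + 1) * (v - k / (p + 1 + k) * w) + c / p * (u - 1 / (p + 1) * (w - v))" for u v w
      by (simp add: divide_simps) (simp add: algebra_simps)
    from this[of "g {j}" "g T" "g {..<n}"] show ?thesis
      by (simp only: p(2,3) p(4)[unfolded p(3)] flip: p(5))
  qed
  then show "centred d y n c (insert j T) $$ (a, b) = (centred d y n c T + increment d y n c T j) $$ (a, b)"
    using ab by (simp add: centred_def increment_def index_gram ins(2) k_def[symmetric] r_def[symmetric]
        g_def[symmetric] ins(1) diff)
qed (auto simp: centred_def increment_def)

section \<open>Size, mean and variance of the increments\<close>

lemma quadratic_form_psd_gram:
  assumes "\<And>t. t \<in> T \<Longrightarrow> y t \<in> carrier_vec d"
  shows "psd d (gram d y T)"
  using assms by (auto simp: psd_def quadratic_form_gram intro!: sum_nonneg)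

lemma increment_mult_vec:
  assumes z: "z \<in> carrier_vec d"
  shows "increment d y n c T j *\<^sub>v z = (c / (real n - real (card T) - 1)) \<cdot>\<^sub>v
    (gram d y {j} *\<^sub>v z - (1 / (real n - real (card T))) \<cdot>\<^sub>v (gram d y ({..<n} - T) *\<^sub>v z))"
  unfolding increment_def using z
  by (simp add: smult_mat_mult_vec[of _ d d] minus_mult_distrib_mat_vec[of _ d d] minus_carrier_mat)

lemma gram_singleton_mult_vec:
  assumes "y j \<in> carrier_vec d" "z \<in> carrier_vec d"
  shows "gram d y {j} *\<^sub>v z = (y j \<bullet> z) \<cdot>\<^sub>v y j"
proof (rule eq_vecI)
  fix i assume "i < dim_vec ((y j \<bullet> z) \<cdot>\<^sub>v y j)"
  then have i: "i < d" using assms by simp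
  show "(gram d y {j} *\<^sub>v z) $ i = ((y j \<bullet> z) \<cdot>\<^sub>v y j) $ i"
    using index_gram_mult_vec[of "{j}" y d z i] assms i by (simp del: index_mult_mat_vec)
qed (use assms in simp)

context
  fixes d n :: nat and y :: "nat \<Rightarrow> real vec" and M c :: real
  assumes y: "\<And>t. t < n \<Longrightarrow> y t \<in> carrier_vec d"
    and M: "\<And>t. t < n \<Longrightarrow> (vnorm (y t))\<^sup>2 \<le> M"
    and n: "0 < n"
begin

lemma M_nonneg: "0 \<le> M"
  using M[OF n] by (meson order_trans zero_le_power2)

lemma vnorm_gram_singleton_le:
  assumes "j < n" "z \<in> carrier_vec d"
  shows "vnorm (gram d y {j} *\<^sub>v z) \<le> M * vnorm z"
proof -
  have "vnorm (gram d y {j} *\<^sub>v z) = \<bar>y j \<bullet> z\<bar> * vnorm (y j)"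
    using y[OF assms(1)] assms by (simp add: gram_singleton_mult_vec vnorm_smult)
  also have "\<dots> \<le> (vnorm (y j) * vnorm z) * vnorm (y j)"
    using y[OF assms(1)] assms by (intro mult_right_mono scalar_prod_le_vnorm) auto
  also have "\<dots> = (vnorm (y j))\<^sup>2 * vnorm z" by (simp add: power2_eq_square)
  also have "\<dots> \<le> M * vnorm z" by (intro mult_right_mono M assms) simp
  finally show ?thesis .
qed

lemma vnorm_gram_le:
  assumes "finite T" "T \<subseteq> {..<n}" and z: "z \<in> carrier_vec d"
  shows "vnorm (gram d y T *\<^sub>v z) \<le> real (card T) * (M * vnorm z)"
  using assms(1,2)
proof (induction T rule: finite_induct)
  case empty
  have "gram d y {} *\<^sub>v z = 0\<^sub>v d" using z by (intro eq_vecI) (auto simp: gram_def scalar_prod_def)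
  then show ?case by simp
next
  case (insert j T)
  have "gram d y (insert j T) = gram d y {j} + gram d y T"
    using insert by (intro eq_matI) (auto simp: index_gram)
  then have "vnorm (gram d y (insert j T) *\<^sub>v z) \<le> vnorm (gram d y {j} *\<^sub>v z) + vnorm (gram d y T *\<^sub>v z)"
    using z vnorm_triangle[of "gram d y {j} *\<^sub>v z" d "gram d y T *\<^sub>v z"]
    by (simp add: add_mult_distrib_mat_vec[of _ d d] mult_mat_vec_carrier[OF gram_carrier])
  also have "\<dots> \<le> M * vnorm z + real (card T) * (M * vnorm z)"
    using insert z by (intro add_mono vnorm_gram_singleton_le) auto
  also have "\<dots> = real (card (insert j T)) * (M * vnorm z)"
    using insert by (simp add: distrib_right)
  finally show ?case .
qed

context
  fixes T :: "nat set"
  assumes T: "T \<subseteq> {..<n}" and half: "2 * (card T + 1) \<le> n"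
begin

lemma card_unsampled: "real (card ({..<n} - T)) = real n - real (card T)"
  using T half finite_subset[OF T] by (simp add: card_Diff_subset of_nat_diff)

text \<open>Sampling at most half of the indices keeps every denominator of the martingale of order
  n. All constants for the increments come from this bound.\<close>

lemma n_half: "real n / 2 \<le> real n - real (card T) - 1"
proof -
  have "real (2 * (card T + 1)) \<le> real n" using half of_nat_mono by blast
  then show ?thesis by simp
qed

text \<open>A single outer product and the mean over the unsampled rows each have norm at most M,
  and the prefactor is at most 2c / n. The product 4cM / n is the source of the hypothesis on
  c.\<close>

lemma vnorm_increment_le:
  assumes c: "0 \<le> c" "4 * c * M \<le> real n" and j: "j < n" and z: "z \<in> carrier_vec d"
  shows "vnorm (increment d y n c T j *\<^sub>v z) \<le> vnorm z"
proof -
  let ?r = "real n - real (card T)"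
  have r: "0 < ?r - 1" "0 < ?r" using n_half n by auto
  have "vnorm (gram d y {j} *\<^sub>v z - (1 / ?r) \<cdot>\<^sub>v (gram d y ({..<n} - T) *\<^sub>v z))
    \<le> vnorm (gram d y {j} *\<^sub>v z) + vnorm ((1 / ?r) \<cdot>\<^sub>v (gram d y ({..<n} - T) *\<^sub>v z))"
    using z mult_mat_vec_carrier[OF gram_carrier z] by (intro vnorm_minus[of _ d]) simp_all
  also have "\<dots> \<le> M * vnorm z + 1 / ?r * (?r * (M * vnorm z))"
  proof (intro add_mono vnorm_gram_singleton_le j z)
    show "vnorm ((1 / ?r) \<cdot>\<^sub>v (gram d y ({..<n} - T) *\<^sub>v z)) \<le> 1 / ?r * (?r * (M * vnorm z))"
      unfolding vnorm_smult card_unsampled[symmetric]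
      using r vnorm_gram_le[OF _ _ z, of "{..<n} - T"] by (intro mult_mono) auto
  qed
  also have "\<dots> = 2 * M * vnorm z" using r by simp
  finally have "vnorm (increment d y n c T j *\<^sub>v z) \<le> c / (?r - 1) * (2 * M * vnorm z)"
    unfolding increment_mult_vec[OF z] vnorm_smult using r c(1) by (simp add: mult_left_mono divide_right_mono)
  also have "\<dots> = (2 * c * M / (?r - 1)) * vnorm z" by simp
  also have "\<dots> \<le> 1 * vnorm z"
  proof (rule mult_right_mono)
    have "2 * c * M \<le> ?r - 1" using c(2) n_half by simp
    then show "2 * c * M / (?r - 1) \<le> 1" using r by simp
  qed simp
  finally show ?thesis by simp
qed

text \<open>The martingale property, tested on quadratic forms: deviations from a mean sum to
  0.\<close>

lemma sum_increment_eq_0: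
  assumes z: "z \<in> carrier_vec d"
  shows "(\<Sum>j\<in>{..<n} - T. z \<bullet> (increment d y n c T j *\<^sub>v z)) = 0"
proof -
  let ?r = "real n - real (card T)" and ?J = "{..<n} - T"
  have r: "0 < ?r" using n_half n by auto
  have "z \<bullet> (increment d y n c T j *\<^sub>v z) =
      c / (?r - 1) * ((y j \<bullet> z)\<^sup>2 - 1 / ?r * (\<Sum>t\<in>?J. (y t \<bullet> z)\<^sup>2))" if "j \<in> ?J" for j
  proof -
    have "z \<bullet> (gram d y {j} *\<^sub>v z) = (y j \<bullet> z)\<^sup>2"
      using that y z by (subst quadratic_form_gram) (auto simp: power2_eq_square)
    moreover have "z \<bullet> (gram d y ?J *\<^sub>v z) = (\<Sum>t\<in>?J. (y t \<bullet> z)\<^sup>2)"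
      using y z by (subst quadratic_form_gram) (auto simp: power2_eq_square)
    ultimately show ?thesis
      unfolding increment_mult_vec[OF z] using z mult_mat_vec_carrier[OF gram_carrier z]
      by (simp add: scalar_prod_minus_distrib[of _ d])
  qed
  then have "(\<Sum>j\<in>?J. z \<bullet> (increment d y n c T j *\<^sub>v z))
    = (\<Sum>j\<in>?J. c / (?r - 1) * ((y j \<bullet> z)\<^sup>2 - 1 / ?r * (\<Sum>t\<in>?J. (y t \<bullet> z)\<^sup>2)))"
    by (rule sum.cong[OF refl])
  also have "\<dots> = c / (?r - 1) * ((\<Sum>j\<in>?J. (y j \<bullet> z)\<^sup>2) - real (card ?J) * (1 / ?r * (\<Sum>t\<in>?J. (y t \<bullet> z)\<^sup>2)))"
    by (simp only: sum_distrib_left[symmetric] sum_subtractf sum_constant mult.left_commute)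
  also have "\<dots> = 0" unfolding card_unsampled using r by simp
  finally show ?thesis .
qed

text \<open>Centring at the mean q only lowers the sum of squares, the image of z under one outer
  product has squared norm at most M (y_j . z)^2, and the unsampled indices are enlarged to all
  indices. The bound thus involves the same population matrix for every T. The constant 8 is (1 /
  (1/2))^2 from the prefactor, times 2 because at least n / 2 indices are unsampled.\<close>

lemma sum_vnorm_increment_le:
  assumes z: "z \<in> carrier_vec d"
  shows "(\<Sum>j\<in>{..<n} - T. (vnorm (increment d y n c T j *\<^sub>v z))\<^sup>2)
    \<le> real (card ({..<n} - T)) * ((8 * c\<^sup>2 * M / (real n)\<^sup>2) * (z \<bullet> (((1 / real n) \<cdot>\<^sub>m gram d y {..<n}) *\<^sub>v z)))"
proof -
  let ?r = "real n - real (card T)" and ?J = "{..<n} - T"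
  have r: "0 < ?r" "0 < ?r - 1" "real n / 2 \<le> ?r - 1" "real n / 2 \<le> ?r" using n_half n by auto
  define p where "p j = gram d y {j} *\<^sub>v z" for j
  define q where "q = (1 / ?r) \<cdot>\<^sub>v (gram d y ?J *\<^sub>v z)"
  define G where "G = (\<Sum>t<n. (y t \<bullet> z)\<^sup>2)"
  have pc: "p j \<in> carrier_vec d" for j using z by (simp add: p_def mult_mat_vec_carrier[OF gram_carrier])
  have qc: "q \<in> carrier_vec d" using z by (simp add: q_def mult_mat_vec_carrier[OF gram_carrier])
  have "(\<Sum>j\<in>?J. p j \<bullet> q) = (\<Sum>j\<in>?J. q \<bullet> p j)" using pc qc by (intro sum.cong refl) (rule comm_scalar_prod)
  also have "\<dots> = (\<Sum>j\<in>?J. (y j \<bullet> q) * (y j \<bullet> z))"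
    unfolding p_def using y z qc by (intro sum.cong refl) (subst quadratic_form_gram, auto)
  also have "\<dots> = q \<bullet> (gram d y ?J *\<^sub>v z)"
    using y z qc by (subst quadratic_form_gram) auto
  also have "gram d y ?J *\<^sub>v z = ?r \<cdot>\<^sub>v q"
    using r by (simp add: q_def smult_smult_assoc)
  finally have cross: "(\<Sum>j\<in>?J. p j \<bullet> q) = ?r * (q \<bullet> q)" using qc by simp
  have "(\<Sum>j\<in>?J. (vnorm (p j - q))\<^sup>2) = (\<Sum>j\<in>?J. p j \<bullet> p j - 2 * (p j \<bullet> q) + q \<bullet> q)"
  proof (intro sum.cong refl)
    fix j
    show "(vnorm (p j - q))\<^sup>2 = p j \<bullet> p j - 2 * (p j \<bullet> q) + q \<bullet> q"
      using pc[of j] qc comm_scalar_prod[OF qc pc[of j]]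
      by (simp add: vnorm_square minus_scalar_prod_distrib[of _ d] scalar_prod_minus_distrib[of _ d])
  qed
  also have "\<dots> = (\<Sum>j\<in>?J. p j \<bullet> p j) - 2 * (\<Sum>j\<in>?J. p j \<bullet> q) + real (card ?J) * (q \<bullet> q)"
    by (simp add: sum.distrib sum_subtractf sum_distrib_left)
  also have "\<dots> = (\<Sum>j\<in>?J. p j \<bullet> p j) - ?r * (q \<bullet> q)"
    unfolding cross card_unsampled by simp
  also have "\<dots> \<le> (\<Sum>j\<in>?J. p j \<bullet> p j)"
    using r by (simp flip: vnorm_square)
  also have "\<dots> \<le> (\<Sum>j\<in>?J. M * (y j \<bullet> z)\<^sup>2)"
  proof (rule sum_mono)
    fix j assume j: "j \<in> ?J"
    have "p j \<bullet> p j = (vnorm (y j))\<^sup>2 * (y j \<bullet> z)\<^sup>2"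
      using j y z by (simp add: p_def gram_singleton_mult_vec vnorm_smult power_mult_distrib flip: vnorm_square)
    also have "\<dots> \<le> M * (y j \<bullet> z)\<^sup>2" using j by (intro mult_right_mono M) auto
    finally show "p j \<bullet> p j \<le> M * (y j \<bullet> z)\<^sup>2" .
  qed
  also have "\<dots> \<le> (\<Sum>j<n. M * (y j \<bullet> z)\<^sup>2)"
    using M_nonneg by (intro sum_mono2) auto
  also have "\<dots> = M * G" by (simp add: G_def sum_distrib_left)
  finally have 1: "(\<Sum>j\<in>?J. (vnorm (p j - q))\<^sup>2) \<le> M * G" .
  have "(\<Sum>j\<in>?J. (vnorm (increment d y n c T j *\<^sub>v z))\<^sup>2) = (c / (?r - 1))\<^sup>2 * (\<Sum>j\<in>?J. (vnorm (p j - q))\<^sup>2)"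
    unfolding increment_mult_vec[OF z] vnorm_smult p_def[symmetric] q_def[symmetric]
    by (simp add: power_mult_distrib power_divide sum_distrib_left)
  also have "\<dots> \<le> (c / (real n / 2))\<^sup>2 * (M * G)"
  proof (rule mult_mono[OF _ 1])
    show "(c / (?r - 1))\<^sup>2 \<le> (c / (real n / 2))\<^sup>2"
      unfolding power_divide[of c]
    proof (intro divide_left_mono mult_pos_pos)
      show "(real n / 2)\<^sup>2 \<le> (?r - 1)\<^sup>2" using r(3) by (intro power_mono) auto
    qed (use r n in auto)
  qed (auto intro: sum_nonneg)
  also have "\<dots> = (real n / 2) * ((8 * c\<^sup>2 * M / (real n)\<^sup>2) * (1 / real n * G))"
    using n by (simp add: field_simps power2_eq_square)
  also have "\<dots> \<le> ?r * ((8 * c\<^sup>2 * M / (real n)\<^sup>2) * (1 / real n * G))"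
    using r M_nonneg by (intro mult_right_mono) (auto intro!: mult_nonneg_nonneg divide_nonneg_nonneg sum_nonneg simp: G_def)
  also have "1 / real n * G = z \<bullet> (((1 / real n) \<cdot>\<^sub>m gram d y {..<n}) *\<^sub>v z)"
  proof -
    have "z \<bullet> (gram d y {..<n} *\<^sub>v z) = G"
      unfolding G_def using z y by (subst quadratic_form_gram) (auto simp: power2_eq_square)
    then show ?thesis
      using z mult_mat_vec_carrier[OF gram_carrier z] by (simp add: smult_mat_mult_vec[of _ d d])
  qed
  finally show ?thesis unfolding card_unsampled .
qed

end

end

text \<open>With g = 1 + 3 \<beta>, the mean potential satisfies e_(k+1) <= g e_k + 6 \<beta> D and
  e_0 = 0, up to a vanishing error; the solution of this recursion is 2 D (g^k - 1). Only finitely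
  many steps are taken, so the parameter K can be sent to infinity after them.\<close>

lemma sum_trace_cosh_centred_le:
  assumes y: "\<And>t. t < n \<Longrightarrow> y t \<in> carrier_vec d"
    and M: "\<And>t. t < n \<Longrightarrow> (vnorm (y t))\<^sup>2 \<le> M" and n: "0 < n"
    and B: "psd d (1\<^sub>m d - (1 / real n) \<cdot>\<^sub>m gram d y {..<n})"
    and c: "0 \<le> c" "4 * c * M \<le> real n"
    and D: "D = mtrace ((1 / real n) \<cdot>\<^sub>m gram d y {..<n})"
    and g: "g = 1 + 24 * c\<^sup>2 * M / (real n)\<^sup>2"
    and k: "2 * k \<le> n" and \<epsilon>: "0 < (\<epsilon>::real)"
  shows "\<forall>\<^sub>F K in sequentially. (\<Sum>T\<in>k_subsets n k. trace_cosh d K (centred d y n c T))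
    \<le> real (n choose k) * (2 * D * (g ^ k - 1) + \<epsilon>)"
  using k \<epsilon>
proof (induction k arbitrary: \<epsilon>)
  case 0
  have "k_subsets n 0 = {{}}" by (auto simp: k_subsets_def dest: finite_subset)
  moreover have "centred d y n c {} = 0\<^sub>m d d"
    by (intro eq_matI) (auto simp: centred_def gram_def)
  moreover have "trace_cosh d K (0\<^sub>m d d) = 0" for K
  proof -
    have "1\<^sub>m d + 0\<^sub>m d d = (1\<^sub>m d :: real mat)" "- 0\<^sub>m d d = (0\<^sub>m d d :: real mat)" by (auto intro!: eq_matI)
    moreover have "(1\<^sub>m d :: real mat) ^\<^sub>m i = 1\<^sub>m d" for i by (induction i) auto
    ultimately show ?thesis by (simp add: trace_cosh_def mtrace_one)
  qed
  ultimately show ?case using 0 by simp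
next
  case (Suc k)
  define \<beta> where "\<beta> = 8 * c\<^sup>2 * M / (real n)\<^sup>2"
  have M0: "0 \<le> M" using M[OF n] by (meson order_trans zero_le_power2)
  have \<beta>: "0 \<le> \<beta>" "g = 1 + 3 * \<beta>" using M0 by (simp_all add: \<beta>_def g)
  let ?B = "(1 / real n) \<cdot>\<^sub>m gram d y {..<n}"
  have psdB: "psd d ?B"
    using quadratic_form_psd_gram[of "{..<n}" y d] y
    by (auto simp: psd_def smult_mat_mult_vec[of _ d d])
  \<comment> \<open>The error of the previous stage is multiplied by g and the current stage adds
    one more e, in total (g + 1) e.\<close>
  define e where "e = \<epsilon> / (g + 1)"
  have e: "0 < e" "g * e + e = \<epsilon>"
  proof -
    have g1: "0 < g + 1" using \<beta> by simp
    show "0 < e" using Suc.prems g1 by (simp add: e_def)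
    have "g * e + e = (g + 1) * e" by (simp add: distrib_right)
    then show "g * e + e = \<epsilon>" using g1 by (simp add: e_def)
  qed
  have card_T: "card T = k" "T \<subseteq> {..<n}" if "T \<in> k_subsets n k" for T
    using that by (auto simp: k_subsets_def)
  have step: "\<forall>\<^sub>F K in sequentially. \<forall>T\<in>k_subsets n k.
    (\<Sum>j\<in>{..<n} - T. trace_cosh d K (centred d y n c T + increment d y n c T j))
    \<le> real (card ({..<n} - T)) * ((1 + 3 * \<beta>) * trace_cosh d K (centred d y n c T) + 6 * \<beta> * mtrace ?B + e)"
  proof (intro eventually_ball_finite ballI finite_k_subsets)
    fix T assume T: "T \<in> k_subsets n k"
    note T' = card_T[OF T]
    have half: "2 * (card T + 1) \<le> n" using Suc.prems T' by simp
    show "\<forall>\<^sub>F K in sequentially.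
      (\<Sum>j\<in>{..<n} - T. trace_cosh d K (centred d y n c T + increment d y n c T j))
      \<le> real (card ({..<n} - T)) * ((1 + 3 * \<beta>) * trace_cosh d K (centred d y n c T) + 6 * \<beta> * mtrace ?B + e)"
    proof (rule trace_cosh_step[OF _ centred_carrier transpose_centred psdB B \<beta>(1)
          increment_carrier transpose_increment _ _ _ e(1)])
      show "finite ({..<n} - T)" by simp
      show "vnorm (increment d y n c T j *\<^sub>v z) \<le> vnorm z"
        if "j \<in> {..<n} - T" "z \<in> carrier_vec d" for j z
        using vnorm_increment_le[OF y M n T'(2) half c] that by simp
      show "(\<Sum>j\<in>{..<n} - T. z \<bullet> (increment d y n c T j *\<^sub>v z)) = 0" if "z \<in> carrier_vec d" for z
        by (rule sum_increment_eq_0[OF y M n T'(2) half that])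
      show "(\<Sum>j\<in>{..<n} - T. (vnorm (increment d y n c T j *\<^sub>v z))\<^sup>2)
        \<le> real (card ({..<n} - T)) * (\<beta> * (z \<bullet> (?B *\<^sub>v z)))" if "z \<in> carrier_vec d" for z
        unfolding \<beta>_def by (rule sum_vnorm_increment_le[OF y M n T'(2) half that])
    qed
  qed
  have "\<forall>\<^sub>F K in sequentially. (\<Sum>T\<in>k_subsets n k. trace_cosh d K (centred d y n c T))
    \<le> real (n choose k) * (2 * D * (g ^ k - 1) + e)"
    using Suc.prems e by (intro Suc.IH) auto
  with step show ?case
  proof eventually_elim
    case (elim K)
    define r where "r = real n - real k"
    have r: "0 \<le> r" using Suc.prems by (simp add: r_def)
    have "real (Suc k) * (\<Sum>T\<in>k_subsets n (Suc k). trace_cosh d K (centred d y n c T))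
      = (\<Sum>T\<in>k_subsets n k. \<Sum>j\<in>{..<n} - T. trace_cosh d K (centred d y n c (insert j T)))"
      by (rule sum_k_subsets_Suc)
    also have "\<dots> = (\<Sum>T\<in>k_subsets n k. \<Sum>j\<in>{..<n} - T. trace_cosh d K (centred d y n c T + increment d y n c T j))"
      using Suc.prems card_T by (intro sum.cong refl) (subst centred_insert, auto)
    also have "\<dots> \<le> (\<Sum>T\<in>k_subsets n k. r * (g * trace_cosh d K (centred d y n c T) + (6 * \<beta> * D + e)))"
    proof (rule sum_mono)
      fix T assume T: "T \<in> k_subsets n k"
      have r': "real (card ({..<n} - T)) = r"
        using card_T[OF T] finite_subset[of T "{..<n}"] Suc.prems
        by (simp add: card_Diff_subset of_nat_diff r_def)
      then show "(\<Sum>j\<in>{..<n} - T. trace_cosh d K (centred d y n c T + increment d y n c T j))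
        \<le> r * (g * trace_cosh d K (centred d y n c T) + (6 * \<beta> * D + e))"
        using elim(1)[rule_format, OF T] unfolding \<beta>(2) D r' by (simp only: add.assoc)
    qed
    also have "\<dots> = r * (g * (\<Sum>T\<in>k_subsets n k. trace_cosh d K (centred d y n c T)) + real (n choose k) * (6 * \<beta> * D + e))"
      by (simp add: sum.distrib card_k_subsets flip: sum_distrib_left)
    also have "\<dots> \<le> r * (g * (real (n choose k) * (2 * D * (g ^ k - 1) + e)) + real (n choose k) * (6 * \<beta> * D + e))"
      using elim(2) r \<beta> by (intro mult_left_mono add_right_mono) auto
    also have "\<dots> = r * real (n choose k) * (2 * D * (g * g ^ k - g + 3 * \<beta>) + (g * e + e))"
      by (simp add: algebra_simps)
    also have "r * real (n choose k) = real (Suc k) * real (n choose Suc k)"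
      using binomial_Suc_real[of k n] Suc.prems by (simp add: r_def)
    also have "g * g ^ k - g + 3 * \<beta> = g ^ Suc k - 1" using \<beta> by simp
    finally show ?case unfolding e(2) mult.assoc by (simp add: mult_le_cancel_left_pos del: of_nat_Suc)
  qed
qed

section \<open>The tail bound for the sample error\<close>

lemma cosh_gap: "1 \<le> a \<Longrightarrow> exp (2 * a) / 4 \<le> cosh (2 * a) - (1::real)"
proof -
  assume a: "1 \<le> a"
  have "4 = (2::real)\<^sup>2" by simp
  also have "\<dots> \<le> (exp a)\<^sup>2" using exp_ge_add_one_self[of a] a by (intro power_mono) linarith+
  also have "\<dots> = exp (2 * a)" by (simp flip: exp_double)
  finally have "4 \<le> exp (2 * a)" .
  moreover have "exp (2 * a) / 2 \<le> cosh (2 * a)" by (simp add: cosh_def)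
  ultimately show ?thesis by linarith
qed

definition sample_error :: "nat \<Rightarrow> (nat \<Rightarrow> real vec) \<Rightarrow> nat \<Rightarrow> nat set \<Rightarrow> real mat" where
  "sample_error d y n T = (1 / real (card T)) \<cdot>\<^sub>m gram d y T - (1 / real n) \<cdot>\<^sub>m gram d y {..<n}"

lemma sample_error_carrier [simp]: "sample_error d y n T \<in> carrier_mat d d"
  by (simp add: sample_error_def minus_carrier_mat)

text \<open>Markov's inequality for the potential over all subsets of size s, written as a count. A
  bad subset has potential at least 2 (cosh (2a) - 1), up to an error that disappears in the limit,
  while the mean potential is at most 2 D (g^s - 1) with g^s <= exp a.\<close>

lemma card_large_sample_error_le:
  assumes y: "\<And>t. t < n \<Longrightarrow> y t \<in> carrier_vec d"
    and M: "\<And>t. t < n \<Longrightarrow> (vnorm (y t))\<^sup>2 \<le> M" and M0: "0 < M"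
    and B: "psd d (1\<^sub>m d - (1 / real n) \<cdot>\<^sub>m gram d y {..<n})"
    and s: "0 < s" "2 * s \<le> n" and \<eta>: "0 < \<eta>" "\<eta> \<le> 1"
    and a: "a = \<eta>\<^sup>2 * real s / (96 * M)" "1 \<le> a"
  shows "real (card {T \<in> k_subsets n s. \<exists>z\<in>carrier_vec d. \<eta> * vnorm z < vnorm (sample_error d y n T *\<^sub>v z)})
    \<le> 4 * ((\<Sum>t<n. (vnorm (y t))\<^sup>2) / real n) * exp (- a) * real (n choose s)"
proof -
  define bad where "bad = {T \<in> k_subsets n s. \<exists>z\<in>carrier_vec d. \<eta> * vnorm z < vnorm (sample_error d y n T *\<^sub>v z)}"
  have n: "0 < n" using s by simp
  \<comment> \<open>This value maximises c s \<eta> / n - 24 c^2 M s / n^2, the eigenvalue forced by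
    a bad subset minus the growth exponent of the potential. The two terms become 2a and a.\<close>
  define c where "c = real n * \<eta> / (48 * M)"
  define D where "D = mtrace ((1 / real n) \<cdot>\<^sub>m gram d y {..<n})"
  define g where "g = 1 + 24 * c\<^sup>2 * M / (real n)\<^sup>2"
  have D: "D = (\<Sum>t<n. (vnorm (y t))\<^sup>2) / real n"
    unfolding D_def using y by (subst mtrace_smult[of _ d], simp, subst mtrace_gram) auto
  have c: "0 \<le> c" "4 * c * M \<le> real n"
    using M0 \<eta> n by (auto simp: c_def field_simps)
  have t: "c * real s * \<eta> / real n = 2 * a"
    using n M0 by (simp add: c_def a power2_eq_square field_simps)
  have ga: "g ^ s \<le> exp a"
  proof -
    have "real s * (24 * c\<^sup>2 * M / (real n)\<^sup>2) = a"
      using n M0 by (simp add: c_def a power2_eq_square field_simps)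
    then have "exp a = exp (24 * c\<^sup>2 * M / (real n)\<^sup>2) ^ s" by (metis exp_of_nat_mult)
    then show ?thesis unfolding g_def using M0
      by (auto intro!: power_mono exp_ge_add_one_self)
  qed
  have fin: "finite bad" by (simp add: bad_def)
  have large: "\<forall>\<^sub>F K in sequentially. \<forall>T\<in>bad. 2 * (cosh (2 * a) - 1) - \<epsilon> \<le> trace_cosh d K (centred d y n c T)"
    if \<epsilon>: "0 < \<epsilon>" for \<epsilon>
  proof (intro eventually_ball_finite ballI fin)
    fix T assume "T \<in> bad"
    then obtain z where T: "T \<subseteq> {..<n}" "card T = s" and z: "z \<in> carrier_vec d"
      and zT: "\<eta> * vnorm z < vnorm (sample_error d y n T *\<^sub>v z)"
      by (auto simp: bad_def k_subsets_def)
    \<comment> \<open>The strict inequality in the definition of a bad subset excludes z =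
      0.\<close>
    have z0: "z \<noteq> 0\<^sub>v d"
    proof
      assume "z = 0\<^sub>v d"
      moreover obtain b where "vnorm (sample_error d y n T *\<^sub>v 0\<^sub>v d) \<le> b * vnorm (0\<^sub>v d)"
        using operator_bound_exists[OF sample_error_carrier] zero_carrier_vec by metis
      ultimately show False using zT by simp
    qed
    have ns: "0 < real n - real s" "real n - real s \<le> real n" using s by auto
    have eq: "centred d y n c T = (c * real s / (real n - real s)) \<cdot>\<^sub>m sample_error d y n T"
      using s n T by (intro eq_matI) (auto simp: centred_def sample_error_def field_simps)
    have "2 * a * vnorm z \<le> c * real s / (real n - real s) * (\<eta> * vnorm z)"
    proof -
      have "2 * a * vnorm z = c * real s / real n * (\<eta> * vnorm z)" unfolding t[symmetric] by simp
      also have "\<dots> \<le> c * real s / (real n - real s) * (\<eta> * vnorm z)"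
        using ns c \<eta> n by (intro mult_right_mono divide_left_mono) auto
      finally show ?thesis .
    qed
    also have "\<dots> \<le> c * real s / (real n - real s) * vnorm (sample_error d y n T *\<^sub>v z)"
      using zT ns c by (intro mult_left_mono) auto
    also have "\<dots> = vnorm (centred d y n c T *\<^sub>v z)"
      unfolding eq using z ns c by (simp add: smult_mat_mult_vec[of _ d d] vnorm_smult)
    finally have "2 * a * vnorm z \<le> vnorm (centred d y n c T *\<^sub>v z)" .
    then show "\<forall>\<^sub>F K in sequentially. 2 * (cosh (2 * a) - 1) - \<epsilon> \<le> trace_cosh d K (centred d y n c T)"
      using a(2) by (intro trace_cosh_eventually_ge[OF centred_carrier transpose_centred z z0 _ _ \<epsilon>]) auto
  qed
  have main: "real (card bad) * (2 * (cosh (2 * a) - 1)) \<le> real (n choose s) * (2 * D * (g ^ s - 1))"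
  proof (rule field_le_epsilon)
    fix e :: real assume e: "0 < e"
    \<comment> \<open>The error occurs once per bad subset and once per subset in the mean; the
      extra 1 keeps the denominator positive.\<close>
    define \<epsilon> where "\<epsilon> = e / (real (card bad) + real (n choose s) + 1)"
    have pos: "0 < real (card bad) + real (n choose s) + 1" by simp
    have \<epsilon>: "0 < \<epsilon>" using e pos unfolding \<epsilon>_def by (rule divide_pos_pos)
    have \<epsilon>e: "(real (card bad) + real (n choose s)) * \<epsilon> \<le> e"
      using e pos by (simp add: \<epsilon>_def field_simps)
    have "\<forall>\<^sub>F K in sequentially. (\<Sum>T\<in>k_subsets n s. trace_cosh d K (centred d y n c T))
      \<le> real (n choose s) * (2 * D * (g ^ s - 1) + \<epsilon>)"
      by (rule sum_trace_cosh_centred_le[OF y M n B c D_def g_def s(2) \<epsilon>])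
    with large[OF \<epsilon>] have "\<forall>\<^sub>F K::nat in sequentially.
      real (card bad) * (2 * (cosh (2 * a) - 1) - \<epsilon>) \<le> real (n choose s) * (2 * D * (g ^ s - 1) + \<epsilon>)"
    proof eventually_elim
      case (elim K)
      have "real (card bad) * (2 * (cosh (2 * a) - 1) - \<epsilon>) = (\<Sum>T\<in>bad. 2 * (cosh (2 * a) - 1) - \<epsilon>)" by simp
      also have "\<dots> \<le> (\<Sum>T\<in>bad. trace_cosh d K (centred d y n c T))"
        using elim(1) by (intro sum_mono) blast
      also have "\<dots> \<le> (\<Sum>T\<in>k_subsets n s. trace_cosh d K (centred d y n c T))"
        by (intro sum_mono2) (auto simp: bad_def intro: trace_cosh_nonneg transpose_centred)
      finally show ?case using elim(2) by linarith
    qed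
    \<comment> \<open>K no longer occurs in the inequality, so holding eventually means
      holding.\<close>
    then have "real (card bad) * (2 * (cosh (2 * a) - 1) - \<epsilon>) \<le> real (n choose s) * (2 * D * (g ^ s - 1) + \<epsilon>)"
      by (simp add: eventually_const)
    then show "real (card bad) * (2 * (cosh (2 * a) - 1)) \<le> real (n choose s) * (2 * D * (g ^ s - 1)) + e"
      using \<epsilon>e by (simp add: algebra_simps)
  qed
  have D0: "0 \<le> D" unfolding D by (intro divide_nonneg_nonneg sum_nonneg) auto
  have "real (card bad) * (exp (2 * a) / 4) \<le> real (card bad) * (cosh (2 * a) - 1)"
    using cosh_gap[OF a(2)] by (intro mult_left_mono) auto
  also have "\<dots> \<le> real (n choose s) * (D * (g ^ s - 1))"
    using main by (simp add: algebra_simps)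
  also have "\<dots> \<le> real (n choose s) * (D * exp a)"
    using ga D0 by (intro mult_left_mono) auto
  finally have "real (card bad) * (exp (2 * a) / 4) \<le> real (n choose s) * (D * exp a)" .
  from mult_right_mono[OF this, of "4 * exp (- (2 * a))"]
  have le: "real (card bad) * (exp (2 * a) / 4) * (4 * exp (- (2 * a)))
    \<le> real (n choose s) * (D * exp a) * (4 * exp (- (2 * a)))" by simp
  have "real (card bad) = real (card bad) * (exp (2 * a) / 4) * (4 * exp (- (2 * a)))"
    by (simp add: exp_minus)
  also note le
  also have "real (n choose s) * (D * exp a) * (4 * exp (- (2 * a)))
    = real (n choose s) * (D * 4) * (exp a * exp (- (2 * a)))" by (simp only: mult_ac)
  also have "exp a * exp (- (2 * a)) = exp (- a)" by (simp flip: exp_add)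
  finally have "real (card bad) \<le> real (n choose s) * (D * 4) * exp (- a)" .
  then show ?thesis unfolding bad_def[symmetric] D[symmetric] by (simp add: mult_ac)
qed

section \<open>Gradients and Hessians of the regularised loss\<close>

lemma scalar_prod_line:
  fixes a w u :: "real vec"
  assumes "a \<in> carrier_vec d" "w \<in> carrier_vec d" "u \<in> carrier_vec d"
  shows "a \<bullet> (w + t \<cdot>\<^sub>v u) = a \<bullet> w + t * (a \<bullet> u)"
  using assms by (simp add: scalar_prod_add_distrib[of _ d])

lemma vnorm_square_line:
  assumes "w \<in> carrier_vec d" "u \<in> carrier_vec d"
  shows "(vnorm (w + t \<cdot>\<^sub>v u))\<^sup>2 = w \<bullet> w + 2 * t * (w \<bullet> u) + t\<^sup>2 * (u \<bullet> u)"
  unfolding vnorm_square using assms comm_scalar_prod[OF assms]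
  by (simp add: scalar_prod_add_distrib[of _ d] add_scalar_prod_distrib[of _ d] power2_eq_square distrib_left)

text \<open>The graph lies above its tangents; adding the tangent inequalities at two points shows
  that the derivative is monotone.\<close>

lemma convex_deriv2_nonneg:
  fixes f :: "real \<Rightarrow> real"
  assumes f: "convex_on UNIV f" and d1: "\<And>z. f differentiable (at z)" and d2: "deriv f differentiable (at z)"
  shows "0 \<le> deriv (deriv f) z"
proof -
  have D: "(f has_real_derivative deriv f x) (at x)" for x
    using d1 by (simp add: DERIV_deriv_iff_real_differentiable)
  have tangent: "f y - f x \<ge> deriv f x * (y - x)" for x y
    using D by (intro convex_on_imp_above_tangent[OF f]) auto
  have "mono_on UNIV (deriv f)"
  proof (rule mono_onI)
    fix x y :: real assume "x \<le> y"
    have "(deriv f y - deriv f x) * (y - x) \<ge> 0"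
      using tangent[of x y] tangent[of y x] by (simp add: algebra_simps)
    then show "deriv f x \<le> deriv f y" using \<open>x \<le> y\<close> by (cases "x = y") (auto simp: zero_le_mult_iff)
  qed
  moreover have "(deriv f has_real_derivative deriv (deriv f) z) (at z)"
    using d2 by (simp add: DERIV_deriv_iff_real_differentiable)
  ultimately show ?thesis by (rule mono_on_imp_deriv_nonneg) simp
qed

lemma vnorm_mult_le_spectral_norm:
  assumes A: "A \<in> carrier_mat d d" and v: "v \<in> carrier_vec d"
  shows "vnorm (A *\<^sub>v v) \<le> spectral_norm A * vnorm v"
proof (cases "v = 0\<^sub>v d")
  case True
  obtain b where "vnorm (A *\<^sub>v v) \<le> b * vnorm v"
    using operator_bound_exists[OF A] v by metis
  then show ?thesis using True by simp
next
  case False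
  then have nz: "0 < vnorm v" using v by (intro vnorm_pos)
  let ?u = "(1 / vnorm v) \<cdot>\<^sub>v v"
  have u: "?u \<in> carrier_vec d" "vnorm ?u = 1" using v nz by (simp_all add: vnorm_smult)
  obtain b where b: "\<And>z. z \<in> carrier_vec d \<Longrightarrow> vnorm (A *\<^sub>v z) \<le> b * vnorm z"
    using operator_bound_exists[OF A] by metis
  have "bdd_above ((\<lambda>v. vnorm (A *\<^sub>v v)) ` {v \<in> carrier_vec (dim_col A). vnorm v = 1})"
    using A b by (intro bdd_aboveI[of _ b]) force
  then have "vnorm (A *\<^sub>v ?u) \<le> spectral_norm A"
    unfolding spectral_norm_def using A u by (intro cSUP_upper) auto
  moreover have "vnorm (A *\<^sub>v ?u) = vnorm (A *\<^sub>v v) / vnorm v"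
    using A v by (simp add: mult_mat_vec[of _ d d] vnorm_smult)
  ultimately show ?thesis using nz by (simp add: field_simps)
qed

locale regularised_loss =
  fixes n d :: nat and x :: "nat \<Rightarrow> real vec" and l :: "nat \<Rightarrow> real \<Rightarrow> real" and \<gamma> :: real
  assumes n: "0 < n" and x: "\<And>j. j < n \<Longrightarrow> x j \<in> carrier_vec d" and \<gamma>: "0 < \<gamma>"
    and convex: "\<And>j. j < n \<Longrightarrow> convex_on UNIV (l j)"
    and diff1: "\<And>j z. j < n \<Longrightarrow> l j differentiable (at z)"
    and diff2: "\<And>j z. j < n \<Longrightarrow> deriv (l j) differentiable (at z)"
begin

abbreviation "F \<equiv> objective n l x \<gamma>"

definition data_row :: "real vec \<Rightarrow> nat \<Rightarrow> real vec" where
  "data_row w j = sqrt (deriv (deriv (l j)) (x j \<bullet> w)) \<cdot>\<^sub>v x j"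

lemma data_row_carrier: "j < n \<Longrightarrow> data_row w j \<in> carrier_vec d"
  using x by (simp add: data_row_def)

lemma deriv2_nonneg: "j < n \<Longrightarrow> 0 \<le> deriv (deriv (l j)) z"
  using convex diff1 diff2 by (intro convex_deriv2_nonneg) auto

lemma DERIV_l: "j < n \<Longrightarrow> (l j has_real_derivative deriv (l j) z) (at z)"
  using diff1 by (simp add: DERIV_deriv_iff_real_differentiable)

lemma DERIV_deriv_l: "j < n \<Longrightarrow> (deriv (l j) has_real_derivative deriv (deriv (l j)) z) (at z)"
  using diff2 by (simp add: DERIV_deriv_iff_real_differentiable)

lemma DERIV_line:
  assumes "\<And>z. (f has_real_derivative f' z) (at z)"
  shows "((\<lambda>t. f (a + t * b)) has_real_derivative f' (a + t * b) * b) (at t)"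
  by (rule DERIV_chain2[where f = f and g = "\<lambda>t. a + t * b"]) (use assms in \<open>auto intro!: derivative_eq_intros\<close>)

lemma objective_line_DERIV:
  assumes w: "w \<in> carrier_vec d" and u: "u \<in> carrier_vec d"
  shows "((\<lambda>t. F (w + t \<cdot>\<^sub>v u)) has_real_derivative
    1 / real n * (\<Sum>j<n. deriv (l j) (x j \<bullet> w) * (x j \<bullet> u)) + \<gamma> * (w \<bullet> u)) (at 0)"
proof -
  have "F (w + t \<cdot>\<^sub>v u) = 1 / real n * (\<Sum>j<n. l j (x j \<bullet> w + t * (x j \<bullet> u)))
    + \<gamma> / 2 * (w \<bullet> w + 2 * t * (w \<bullet> u) + t\<^sup>2 * (u \<bullet> u))" for t
    unfolding objective_def vnorm_square_line[OF w u] using w u x by (simp add: scalar_prod_line[of _ d])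
  moreover have "((\<lambda>t. 1 / real n * (\<Sum>j<n. l j (x j \<bullet> w + t * (x j \<bullet> u)))
    + \<gamma> / 2 * (w \<bullet> w + 2 * t * (w \<bullet> u) + t\<^sup>2 * (u \<bullet> u))) has_real_derivative
    1 / real n * (\<Sum>j<n. deriv (l j) (x j \<bullet> w + 0 * (x j \<bullet> u)) * (x j \<bullet> u)) + \<gamma> / 2 * (2 * (w \<bullet> u))) (at 0)"
    by (intro DERIV_add DERIV_cmult DERIV_sum DERIV_line DERIV_l) (auto intro!: derivative_eq_intros)
  ultimately show ?thesis by simp
qed

lemma partial_objective:
  assumes w: "w \<in> carrier_vec d" and i: "i < d"
  shows "partial i F w = 1 / real n * (\<Sum>j<n. deriv (l j) (x j \<bullet> w) * x j $ i) + \<gamma> * w $ i"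
proof -
  have "partial i F w = 1 / real n * (\<Sum>j<n. deriv (l j) (x j \<bullet> w) * (x j \<bullet> unit_vec d i)) + \<gamma> * (w \<bullet> unit_vec d i)"
    unfolding partial_def carrier_vecD[OF w]
    by (rule DERIV_imp_deriv) (rule objective_line_DERIV[OF w unit_vec_carrier])
  then show ?thesis using w x i by simp
qed

lemma gradient_carrier: "w \<in> carrier_vec d \<Longrightarrow> gradient F w \<in> carrier_vec d"
  by (simp add: gradient_def)

lemma scalar_prod_gradient:
  assumes w: "w \<in> carrier_vec d" and u: "u \<in> carrier_vec d"
  shows "u \<bullet> gradient F w = 1 / real n * (\<Sum>j<n. deriv (l j) (x j \<bullet> w) * (x j \<bullet> u)) + \<gamma> * (w \<bullet> u)"
proof -
  have "u \<bullet> gradient F w = (\<Sum>i<d. u $ i * (1 / real n * (\<Sum>j<n. deriv (l j) (x j \<bullet> w) * x j $ i) + \<gamma> * w $ i))"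
    using w by (auto simp: scalar_prod_def gradient_def partial_objective lessThan_atLeast0 intro!: sum.cong)
  also have "\<dots> = 1 / real n * (\<Sum>i<d. \<Sum>j<n. u $ i * (deriv (l j) (x j \<bullet> w) * x j $ i)) + \<gamma> * (\<Sum>i<d. w $ i * u $ i)"
    by (simp add: distrib_left sum.distrib sum_distrib_left mult_ac)
  also have "(\<Sum>i<d. \<Sum>j<n. u $ i * (deriv (l j) (x j \<bullet> w) * x j $ i))
    = (\<Sum>j<n. deriv (l j) (x j \<bullet> w) * (x j \<bullet> u))"
    using u by (subst sum.swap) (simp add: scalar_prod_def[of _ u] lessThan_atLeast0 sum_distrib_left mult_ac)
  also have "(\<Sum>i<d. w $ i * u $ i) = w \<bullet> u"
    using u by (simp add: scalar_prod_def lessThan_atLeast0)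
  finally show ?thesis .
qed

lemma hessian_objective:
  assumes w: "w \<in> carrier_vec d"
  shows "hessian F w = (1 / real n) \<cdot>\<^sub>m gram d (data_row w) {..<n} + \<gamma> \<cdot>\<^sub>m 1\<^sub>m d"
proof (rule eq_matI)
  fix i j assume "i < dim_row ((1 / real n) \<cdot>\<^sub>m gram d (data_row w) {..<n} + \<gamma> \<cdot>\<^sub>m 1\<^sub>m d)"
    "j < dim_col ((1 / real n) \<cdot>\<^sub>m gram d (data_row w) {..<n} + \<gamma> \<cdot>\<^sub>m 1\<^sub>m d)"
  then have ij: "i < d" "j < d" by simp_all
  let ?e = "unit_vec d i :: real vec"
  have "partial j F (w + t \<cdot>\<^sub>v ?e) = 1 / real n * (\<Sum>k<n. deriv (l k) (x k \<bullet> w + t * x k $ i) * x k $ j)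
      + \<gamma> * (w $ j + t * (if i = j then 1 else 0))" for t
    using w ij x by (simp add: partial_objective scalar_prod_line[of _ d])
  moreover have "((\<lambda>t. 1 / real n * (\<Sum>k<n. deriv (l k) (x k \<bullet> w + t * x k $ i) * x k $ j)
      + \<gamma> * (w $ j + t * (if i = j then 1 else 0))) has_real_derivative
      1 / real n * (\<Sum>k<n. deriv (deriv (l k)) (x k \<bullet> w + 0 * x k $ i) * x k $ i * x k $ j)
      + \<gamma> * (if i = j then 1 else 0)) (at 0)"
    by (intro DERIV_add DERIV_cmult DERIV_sum DERIV_cmult_right DERIV_line DERIV_deriv_l)
      (auto intro!: derivative_eq_intros)
  ultimately have "((\<lambda>t. partial j F (w + t \<cdot>\<^sub>v ?e)) has_real_derivative
      1 / real n * (\<Sum>k<n. deriv (deriv (l k)) (x k \<bullet> w) * x k $ i * x k $ j)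
      + \<gamma> * (if i = j then 1 else 0)) (at 0)" by simp
  then have "partial i (partial j F) w = 1 / real n * (\<Sum>k<n. deriv (deriv (l k)) (x k \<bullet> w) * x k $ i * x k $ j)
      + \<gamma> * (if i = j then 1 else 0)"
    unfolding partial_def[of i] carrier_vecD[OF w] by (rule DERIV_imp_deriv)
  also have "(\<Sum>k<n. deriv (deriv (l k)) (x k \<bullet> w) * x k $ i * x k $ j) = gram d (data_row w) {..<n} $$ (i, j)"
    unfolding index_gram[OF ij]
  proof (intro sum.cong refl)
    fix k assume "k \<in> {..<n}"
    then have k: "k < n" by simp
    have "(data_row w k $ i) * (data_row w k $ j)
      = (sqrt (deriv (deriv (l k)) (x k \<bullet> w)))\<^sup>2 * x k $ i * x k $ j"
      using x[OF k] ij by (simp add: data_row_def power2_eq_square)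
    \<comment> \<open>Convexity enters here: the square of \<open>sqrt\<close> gives back the second
      derivative because that is nonnegative.\<close>
    also have "\<dots> = deriv (deriv (l k)) (x k \<bullet> w) * x k $ i * x k $ j"
      using deriv2_nonneg[OF k] by simp
    finally show "deriv (deriv (l k)) (x k \<bullet> w) * x k $ i * x k $ j = data_row w k $ i * data_row w k $ j" ..
  qed
  finally show "hessian F w $$ (i, j) = ((1 / real n) \<cdot>\<^sub>m gram d (data_row w) {..<n} + \<gamma> \<cdot>\<^sub>m 1\<^sub>m d) $$ (i, j)"
    using w ij by (simp add: hessian_def)
qed (use w in \<open>simp_all add: hessian_def\<close>)

lemma hessian_carrier: "w \<in> carrier_vec d \<Longrightarrow> hessian F w \<in> carrier_mat d d"
  by (simp add: hessian_def)

lemma scalar_prod_hessian: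
  assumes w: "w \<in> carrier_vec d" and u: "u \<in> carrier_vec d" and z: "z \<in> carrier_vec d"
  shows "u \<bullet> (hessian F w *\<^sub>v z)
    = 1 / real n * (\<Sum>j<n. deriv (deriv (l j)) (x j \<bullet> w) * (x j \<bullet> u) * (x j \<bullet> z)) + \<gamma> * (u \<bullet> z)"
proof -
  have "hessian F w *\<^sub>v z = (1 / real n) \<cdot>\<^sub>v (gram d (data_row w) {..<n} *\<^sub>v z) + \<gamma> \<cdot>\<^sub>v z"
    unfolding hessian_objective[OF w] using z
    by (simp add: add_mult_distrib_mat_vec[of _ d d] smult_mat_mult_vec[of _ d d])
  then have "u \<bullet> (hessian F w *\<^sub>v z) = 1 / real n * (u \<bullet> (gram d (data_row w) {..<n} *\<^sub>v z)) + \<gamma> * (u \<bullet> z)"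
    using u z mult_mat_vec_carrier[OF gram_carrier z, of "data_row w" "{..<n}"]
    by (simp add: scalar_prod_add_distrib[of _ d])
  also have "u \<bullet> (gram d (data_row w) {..<n} *\<^sub>v z) = (\<Sum>j<n. (data_row w j \<bullet> u) * (data_row w j \<bullet> z))"
    using u z data_row_carrier by (intro quadratic_form_gram) auto
  also have "\<dots> = (\<Sum>j<n. deriv (deriv (l j)) (x j \<bullet> w) * (x j \<bullet> u) * (x j \<bullet> z))"
  proof (intro sum.cong refl)
    fix j assume "j \<in> {..<n}"
    then have j: "j < n" by simp
    have "(data_row w j \<bullet> u) * (data_row w j \<bullet> z)
      = (sqrt (deriv (deriv (l j)) (x j \<bullet> w)))\<^sup>2 * (x j \<bullet> u) * (x j \<bullet> z)"
      using x[OF j] u z by (simp add: data_row_def power2_eq_square)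
    then show "(data_row w j \<bullet> u) * (data_row w j \<bullet> z) = deriv (deriv (l j)) (x j \<bullet> w) * (x j \<bullet> u) * (x j \<bullet> z)"
      using deriv2_nonneg[OF j] by simp
  qed
  finally show ?thesis .
qed

section \<open>Optimality and the remainder of the Newton equation\<close>

lemma gradient_minimizer:
  assumes w: "w \<in> carrier_vec d" and min: "\<And>v. v \<in> carrier_vec d \<Longrightarrow> F w \<le> F v"
  shows "gradient F w = 0\<^sub>v d"
proof (rule eq_vecI)
  fix i assume "i < dim_vec (0\<^sub>v d :: real vec)"
  then have i: "i < d" by simp
  note D = objective_line_DERIV[OF w unit_vec_carrier[of d i]]
  have "w + 0 \<cdot>\<^sub>v unit_vec d i = w" using w by (intro eq_vecI) auto
  then have "1 / real n * (\<Sum>j<n. deriv (l j) (x j \<bullet> w) * (x j \<bullet> unit_vec d i)) + \<gamma> * (w \<bullet> unit_vec d i) = 0"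
    using w by (intro DERIV_local_min[OF D, of 1]) (auto intro!: min)
  moreover have "x j \<bullet> unit_vec d i = x j $ i" if "j < n" for j using x[OF that] i by simp
  moreover have "w \<bullet> unit_vec d i = w $ i" using w i by simp
  ultimately show "gradient F w $ i = 0\<^sub>v d $ i"
    using w i by (simp add: gradient_def partial_objective)
qed (use w in \<open>simp add: gradient_def\<close>)

text \<open>Testing the remainder r against itself reduces the claim to a scalar function f on the
  segment from v to w with f 0 = 0, f 1 = -|r|^2 and |f'(t)| <= C (1 - t). Monotonicity of -f + C (1
  - t)^2 / 2 takes the place of an integral and yields |r|^2 <= C / 2, which contains the factor |r|
  once on the right.\<close>

lemma newton_remainder:
  assumes w: "w \<in> carrier_vec d" and v: "v \<in> carrier_vec d" and g0: "gradient F v = 0\<^sub>v d"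
    and L: "\<And>u u'. u \<in> carrier_vec d \<Longrightarrow> u' \<in> carrier_vec d \<Longrightarrow>
      spectral_norm (hessian F u - hessian F u') \<le> L * vnorm (u - u')"
  shows "vnorm (hessian F w *\<^sub>v (w - v) - gradient F w) \<le> L / 2 * (vnorm (w - v))\<^sup>2"
proof -
  define \<Delta> where "\<Delta> = w - v"
  have \<Delta>: "\<Delta> \<in> carrier_vec d" using w v by (simp add: \<Delta>_def)
  define H where "H = hessian F w"
  have H: "H \<in> carrier_mat d d" using hessian_carrier[OF w] by (simp add: H_def)
  have H\<Delta>: "H *\<^sub>v \<Delta> \<in> carrier_vec d" using H \<Delta> by simp
  have g: "gradient F w \<in> carrier_vec d" by (rule gradient_carrier[OF w])
  define r where "r = H *\<^sub>v \<Delta> - gradient F w"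
  have r: "r \<in> carrier_vec d" using H\<Delta> g by (simp add: r_def)
  define C where "C = L * (vnorm r * (vnorm \<Delta>)\<^sup>2)"
  define p where "p t = v + t \<cdot>\<^sub>v \<Delta>" for t
  have p: "p t \<in> carrier_vec d" for t using v \<Delta> by (simp add: p_def)
  have p1: "p 1 = w" using v w by (intro eq_vecI) (auto simp: p_def \<Delta>_def)
  have p0: "p 0 = v" using v \<Delta> by (intro eq_vecI) (auto simp: p_def)
  define f where "f t = r \<bullet> gradient F (p t) - t * (r \<bullet> (H *\<^sub>v \<Delta>))" for t
  define f' where "f' t = r \<bullet> ((hessian F (p t) - H) *\<^sub>v \<Delta>)" for t
  have f'_eq: "f' t = r \<bullet> (hessian F (p t) *\<^sub>v \<Delta>) - r \<bullet> (H *\<^sub>v \<Delta>)" for t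
    using r \<Delta> H\<Delta> H hessian_carrier[OF p, of t] mult_mat_vec_carrier[OF hessian_carrier[OF p, of t] \<Delta>]
    by (simp add: f'_def minus_mult_distrib_mat_vec[of _ d d] scalar_prod_minus_distrib[of _ d])
  have der: "(f has_real_derivative f' t) (at t)" for t
  proof -
    have "f = (\<lambda>t. 1 / real n * (\<Sum>j<n. deriv (l j) (x j \<bullet> v + t * (x j \<bullet> \<Delta>)) * (x j \<bullet> r))
      + \<gamma> * (r \<bullet> v + t * (r \<bullet> \<Delta>)) - t * (r \<bullet> (H *\<^sub>v \<Delta>)))"
      unfolding f_def scalar_prod_gradient[OF p r]
      using comm_scalar_prod[OF p r] x v \<Delta> r by (simp add: p_def scalar_prod_line[of _ d])
    moreover have "((\<lambda>t. 1 / real n * (\<Sum>j<n. deriv (l j) (x j \<bullet> v + t * (x j \<bullet> \<Delta>)) * (x j \<bullet> r))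
      + \<gamma> * (r \<bullet> v + t * (r \<bullet> \<Delta>)) - t * (r \<bullet> (H *\<^sub>v \<Delta>))) has_real_derivative
      1 / real n * (\<Sum>j<n. deriv (deriv (l j)) (x j \<bullet> v + t * (x j \<bullet> \<Delta>)) * (x j \<bullet> \<Delta>) * (x j \<bullet> r))
      + \<gamma> * (r \<bullet> \<Delta>) - r \<bullet> (H *\<^sub>v \<Delta>)) (at t)"
      by (intro DERIV_diff DERIV_add DERIV_cmult DERIV_sum DERIV_cmult_right DERIV_line DERIV_deriv_l)
        (auto intro!: derivative_eq_intros)
    moreover have "f' t = 1 / real n * (\<Sum>j<n. deriv (deriv (l j)) (x j \<bullet> v + t * (x j \<bullet> \<Delta>)) * (x j \<bullet> \<Delta>) * (x j \<bullet> r))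
      + \<gamma> * (r \<bullet> \<Delta>) - r \<bullet> (H *\<^sub>v \<Delta>)"
      unfolding f'_eq scalar_prod_hessian[OF p r \<Delta>]
      using x v \<Delta> by (simp add: p_def scalar_prod_line[of _ d] mult_ac)
    ultimately show ?thesis by simp
  qed
  have bound: "\<bar>f' t\<bar> \<le> C * (1 - t)" if t: "t \<le> 1" for t
  proof -
    have D: "hessian F (p t) - H \<in> carrier_mat d d" using H by (simp add: minus_carrier_mat)
    have "\<bar>f' t\<bar> \<le> vnorm r * vnorm ((hessian F (p t) - H) *\<^sub>v \<Delta>)"
      unfolding f'_def using r D \<Delta> mult_mat_vec_carrier[OF D \<Delta>] by (intro scalar_prod_le_vnorm)
    also have "\<dots> \<le> vnorm r * (spectral_norm (hessian F (p t) - H) * vnorm \<Delta>)"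
      by (intro mult_left_mono vnorm_mult_le_spectral_norm[OF D \<Delta>]) simp
    also have "\<dots> \<le> vnorm r * (L * vnorm (p t - w) * vnorm \<Delta>)"
      unfolding H_def by (intro mult_left_mono mult_right_mono L p w) simp_all
    also have "p t - w = (t - 1) \<cdot>\<^sub>v \<Delta>"
      using v w by (intro eq_vecI) (auto simp: p_def \<Delta>_def algebra_simps)
    also have "vnorm r * (L * vnorm ((t - 1) \<cdot>\<^sub>v \<Delta>) * vnorm \<Delta>) = C * (1 - t)"
      using t by (simp add: vnorm_smult C_def power2_eq_square)
    finally show ?thesis .
  qed
  have "- f 1 + C * (1 - 1)\<^sup>2 / 2 \<le> - f 0 + C * (1 - 0)\<^sup>2 / 2"
  proof (rule DERIV_nonpos_imp_nonincreasing[of 0 1 "\<lambda>t. - f t + C * (1 - t)\<^sup>2 / 2"])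
    fix t :: real assume t: "0 \<le> t" "t \<le> 1"
    have "((\<lambda>t. - f t + C * (1 - t)\<^sup>2 / 2) has_real_derivative - f' t - C * (1 - t)) (at t)"
      by (auto intro!: derivative_eq_intros der simp: field_simps)
    moreover have "- f' t - C * (1 - t) \<le> 0" using bound[OF t(2)] by linarith
    ultimately show "\<exists>y. ((\<lambda>t. - f t + C * (1 - t)\<^sup>2 / 2) has_real_derivative y) (at t) \<and> y \<le> 0" by blast
  qed simp
  moreover have "f 0 = 0" using r by (simp add: f_def p0 g0)
  moreover have "f 1 = - (vnorm r)\<^sup>2"
    using r g H\<Delta> unfolding f_def p1 vnorm_square
    by (simp add: r_def scalar_prod_minus_distrib[of _ d])
  ultimately have "(vnorm r)\<^sup>2 \<le> C / 2" by simp
  then have "vnorm r * vnorm r \<le> vnorm r * (L / 2 * (vnorm \<Delta>)\<^sup>2)"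
    by (simp add: C_def power2_eq_square mult_ac)
  \<comment> \<open>For r = 0 one cannot divide by |r|, and the sign of L is not given. If w differs
    from v, the Lipschitz bound itself forces L >= 0.\<close>
  moreover have "0 \<le> L / 2 * (vnorm \<Delta>)\<^sup>2" if "vnorm r = 0"
  proof (cases "vnorm \<Delta> = 0")
    case False
    have D: "hessian F w - hessian F v \<in> carrier_mat d d" using hessian_carrier[OF v] by (simp add: minus_carrier_mat)
    have "0 \<le> spectral_norm (hessian F w - hessian F v) * vnorm \<Delta>"
      using vnorm_mult_le_spectral_norm[OF D \<Delta>] vnorm_nonneg order_trans by blast
    also have "\<dots> \<le> L * vnorm \<Delta> * vnorm \<Delta>"
      unfolding \<Delta>_def by (intro mult_right_mono L w v) simp
    finally show ?thesis by (simp add: power2_eq_square)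
  qed simp
  ultimately have "vnorm r \<le> L / 2 * (vnorm \<Delta>)\<^sup>2"
    using vnorm_nonneg[of r] by (cases "vnorm r = 0") (auto simp: mult_le_cancel_left_pos)
  then show ?thesis by (simp add: r_def H_def \<Delta>_def)
qed

end

section \<open>Random partitions\<close>

definition worker_set :: "nat \<Rightarrow> (nat \<Rightarrow> nat) \<Rightarrow> nat \<Rightarrow> nat set" where
  "worker_set n p i = {j. j < n \<and> p j = i}"

lemma worker_set_k_subsets:
  assumes "p \<in> partitions n m" "i < m"
  shows "worker_set n p i \<in> k_subsets n (n div m)"
  using assms by (auto simp: partitions_def k_subsets_def worker_set_def)

lemma finite_partitions [simp]: "finite (partitions n m)"
proof -
  have "finite ({..<n} \<rightarrow>\<^sub>E {..<m})" by (intro finite_PiE) auto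
  then show ?thesis unfolding partitions_def by (rule rev_finite_subset) auto
qed

text \<open>Contiguous blocks of length s form a partition. Nonemptiness is what makes
  \<open>pmf_of_set\<close> the uniform distribution.\<close>

lemma partitions_nonempty:
  assumes m: "0 < m" and dvd: "m dvd n"
  shows "partitions n m \<noteq> {}"
proof -
  define s where "s = n div m"
  have n: "n = m * s" using dvd by (simp add: s_def)
  let ?p = "\<lambda>j\<in>{..<n}. j div s"
  have "?p \<in> partitions n m"
    unfolding partitions_def
  proof (intro CollectI conjI allI impI)
    show "?p \<in> {..<n} \<rightarrow>\<^sub>E {..<m}"
      using n by (auto simp: less_mult_imp_div_less)
    fix i assume i: "i < m"
    have "{j. j < n \<and> ?p j = i} = {i * s..<i * s + s}"
    proof (cases "s = 0")
      case False
      then have "j < n \<and> j div s = i \<longleftrightarrow> i * s \<le> j \<and> j < i * s + s" for j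
      proof -
        have "j div s = i \<longleftrightarrow> i * s \<le> j \<and> j < i * s + s"
        proof
          assume "j div s = i"
          then have "i * s + j mod s = j" by (metis div_mult_mod_eq)
          moreover have "j mod s < s" using False by simp
          ultimately show "i * s \<le> j \<and> j < i * s + s" by linarith
        next
          assume "i * s \<le> j \<and> j < i * s + s"
          then show "j div s = i" by (intro div_nat_eqI) (auto simp: mult.commute)
        qed
        moreover have "i * s + s \<le> n"
          using mult_le_mono1[of "Suc i" m s] i n by simp
        ultimately show ?thesis by auto
      qed
      then have "{j. j < n \<and> j div s = i} = {j. i * s \<le> j \<and> j < i * s + s}"
        by (rule Collect_cong)
      moreover have "{j. j < n \<and> ?p j = i} = {j. j < n \<and> j div s = i}"
        by (rule Collect_cong) auto
      ultimately show ?thesis by (simp only: atLeastLessThan_def atLeast_def lessThan_def Int_def mem_Collect_eq)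
    qed (use n in auto)
    then show "card {j. j < n \<and> ?p j = i} = n div m" by (simp add: s_def)
  qed
  then show ?thesis by blast
qed

lemma exists_bij_mapping_subset:
  assumes "finite A" "S \<subseteq> A" "T \<subseteq> A" "card S = card T"
  obtains f where "bij_betw f A A" "f ` S = T"
proof -
  have fin: "finite S" "finite T" using assms finite_subset by auto
  obtain f where f: "bij_betw f S T" using finite_same_card_bij[OF fin assms(4)] by blast
  have "card (A - S) = card (A - T)" using assms fin by (simp add: card_Diff_subset)
  then obtain g where g: "bij_betw g (A - S) (A - T)"
    using finite_same_card_bij[of "A - S" "A - T"] assms by blast
  let ?h = "\<lambda>x. if x \<in> S then f x else g x"
  have "bij_betw ?h S T" using f by (simp cong: bij_betw_cong)
  moreover have "bij_betw ?h (A - S) (A - T)"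
    using g by (subst bij_betw_cong[of _ _ g]) auto
  ultimately have "bij_betw ?h (S \<union> (A - S)) (T \<union> (A - T))"
    by (rule bij_betw_combine) auto
  moreover have "S \<union> (A - S) = A" "T \<union> (A - T) = A" using assms by auto
  moreover have "?h ` S = T" using \<open>bij_betw ?h S T\<close> by (simp add: bij_betw_def)
  ultimately show ?thesis using that by metis
qed

text \<open>Relabelling the samples by a permutation that maps S onto T injects the partitions in
  which worker i holds T into those in which it holds S. By symmetry all these counts agree.\<close>

lemma card_partitions_worker_set_le:
  assumes "S \<in> k_subsets n s" "T \<in> k_subsets n s"
  shows "card {p \<in> partitions n m. worker_set n p i = T} \<le> card {p \<in> partitions n m. worker_set n p i = S}"
proof -
  obtain f where f: "bij_betw f {..<n} {..<n}" and fS: "f ` S = T"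
    by (rule exists_bij_mapping_subset[of "{..<n}" S T]) (use assms in \<open>auto simp: k_subsets_def\<close>)
  \<comment> \<open>\<open>restrict\<close> keeps the relabelled assignment in the extensional
    function space that underlies \<open>partitions\<close>.\<close>
  have ws: "worker_set n (restrict (p \<circ> f) {..<n}) k = {j. j < n \<and> f j \<in> worker_set n p k}" for p k
    using bij_betwE[OF f] by (auto simp: worker_set_def)
  have image: "f ` {j. j < n \<and> f j \<in> U} = U" if "U \<subseteq> {..<n}" for U
  proof
    show "U \<subseteq> f ` {j. j < n \<and> f j \<in> U}"
    proof
      fix u assume u: "u \<in> U"
      then have "u \<in> f ` {..<n}" using f that by (auto simp: bij_betw_def)
      then show "u \<in> f ` {j. j < n \<and> f j \<in> U}" using u by blast
    qed
  qed blast
  have inj: "inj_on f {..<n}" using f by (simp add: bij_betw_def)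
  show ?thesis
  proof (rule card_inj_on_le[of "\<lambda>p. restrict (p \<circ> f) {..<n}"])
    show "inj_on (\<lambda>p. restrict (p \<circ> f) {..<n}) {p \<in> partitions n m. worker_set n p i = T}"
    proof (rule inj_onI)
      fix p q assume p: "p \<in> {p \<in> partitions n m. worker_set n p i = T}"
        and q: "q \<in> {p \<in> partitions n m. worker_set n p i = T}"
        and eq: "restrict (p \<circ> f) {..<n} = restrict (q \<circ> f) {..<n}"
      have pq: "p \<in> {..<n} \<rightarrow>\<^sub>E {..<m}" "q \<in> {..<n} \<rightarrow>\<^sub>E {..<m}" using p q by (auto simp: partitions_def)
      show "p = q"
      proof (rule PiE_ext[OF pq])
        fix j assume "j \<in> {..<n}"
        then obtain k where k: "k \<in> {..<n}" "j = f k" using f by (metis bij_betw_def imageE)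
        then show "p j = q j" using fun_cong[OF eq, of k] by simp
      qed
    qed
    show "(\<lambda>p. restrict (p \<circ> f) {..<n}) ` {p \<in> partitions n m. worker_set n p i = T}
      \<subseteq> {p \<in> partitions n m. worker_set n p i = S}"
    proof (intro image_subsetI CollectI conjI)
      fix p assume "p \<in> {p \<in> partitions n m. worker_set n p i = T}"
      then have p: "p \<in> partitions n m" and pT: "worker_set n p i = T" by auto
      show "restrict (p \<circ> f) {..<n} \<in> partitions n m"
        unfolding partitions_def
      proof (intro CollectI conjI allI impI)
        show "restrict (p \<circ> f) {..<n} \<in> {..<n} \<rightarrow>\<^sub>E {..<m}"
          using p bij_betwE[OF f] by (fastforce simp: partitions_def)
        fix k assume "k < m"
        let ?W = "{j. j < n \<and> f j \<in> worker_set n p k}"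
        have "card ?W = card (f ` ?W)"
          by (intro card_image[symmetric] inj_on_subset[OF inj]) auto
        also have "\<dots> = card (worker_set n p k)" by (subst image) (auto simp: worker_set_def)
        also have "\<dots> = n div m" using p \<open>k < m\<close> by (simp add: partitions_def worker_set_def)
        finally show "card {j. j < n \<and> restrict (p \<circ> f) {..<n} j = k} = n div m"
          using ws[of p k] by (simp add: worker_set_def[of n "restrict (p \<circ> f) {..<n}"])
      qed
      have "f ` {j. j < n \<and> f j \<in> T} = f ` S" using fS assms by (subst image) (auto simp: k_subsets_def)
      then have "{j. j < n \<and> f j \<in> T} = S"
        using assms by (subst (asm) inj_on_image_eq_iff[OF inj]) (auto simp: k_subsets_def)
      then show "worker_set n (restrict (p \<circ> f) {..<n}) i = S" using ws[of p i] pT by simp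
    qed
  qed auto
qed

text \<open>The set held by one worker is uniformly distributed over the subsets of size n / m: the
  fibres over these subsets have equal size, so the number of partitions is proportional to the
  number of subsets. Cross-multiplication avoids quotients.\<close>

lemma card_partitions_worker_set_in:
  assumes i: "i < m" and U: "U \<subseteq> k_subsets n (n div m)"
  shows "real (card {p \<in> partitions n m. worker_set n p i \<in> U}) * real (n choose (n div m))
    = real (card (partitions n m)) * real (card U)"
proof -
  let ?s = "n div m"
  define N where "N T = card {p \<in> partitions n m. worker_set n p i = T}" for T
  have const: "N S = N T" if "S \<in> k_subsets n ?s" "T \<in> k_subsets n ?s" for S T
    unfolding N_def using that by (intro antisym card_partitions_worker_set_le)
  have count: "card {p \<in> partitions n m. worker_set n p i \<in> V} = (\<Sum>T\<in>V. N T)" if "V \<subseteq> k_subsets n ?s" for V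
  proof -
    have fin: "finite V" using that finite_k_subsets by (rule finite_subset)
    have "{p \<in> partitions n m. worker_set n p i \<in> V} = (\<Union>T\<in>V. {p \<in> partitions n m. worker_set n p i = T})" by auto
    then show ?thesis unfolding N_def using fin by (simp, subst card_UN_disjoint) auto
  qed
  have all: "{p \<in> partitions n m. worker_set n p i \<in> k_subsets n ?s} = partitions n m"
    using worker_set_k_subsets[OF _ i] by auto
  show ?thesis
  proof (cases "k_subsets n ?s = {}")
    case True
    then have "U = {}" using U by simp
    then show ?thesis by simp
  next
    case False
    then obtain S where S: "S \<in> k_subsets n ?s" by blast
    have "card {p \<in> partitions n m. worker_set n p i \<in> V} = card V * N S" if "V \<subseteq> k_subsets n ?s" for V
      unfolding count[OF that] using that const[OF _ S] by (subst sum.cong[of V V N "\<lambda>_. N S"]) auto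
    from this[OF U] this[OF order_refl] show ?thesis
      unfolding all card_k_subsets by simp
  qed
qed

lemma prob_worker_set_in:
  assumes "0 < m" "m dvd n" "i < m" "U \<subseteq> k_subsets n (n div m)"
  shows "measure_pmf.prob (pmf_of_set (partitions n m)) {p. worker_set n p i \<in> U} * real (n choose (n div m)) = real (card U)"
proof -
  have "partitions n m \<inter> {p. worker_set n p i \<in> U} = {p \<in> partitions n m. worker_set n p i \<in> U}" by auto
  then show ?thesis
    using card_partitions_worker_set_in[OF assms(3,4)] partitions_nonempty[OF assms(1,2)]
    by (simp add: measure_pmf_of_set field_simps)
qed

section \<open>Whitening and singular values\<close>

lemma vnorm_square_mult_vec:
  assumes P: "P \<in> carrier_mat d d" and z: "z \<in> carrier_vec d"
  shows "(vnorm (P\<^sup>T *\<^sub>v z))\<^sup>2 = z \<bullet> (P *\<^sub>v (P\<^sup>T *\<^sub>v z))"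
proof -
  have Pz: "P\<^sup>T *\<^sub>v z \<in> carrier_vec d" using P z by simp
  show ?thesis unfolding vnorm_square
    using transpose_vec_mult_scalar[OF P Pz z] .
qed

lemma congruence_gram:
  assumes P: "P \<in> carrier_mat d d" and a: "\<And>t. t \<in> T \<Longrightarrow> a t \<in> carrier_vec d"
  shows "P\<^sup>T * gram d a T * P = gram d (\<lambda>t. P\<^sup>T *\<^sub>v a t) T"
proof (rule eq_matI)
  fix i k assume "i < dim_row (gram d (\<lambda>t. P\<^sup>T *\<^sub>v a t) T)" "k < dim_col (gram d (\<lambda>t. P\<^sup>T *\<^sub>v a t) T)"
  then have ik: "i < d" "k < d" by auto
  have v: "(P\<^sup>T *\<^sub>v a t) $ i = (\<Sum>r<d. P $$ (r, i) * a t $ r)" if "t \<in> T" "i < d" for t i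
    using P carrier_vecD[OF a[OF that(1)]] that(2)
    by (auto simp: scalar_prod_def lessThan_atLeast0 intro!: sum.cong)
  have "(P\<^sup>T * gram d a T * P) $$ (i, k) = (\<Sum>l<d. (\<Sum>r<d. P $$ (r, i) * (\<Sum>t\<in>T. a t $ r * a t $ l)) * P $$ (l, k))"
    using ik P by (auto simp: scalar_prod_def index_gram lessThan_atLeast0 intro!: sum.cong)
  also have "\<dots> = (\<Sum>l<d. \<Sum>r<d. \<Sum>t\<in>T. P $$ (r, i) * a t $ r * (P $$ (l, k) * a t $ l))"
    by (simp add: sum_distrib_left sum_distrib_right mult_ac)
  also have "\<dots> = (\<Sum>t\<in>T. \<Sum>l<d. \<Sum>r<d. P $$ (r, i) * a t $ r * (P $$ (l, k) * a t $ l))"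
  proof -
    have "(\<Sum>r<d. \<Sum>t\<in>T. f r t) = (\<Sum>t\<in>T. \<Sum>r<d. f r t)" for f :: "nat \<Rightarrow> nat \<Rightarrow> real"
      by (rule sum.swap)
    then show ?thesis by (simp only:)
  qed
  also have "\<dots> = (\<Sum>t\<in>T. (P\<^sup>T *\<^sub>v a t) $ i * (P\<^sup>T *\<^sub>v a t) $ k)"
  proof (intro sum.cong refl)
    fix t assume t: "t \<in> T"
    have "(\<Sum>l<d. \<Sum>r<d. f r * g l) = (\<Sum>r<d. f r) * (\<Sum>l<d. g l)" for f g :: "nat \<Rightarrow> real"
      by (subst sum.swap) (simp only: sum_product)
    then show "(\<Sum>l<d. \<Sum>r<d. P $$ (r, i) * a t $ r * (P $$ (l, k) * a t $ l))
      = (P\<^sup>T *\<^sub>v a t) $ i * (P\<^sup>T *\<^sub>v a t) $ k"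
      unfolding v[OF t ik(1)] v[OF t ik(2)] .
  qed
  finally show "(P\<^sup>T * gram d a T * P) $$ (i, k) = gram d (\<lambda>t. P\<^sup>T *\<^sub>v a t) T $$ (i, k)"
    using ik by (simp add: index_gram)
qed (use P in auto)

text \<open>A whitening matrix is built by rank-one updates, without diagonalisation. It starts from
  a multiple of the identity for the regulariser; adding a row changes the whitened matrix from 1 to
  1 + v v^T, and the factor 1 - q v v^T whitens it again.\<close>

lemma inverse_congruence_exists:
  assumes "finite T" and a: "\<And>t. t \<in> T \<Longrightarrow> a t \<in> carrier_vec d" and \<gamma>: "0 < \<gamma>" and c: "0 \<le> c"
  obtains P where "P \<in> carrier_mat d d" "P\<^sup>T * (c \<cdot>\<^sub>m gram d a T + \<gamma> \<cdot>\<^sub>m 1\<^sub>m d) * P = 1\<^sub>m d"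
proof -
  have "\<exists>P\<in>carrier_mat d d. P\<^sup>T * (c \<cdot>\<^sub>m gram d a T + \<gamma> \<cdot>\<^sub>m 1\<^sub>m d) * P = 1\<^sub>m d"
    using assms(1) a
  proof (induction T rule: finite_induct)
    case empty
    have "c \<cdot>\<^sub>m gram d a {} + \<gamma> \<cdot>\<^sub>m 1\<^sub>m d = \<gamma> \<cdot>\<^sub>m 1\<^sub>m d"
      by (intro eq_matI) (auto simp: gram_def)
    moreover have "((1 / sqrt \<gamma>) \<cdot>\<^sub>m 1\<^sub>m d)\<^sup>T * (\<gamma> \<cdot>\<^sub>m 1\<^sub>m d) * ((1 / sqrt \<gamma>) \<cdot>\<^sub>m 1\<^sub>m d) = 1\<^sub>m d"
      using \<gamma> by (simp add: transpose_smult mult_smult_distrib[of _ d d _ d] mult_smult_assoc_mat[of _ d d _ d]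
          smult_smult_mat) (intro eq_matI, auto simp: field_simps)
    ultimately show ?case by (intro bexI[of _ "(1 / sqrt \<gamma>) \<cdot>\<^sub>m 1\<^sub>m d"]) auto
  next
    case (insert j T)
    then obtain P where P: "P \<in> carrier_mat d d" and eq: "P\<^sup>T * (c \<cdot>\<^sub>m gram d a T + \<gamma> \<cdot>\<^sub>m 1\<^sub>m d) * P = 1\<^sub>m d"
      by auto
    define H where "H = c \<cdot>\<^sub>m gram d a T + \<gamma> \<cdot>\<^sub>m 1\<^sub>m d"
    have H: "H \<in> carrier_mat d d" by (simp add: H_def)
    have aj: "a j \<in> carrier_vec d" using insert by simp
    define v where "v = sqrt c \<cdot>\<^sub>v (P\<^sup>T *\<^sub>v a j)"
    have Paj: "P\<^sup>T *\<^sub>v a j \<in> carrier_vec d" using P aj by simp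
    have v: "v \<in> carrier_vec d" using Paj by (simp add: v_def)
    define Y where "Y = gram d (\<lambda>_. v) {0::nat}"
    have Y: "Y \<in> carrier_mat d d" "Y\<^sup>T = Y" by (simp_all add: Y_def)
    define b where "b = v \<bullet> v"
    have b: "0 \<le> b" by (simp add: b_def flip: vnorm_square)
    have YY: "Y * Y = b \<cdot>\<^sub>m Y"
    proof (rule eq_matI)
      fix i k assume "i < dim_row (b \<cdot>\<^sub>m Y)" "k < dim_col (b \<cdot>\<^sub>m Y)"
      then have ik: "i < d" "k < d" using Y by auto
      have "(Y * Y) $$ (i, k) = (\<Sum>l<d. (v $ i * v $ l) * (v $ l * v $ k))"
        using ik Y by (auto simp: Y_def scalar_prod_def index_gram lessThan_atLeast0 intro!: sum.cong)
      also have "\<dots> = b * (v $ i * v $ k)"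
        using v by (simp add: b_def scalar_prod_def lessThan_atLeast0 sum_distrib_right sum_distrib_left mult_ac)
      finally show "(Y * Y) $$ (i, k) = (b \<cdot>\<^sub>m Y) $$ (i, k)"
        using ik by (simp add: Y_def index_gram)
    qed (use Y in auto)
    have gram_insert: "c \<cdot>\<^sub>m gram d a (insert j T) + \<gamma> \<cdot>\<^sub>m 1\<^sub>m d = H + c \<cdot>\<^sub>m gram d a {j}"
      unfolding H_def using insert by (intro eq_matI) (auto simp: index_gram algebra_simps)
    have PgP: "P\<^sup>T * (c \<cdot>\<^sub>m gram d a {j}) * P = Y"
    proof -
      have "P\<^sup>T * (c \<cdot>\<^sub>m gram d a {j}) * P = c \<cdot>\<^sub>m gram d (\<lambda>t. P\<^sup>T *\<^sub>v a t) {j}"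
        using congruence_gram[OF P, of "{j}" a] P aj
        by (simp add: mult_smult_distrib[of _ d d _ d] mult_smult_assoc_mat[of _ d d _ d])
      also have "\<dots> = Y"
        using c carrier_vecD[OF Paj] by (intro eq_matI) (auto simp: Y_def v_def index_gram simp del: index_mult_mat_vec)
      finally show ?thesis .
    qed
    have PHP: "P\<^sup>T * (H + c \<cdot>\<^sub>m gram d a {j}) * P = 1\<^sub>m d + Y"
      using P H eq PgP unfolding H_def[symmetric]
      by (simp add: mult_add_distrib_mat[of _ d d _ d] add_mult_distrib_mat[of _ d d _ _ d])
    define r where "r = sqrt (1 + b)"
    have r: "0 < r" "b = r * r - 1" using b by (auto simp: r_def)
    \<comment> \<open>On the line of v the matrix Y acts as b, so the requirement is (1 + b) (1 - q
      b)^2 = 1. With 1 + b = r^2 this is solved by 1 - q b = 1 / r; in the present form of q there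
      is no division by b, which may be 0.\<close>
    define q where "q = 1 / (r * (r + 1))"
    (* (1 - q Y)^2 is the inverse of 1 + Y, because Y^2 = b Y. *)
    have q: "1 - 2 * q + q * q * b - 2 * q * b + q * q * b * b = 0"
    proof -
      have "1 - 2 * q + q * q * b - 2 * q * b + q * q * b * b = 1 + (1 + b) * (q * (q * b - 2))"
        by (simp add: algebra_simps)
      also have "q * b - 2 = - ((r + 1) / r)"
      proof -
        have "q * b = ((r - 1) * (r + 1)) / (r * (r + 1))" by (simp add: q_def r(2) algebra_simps)
        also have "\<dots> = (r - 1) / r" using r(1) by simp
        finally show ?thesis using r(1) by (simp add: field_simps)
      qed
      also have "1 + (1 + b) * (q * (- ((r + 1) / r))) = 1 - r * r * (q * (r + 1)) / r" by (simp add: r(2))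
      also have "q * (r + 1) = 1 / r" using r(1) by (simp add: q_def)
      also have "1 - r * r * (1 / r) / r = 0" using r(1) by simp
      finally show ?thesis .
    qed
    define Q where "Q = 1\<^sub>m d - q \<cdot>\<^sub>m Y"
    have Q: "Q \<in> carrier_mat d d" using Y by (simp add: Q_def minus_carrier_mat)
    have QT: "Q\<^sup>T = Q" using Y by (simp add: Q_def transpose_minus[of _ d d] transpose_smult)
    have YQ: "(1\<^sub>m d + Y) * Q = 1\<^sub>m d + (1 - q - q * b) \<cdot>\<^sub>m Y"
    proof -
      have "(1\<^sub>m d + Y) * Q = (1\<^sub>m d + Y) - q \<cdot>\<^sub>m (Y + b \<cdot>\<^sub>m Y)"
        unfolding Q_def using Y YY
        by (simp add: mult_minus_distrib_mat[of _ d d _ d] mult_smult_distrib[of _ d d _ d]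
            add_mult_distrib_mat[of _ d d _ _ d] left_mult_one_mat[of _ d d])
      also have "\<dots> = 1\<^sub>m d + (1 - q - q * b) \<cdot>\<^sub>m Y"
        using Y by (intro eq_matI) (auto simp: algebra_simps)
      finally show ?thesis .
    qed
    have "Q * ((1\<^sub>m d + Y) * Q) = 1\<^sub>m d + (1 - q - q * b) \<cdot>\<^sub>m Y - q \<cdot>\<^sub>m (Y + (1 - q - q * b) \<cdot>\<^sub>m (b \<cdot>\<^sub>m Y))"
      unfolding YQ unfolding Q_def using Y YY
      by (simp add: minus_mult_distrib_mat[of _ d d _ _ d] mult_smult_assoc_mat[of _ d d _ d]
          mult_add_distrib_mat[of _ d d _ d] mult_smult_distrib[of _ d d _ d] left_mult_one_mat[of _ d d])
        (intro eq_matI, auto simp: algebra_simps)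
    also have "\<dots> = 1\<^sub>m d"
    proof (rule eq_matI)
      fix i k assume ik: "i < dim_row (1\<^sub>m d :: real mat)" "k < dim_col (1\<^sub>m d :: real mat)"
      have "(1 - q - q * b) * w - q * (w + (1 - q - q * b) * (b * w))
        = (1 - 2 * q + q * q * b - 2 * q * b + q * q * b * b) * w" for w
        by (simp add: algebra_simps)
      then have zero: "(1 - q - q * b) * Y $$ (i, k) - q * (Y $$ (i, k) + (1 - q - q * b) * (b * Y $$ (i, k))) = 0"
        unfolding q mult_zero_left .
      have "(1\<^sub>m d + (1 - q - q * b) \<cdot>\<^sub>m Y - q \<cdot>\<^sub>m (Y + (1 - q - q * b) \<cdot>\<^sub>m (b \<cdot>\<^sub>m Y))) $$ (i, k)
        = 1\<^sub>m d $$ (i, k) + ((1 - q - q * b) * Y $$ (i, k) - q * (Y $$ (i, k) + (1 - q - q * b) * (b * Y $$ (i, k))))"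
        using ik carrier_matD[OF Y(1)] by simp
      then show "(1\<^sub>m d + (1 - q - q * b) \<cdot>\<^sub>m Y - q \<cdot>\<^sub>m (Y + (1 - q - q * b) \<cdot>\<^sub>m (b \<cdot>\<^sub>m Y))) $$ (i, k) = 1\<^sub>m d $$ (i, k)"
        unfolding zero by (simp only: add_0_right)
    qed (use Y in auto)
    finally have QYQ: "Q * ((1\<^sub>m d + Y) * Q) = 1\<^sub>m d" .
    have "(P * Q)\<^sup>T * (H + c \<cdot>\<^sub>m gram d a {j}) * (P * Q) = Q * ((P\<^sup>T * (H + c \<cdot>\<^sub>m gram d a {j}) * P) * Q)"
      using P Q H QT by (simp add: transpose_mult_square_mat[of _ d] assoc_mult_mat[of _ d d _ d _ d])
    also have "\<dots> = 1\<^sub>m d" unfolding PHP QYQ ..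
    finally show ?case unfolding gram_insert using P Q by (intro bexI[of _ "P * Q"]) auto
  qed
  then show ?thesis using that by blast
qed

section \<open>Singular values of a positive definite matrix\<close>

lemma finite_singular_values:
  assumes A: "A \<in> carrier_mat d d"
  shows "finite (singular_values A)"
proof -
  have AA: "A\<^sup>T * A \<in> carrier_mat d d" using A by simp
  have "char_poly (A\<^sup>T * A) \<noteq> 0" using degree_monic_char_poly[OF AA] by auto
  then have "finite {x. poly (char_poly (A\<^sup>T * A)) x = 0}" by (rule poly_roots_finite)
  moreover have "(\<lambda>\<sigma>. \<sigma>\<^sup>2) ` singular_values A \<subseteq> {x. poly (char_poly (A\<^sup>T * A)) x = 0}"
    by (auto simp: singular_values_def eigenvalue_root_char_poly[OF AA])
  ultimately have "finite ((\<lambda>\<sigma>. \<sigma>\<^sup>2) ` singular_values A)" using finite_subset by blast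
  then show ?thesis
    by (rule finite_imageD) (auto simp: inj_on_def singular_values_def power2_eq_iff_nonneg)
qed

lemma eigenvalue_in_singular_values:
  assumes A: "A \<in> carrier_mat d d" "A\<^sup>T = A" and u: "u \<in> carrier_vec d" "u \<noteq> 0\<^sub>v d" "A *\<^sub>v u = l \<cdot>\<^sub>v u" and l: "0 \<le> l"
  shows "l \<in> singular_values A"
proof -
  have "(A\<^sup>T * A) *\<^sub>v u = l\<^sup>2 \<cdot>\<^sub>v u"
    using A u by (simp add: assoc_mult_mat_vec[of _ d d _ d] mult_mat_vec[of _ d d] smult_smult_assoc power2_eq_square)
  then have "eigenvalue (A\<^sup>T * A) (l\<^sup>2)"
    unfolding eigenvalue_def eigenvector_def using u A by (intro exI[of _ u]) auto
  then show ?thesis using l by (simp add: singular_values_def)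
qed

text \<open>Maximising the Rayleigh quotients of A and of -A produces the extreme eigenvalues of A.
  They are positive, hence singular values, and \<open>Max\<close> and \<open>Min\<close> over the
  finite set of singular values bound them. The minimum is itself a singular value, and if it were
  0, then A would have a kernel vector.\<close>

lemma sigma_bounds:
  assumes A: "A \<in> carrier_mat d d" "A\<^sup>T = A" and d: "0 < d" and \<gamma>: "0 < \<gamma>"
    and pos: "\<And>z. z \<in> carrier_vec d \<Longrightarrow> \<gamma> * (z \<bullet> z) \<le> z \<bullet> (A *\<^sub>v z)"
  shows "0 < sigma_min A" "\<And>z. z \<in> carrier_vec d \<Longrightarrow> sigma_min A * (z \<bullet> z) \<le> z \<bullet> (A *\<^sub>v z)"
    "\<And>z. z \<in> carrier_vec d \<Longrightarrow> z \<bullet> (A *\<^sub>v z) \<le> sigma_max A * (z \<bullet> z)"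
proof -
  have uu: "0 < u \<bullet> u" if "u \<in> carrier_vec d" "u \<noteq> 0\<^sub>v d" for u :: "real vec"
    using that vnorm_eq_0_iff[of u d] vnorm_nonneg[of u] by (simp flip: vnorm_square)
  obtain l u where u: "u \<in> carrier_vec d" "u \<noteq> 0\<^sub>v d" "A *\<^sub>v u = l \<cdot>\<^sub>v u"
    and l: "\<And>z. z \<in> carrier_vec d \<Longrightarrow> z \<bullet> (A *\<^sub>v z) \<le> l * (z \<bullet> z)"
    using max_eigenvalue_exists[OF A d] by metis
  have "\<gamma> * (u \<bullet> u) \<le> l * (u \<bullet> u)" using pos[OF u(1)] u by simp
  then have "\<gamma> \<le> l" using uu[OF u(1,2)] by simp
  then have lS: "l \<in> singular_values A" using eigenvalue_in_singular_values[OF A u] \<gamma> by simp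
  have nA: "- A \<in> carrier_mat d d" "(- A)\<^sup>T = - A" using A by (simp_all add: transpose_uminus)
  have neg: "(- A) *\<^sub>v z = - (A *\<^sub>v z)" if "z \<in> carrier_vec d" for z
    using A that by (intro eq_vecI) auto
  obtain k v where v: "v \<in> carrier_vec d" "v \<noteq> 0\<^sub>v d" "(- A) *\<^sub>v v = k \<cdot>\<^sub>v v"
    and k: "\<And>z. z \<in> carrier_vec d \<Longrightarrow> z \<bullet> ((- A) *\<^sub>v z) \<le> k * (z \<bullet> z)"
    using max_eigenvalue_exists[OF nA d] by metis
  have Av: "A *\<^sub>v v = (- k) \<cdot>\<^sub>v v"
  proof (rule eq_vecI)
    fix i assume "i < dim_vec ((- k) \<cdot>\<^sub>v v)"
    then have i: "i < d" using v(1) by simp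
    have "(- (A *\<^sub>v v)) $ i = (k \<cdot>\<^sub>v v) $ i" using v(3) unfolding neg[OF v(1)] by simp
    then show "(A *\<^sub>v v) $ i = ((- k) \<cdot>\<^sub>v v) $ i"
      using i by (simp add: carrier_matD(1)[OF A(1)] carrier_vecD[OF v(1)] del: index_mult_mat_vec)
  qed (simp add: carrier_matD(1)[OF A(1)] carrier_vecD[OF v(1)])
  have "\<gamma> * (v \<bullet> v) \<le> (- k) * (v \<bullet> v)" using pos[OF v(1)] Av v by simp
  then have kpos: "\<gamma> \<le> - k" using uu[OF v(1,2)] by (simp only: mult_le_cancel_right)
  then have kS: "- k \<in> singular_values A" using eigenvalue_in_singular_values[OF A v(1,2) Av] \<gamma> by simp
  note fin = finite_singular_values[OF A(1)]
  show "z \<bullet> (A *\<^sub>v z) \<le> sigma_max A * (z \<bullet> z)" if z: "z \<in> carrier_vec d" for z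
  proof -
    have "l \<le> sigma_max A" unfolding sigma_max_def using fin lS by (rule Max_ge)
    then have "l * (z \<bullet> z) \<le> sigma_max A * (z \<bullet> z)" by (intro mult_right_mono) (simp_all flip: vnorm_square)
    then show ?thesis using l[OF z] by linarith
  qed
  show "sigma_min A * (z \<bullet> z) \<le> z \<bullet> (A *\<^sub>v z)" if z: "z \<in> carrier_vec d" for z
  proof -
    have "sigma_min A \<le> - k" unfolding sigma_min_def using fin kS by (rule Min_le)
    then have "sigma_min A * (z \<bullet> z) \<le> - k * (z \<bullet> z)" by (intro mult_right_mono) (simp_all flip: vnorm_square)
    moreover have "z \<bullet> ((- A) *\<^sub>v z) = - (z \<bullet> (A *\<^sub>v z))"
      unfolding neg[OF z] using z A by simp
    ultimately show ?thesis using k[OF z] by simp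
  qed
  have "sigma_min A \<in> singular_values A" unfolding sigma_min_def using fin kS by (intro Min_in) auto
  then have s: "0 \<le> sigma_min A" "eigenvalue (A\<^sup>T * A) ((sigma_min A)\<^sup>2)" by (auto simp: singular_values_def)
  have "sigma_min A \<noteq> 0"
  proof
    assume "sigma_min A = 0"
    then obtain y where y: "y \<in> carrier_vec d" "y \<noteq> 0\<^sub>v d" "(A * A) *\<^sub>v y = 0 \<cdot>\<^sub>v y"
      using s(2) A by (auto simp: eigenvalue_def eigenvector_def)
    have Ay: "A *\<^sub>v y \<in> carrier_vec d" using A y by simp
    have "(vnorm (A *\<^sub>v y))\<^sup>2 = y \<bullet> (A *\<^sub>v (A *\<^sub>v y))"
      using scalar_prod_symmetric_mat[OF A y(1) Ay] by (simp add: vnorm_square)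
    also have "A *\<^sub>v (A *\<^sub>v y) = 0 \<cdot>\<^sub>v y" using y A by (metis assoc_mult_mat_vec)
    finally have "vnorm (A *\<^sub>v y) = 0" using y by simp
    then have "A *\<^sub>v y = 0\<^sub>v d" using vnorm_eq_0_iff[OF Ay] by simp
    then have "\<gamma> * (y \<bullet> y) \<le> 0" using pos[OF y(1)] y by simp
    then show False using mult_pos_pos[OF \<gamma> uu[OF y(1,2)]] by linarith
  qed
  then show "0 < sigma_min A" using s by simp
qed

section \<open>Averaged Newton steps\<close>

text \<open>Uniqueness comes from M X M = M, multiplied by the inverse on both sides.\<close>

lemma pseudoinverse_eq_inverse:
  assumes M: "M \<in> carrier_mat d d" and B: "B \<in> carrier_mat d d" and MB: "M * B = 1\<^sub>m d" "B * M = 1\<^sub>m d"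
  shows "pseudoinverse M = B"
  unfolding pseudoinverse_def
proof (rule the_equality)
  show "B \<in> carrier_mat (dim_col M) (dim_row M) \<and> M * B * M = M \<and> B * M * B = B \<and>
    (M * B)\<^sup>T = M * B \<and> (B * M)\<^sup>T = B * M"
    using M B unfolding MB by (simp add: left_mult_one_mat[of _ d d])
next
  fix X assume X: "X \<in> carrier_mat (dim_col M) (dim_row M) \<and> M * X * M = M \<and> X * M * X = X \<and>
    (M * X)\<^sup>T = M * X \<and> (X * M)\<^sup>T = X * M"
  then have Xc: "X \<in> carrier_mat d d" and MXM: "M * X * M = M" using M by auto
  have "X = (B * M) * X * (M * B)" unfolding MB using Xc by (simp add: left_mult_one_mat[of _ d d])
  also have "\<dots> = B * (M * X * M) * B" using M B Xc by (simp add: assoc_mult_mat[of _ d d _ d _ d])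
  also have "\<dots> = B" unfolding MXM MB using B by (simp add: left_mult_one_mat[of _ d d])
  finally show "X = B" .
qed

text \<open>A singular matrix would have a kernel vector, contrary to positivity; this guarantees
  that \<open>the\<close> is applied to an actual inverse.\<close>

lemma mat_inverse_positive_definite:
  fixes A :: "real mat"
  assumes A: "A \<in> carrier_mat d d" and pos: "\<And>z. z \<in> carrier_vec d \<Longrightarrow> z \<noteq> 0\<^sub>v d \<Longrightarrow> 0 < z \<bullet> (A *\<^sub>v z)"
  shows "the (mat_inverse A) \<in> carrier_mat d d" "A * the (mat_inverse A) = 1\<^sub>m d"
proof -
  have "Determinant.det A \<noteq> 0"
  proof
    assume "Determinant.det A = 0"
    then obtain v where v: "v \<in> carrier_vec d" "v \<noteq> 0\<^sub>v d" "A *\<^sub>v v = 0\<^sub>v d"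
      using det_0_iff_vec_prod_zero[OF A] by blast
    then show False using pos[OF v(1,2)] by simp
  qed
  then have "A \<in> Units (ring_mat TYPE(real) d ())" by (rule det_non_zero_imp_unit[OF A])
  then obtain B where "mat_inverse A = Some B"
    using mat_inverse(1)[OF A, of "()"] by (cases "mat_inverse A") auto
  then show "the (mat_inverse A) \<in> carrier_mat d d" "A * the (mat_inverse A) = 1\<^sub>m d"
    using mat_inverse(2)[OF A, of B] by simp_all
qed

lemma vnorm_le_by_duality:
  assumes v: "v \<in> carrier_vec d" and le: "\<And>u. u \<in> carrier_vec d \<Longrightarrow> u \<bullet> v \<le> c * vnorm u" and c: "0 \<le> c"
  shows "vnorm v \<le> c"
proof (cases "vnorm v = 0")
  case False
  have "vnorm v * vnorm v \<le> c * vnorm v" using le[OF v] by (simp add: power2_eq_square flip: vnorm_square)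
  moreover have "0 < vnorm v" using False vnorm_nonneg[of v] by linarith
  ultimately show ?thesis by simp
qed (use c in simp)

(* The errors E i average to 0, hence the first-order terms of the expansions
   (1 + E i)^-1 = 1 - E i + E i^2 (1 + E i)^-1 cancel in the mean. *)
lemma averaged_newton_step:
  fixes H P :: "real mat" and E K G :: "nat \<Rightarrow> real mat"
  assumes H: "H \<in> carrier_mat d d" and P: "P \<in> carrier_mat d d" and PHP: "P\<^sup>T * H * P = 1\<^sub>m d"
    and m: "0 < m" and \<eta>: "0 \<le> \<eta>" "\<eta> < 1"
    and G: "\<And>i. i < m \<Longrightarrow> G i \<in> carrier_mat d d" and PGP: "\<And>i. i < m \<Longrightarrow> P\<^sup>T * G i * P = 1\<^sub>m d + E i"
    and E: "\<And>i. i < m \<Longrightarrow> E i \<in> carrier_mat d d"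
    and Ebd: "\<And>i z. i < m \<Longrightarrow> z \<in> carrier_vec d \<Longrightarrow> vnorm (E i *\<^sub>v z) \<le> \<eta> * vnorm z"
    and Esum: "\<And>u z. u \<in> carrier_vec d \<Longrightarrow> z \<in> carrier_vec d \<Longrightarrow> (\<Sum>i<m. u \<bullet> (E i *\<^sub>v z)) = 0"
    and K: "\<And>i. i < m \<Longrightarrow> K i \<in> carrier_mat d d" "\<And>i. i < m \<Longrightarrow> G i * K i = 1\<^sub>m d"
    and \<sigma>: "0 < \<sigma>" "\<And>z. z \<in> carrier_vec d \<Longrightarrow> \<sigma> * (z \<bullet> z) \<le> z \<bullet> (H *\<^sub>v z)"
    and \<tau>: "0 \<le> \<tau>" "\<And>z. z \<in> carrier_vec d \<Longrightarrow> z \<bullet> (H *\<^sub>v z) \<le> \<tau> * (z \<bullet> z)"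
    and \<Delta>: "\<Delta> \<in> carrier_vec d" and g: "g \<in> carrier_vec d" and S: "S \<in> carrier_vec d"
    and S_eq: "\<And>u. u \<in> carrier_vec d \<Longrightarrow> u \<bullet> S = 1 / real m * (\<Sum>i<m. u \<bullet> (K i *\<^sub>v g))"
    and c: "c = \<eta>\<^sup>2 / (1 - \<eta>)"
  shows "vnorm (\<Delta> - S) \<le> c * sqrt (\<tau> / \<sigma>) * vnorm \<Delta> + (1 + c) / \<sigma> * vnorm (H *\<^sub>v \<Delta> - g)"
proof -
  define r where "r = H *\<^sub>v \<Delta> - g"
  have H\<Delta>: "H *\<^sub>v \<Delta> \<in> carrier_vec d" using H \<Delta> by simp
  have r: "r \<in> carrier_vec d" using H\<Delta> g by (simp add: r_def)
  have PT: "P\<^sup>T \<in> carrier_mat d d" using P by simp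
  have PTv: "P\<^sup>T *\<^sub>v z \<in> carrier_vec d" "P *\<^sub>v z \<in> carrier_vec d" if "z \<in> carrier_vec d" for z using P that by simp_all
  \<comment> \<open>For square matrices a right inverse is a left inverse; so P P^T is the inverse
    of H, and P^T H inverts P.\<close>
  have PPH: "P * (P\<^sup>T * H) = 1\<^sub>m d"
    using mat_mult_left_right_inverse[of "P\<^sup>T * H" d P] P H PHP by simp
  have c0: "0 \<le> c" using \<eta> by (simp add: c)
  define v where "v = P\<^sup>T *\<^sub>v (H *\<^sub>v \<Delta>)"
  have v: "v \<in> carrier_vec d" unfolding v_def by (rule PTv(1)[OF H\<Delta>])
  have Pinv: "P *\<^sub>v (P\<^sup>T *\<^sub>v (H *\<^sub>v z)) = z" if "z \<in> carrier_vec d" for z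
  proof -
    have "P *\<^sub>v (P\<^sup>T *\<^sub>v (H *\<^sub>v z)) = (P * (P\<^sup>T * H)) *\<^sub>v z"
      using P H that by (simp add: assoc_mult_mat_vec[of _ d d _ d])
    then show ?thesis unfolding PPH using that by simp
  qed
  have energy: "(P *\<^sub>v z) \<bullet> (H *\<^sub>v (P *\<^sub>v z)) = z \<bullet> z" if z: "z \<in> carrier_vec d" for z
  proof -
    have HPz: "H *\<^sub>v (P *\<^sub>v z) \<in> carrier_vec d" using H P z by simp
    have "z \<bullet> z = z \<bullet> ((P\<^sup>T * H * P) *\<^sub>v z)" unfolding PHP using z by simp
    also have "(P\<^sup>T * H * P) *\<^sub>v z = P\<^sup>T *\<^sub>v (H *\<^sub>v (P *\<^sub>v z))"
      using P H z PTv(2)[OF z] by (simp add: assoc_mult_mat_vec[of _ d d _ d])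
    also have "z \<bullet> (P\<^sup>T *\<^sub>v (H *\<^sub>v (P *\<^sub>v z))) = (P *\<^sub>v z) \<bullet> (H *\<^sub>v (P *\<^sub>v z))"
      using transpose_vec_mult_scalar[OF PT HPz z] by simp
    finally show ?thesis ..
  qed
  have P_le: "vnorm (P *\<^sub>v z) \<le> vnorm z / sqrt \<sigma>" if z: "z \<in> carrier_vec d" for z
  proof -
    have "\<sigma> * (vnorm (P *\<^sub>v z))\<^sup>2 \<le> (vnorm z)\<^sup>2"
      using \<sigma>(2)[OF PTv(2)[OF z]] energy[OF z] by (simp add: vnorm_square)
    then have "(vnorm (P *\<^sub>v z))\<^sup>2 \<le> (vnorm z / sqrt \<sigma>)\<^sup>2"
      using \<sigma>(1) by (simp add: power_divide field_simps)
    then show ?thesis by (rule power2_le_imp_le) (use \<sigma> in simp)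
  qed
  \<comment> \<open>The bound for P carries over to its transpose through |P^T z|^2 = z . (P P^T z),
    after cancelling one factor |P^T z|.\<close>
  have PT_le: "vnorm (P\<^sup>T *\<^sub>v z) \<le> vnorm z / sqrt \<sigma>" if z: "z \<in> carrier_vec d" for z
  proof -
    let ?p = "P\<^sup>T *\<^sub>v z"
    have "(vnorm ?p)\<^sup>2 = z \<bullet> (P *\<^sub>v ?p)" by (rule vnorm_square_mult_vec[OF P z])
    also have "\<dots> \<le> vnorm z * vnorm (P *\<^sub>v ?p)"
      using scalar_prod_le_vnorm[OF z PTv(2)[OF PTv(1)[OF z]]] by simp
    also have "\<dots> \<le> vnorm z * (vnorm ?p / sqrt \<sigma>)"
      by (intro mult_left_mono P_le PTv z) simp
    finally have le: "vnorm ?p * vnorm ?p \<le> (vnorm z / sqrt \<sigma>) * vnorm ?p" by (simp add: power2_eq_square)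
    show ?thesis
    proof (cases "vnorm ?p = 0")
      case False
      then have "0 < vnorm ?p" using vnorm_nonneg[of ?p] by linarith
      then show ?thesis using le by (simp only: mult_le_cancel_right_pos)
    qed (use \<sigma> in simp)
  qed
  have v_le: "vnorm v \<le> sqrt \<tau> * vnorm \<Delta>"
  proof -
    have "(vnorm v)\<^sup>2 = \<Delta> \<bullet> (H *\<^sub>v \<Delta>)"
      using energy[OF v] Pinv[OF \<Delta>] unfolding v_def[symmetric] by (simp add: vnorm_square)
    also have "\<dots> \<le> (sqrt \<tau> * vnorm \<Delta>)\<^sup>2"
      using \<tau>(2)[OF \<Delta>] \<tau>(1) by (simp add: power_mult_distrib vnorm_square)
    finally show ?thesis by (rule power2_le_imp_le) (use \<tau> in simp)
  qed
  define \<rho> where "\<rho> = P\<^sup>T *\<^sub>v r"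
  have \<rho>: "\<rho> \<in> carrier_vec d" unfolding \<rho>_def by (rule PTv(1)[OF r])
  define b where "b = P\<^sup>T *\<^sub>v g"
  have b: "b \<in> carrier_vec d" unfolding b_def by (rule PTv(1)[OF g])
  have b_eq: "b = v - \<rho>"
  proof -
    have "\<rho> = v - b"
      unfolding \<rho>_def v_def b_def r_def by (rule mult_minus_distrib_mat_vec[OF PT H\<Delta> g])
    then show ?thesis using v b by (intro eq_vecI) auto
  qed
  have b_le: "vnorm b \<le> vnorm v + vnorm \<rho>" unfolding b_eq by (rule vnorm_minus[OF v \<rho>])
  \<comment> \<open>The direction of worker i in whitened coordinates: P q_i = K_i g, and q_i solves
    (1 + E_i) q_i = b, where b is the whitened gradient.\<close>
  define q where "q i = P\<^sup>T *\<^sub>v (H *\<^sub>v (K i *\<^sub>v g))" for i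
  have Kg: "K i *\<^sub>v g \<in> carrier_vec d" if "i < m" for i using K(1)[OF that] g by simp
  have q: "q i \<in> carrier_vec d" if "i < m" for i
    unfolding q_def using mult_mat_vec_carrier[OF H Kg[OF that]] by (rule PTv(1))
  have Pq: "P *\<^sub>v q i = K i *\<^sub>v g" if "i < m" for i unfolding q_def by (rule Pinv[OF Kg[OF that]])
  have Ez: "E i *\<^sub>v z \<in> carrier_vec d" if "i < m" "z \<in> carrier_vec d" for i z using E[OF that(1)] that(2) by simp
  have q_eq: "q i + E i *\<^sub>v q i = b" if i: "i < m" for i
  proof -
    have "b = P\<^sup>T *\<^sub>v ((G i * K i) *\<^sub>v g)" unfolding K(2)[OF i] b_def using g by simp
    also have "(G i * K i) *\<^sub>v g = G i *\<^sub>v (P *\<^sub>v q i)"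
      unfolding Pq[OF i] by (rule assoc_mult_mat_vec[OF G[OF i] K(1)[OF i] g])
    also have "P\<^sup>T *\<^sub>v (G i *\<^sub>v (P *\<^sub>v q i)) = (P\<^sup>T * G i * P) *\<^sub>v q i"
      using P G[OF i] q[OF i] PTv(2)[OF q[OF i]] by (simp add: assoc_mult_mat_vec[of _ d d _ d])
    also have "\<dots> = q i + E i *\<^sub>v q i"
      unfolding PGP[OF i] using E[OF i] q[OF i] by (simp add: add_mult_distrib_mat_vec[of _ d d])
    finally show ?thesis ..
  qed
  have q_le: "vnorm (q i) \<le> vnorm b / (1 - \<eta>)" if i: "i < m" for i
  proof -
    have "q i = b - E i *\<^sub>v q i"
      unfolding q_eq[OF i, symmetric] using carrier_vecD[OF q[OF i]] carrier_vecD[OF Ez[OF i q[OF i]]]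
      by (intro eq_vecI) (simp_all del: index_mult_mat_vec dim_mult_mat_vec)
    then have "vnorm (q i) \<le> vnorm b + vnorm (E i *\<^sub>v q i)" using vnorm_minus[OF b Ez[OF i q[OF i]]] by simp
    also have "vnorm (E i *\<^sub>v q i) \<le> \<eta> * vnorm (q i)" by (rule Ebd[OF i q[OF i]])
    finally show ?thesis using \<eta> by (simp add: field_simps)
  qed
  have second_order: "z \<bullet> q i = z \<bullet> b - z \<bullet> (E i *\<^sub>v b) + z \<bullet> (E i *\<^sub>v (E i *\<^sub>v q i))"
    if i: "i < m" and z: "z \<in> carrier_vec d" for i z
  proof -
    note c' = q[OF i] Ez[OF i q[OF i]] Ez[OF i Ez[OF i q[OF i]]]
    have "z \<bullet> b = z \<bullet> q i + z \<bullet> (E i *\<^sub>v q i)"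
      unfolding q_eq[OF i, symmetric] by (rule scalar_prod_add_distrib[OF z c'(1,2)])
    moreover have "E i *\<^sub>v b = E i *\<^sub>v q i + E i *\<^sub>v (E i *\<^sub>v q i)"
      unfolding q_eq[OF i, symmetric] by (rule mult_add_distrib_mat_vec[OF E[OF i] c'(1,2)])
    then have "z \<bullet> (E i *\<^sub>v b) = z \<bullet> (E i *\<^sub>v q i) + z \<bullet> (E i *\<^sub>v (E i *\<^sub>v q i))"
      using scalar_prod_add_distrib[OF z c'(2,3)] by simp
    ultimately show ?thesis by linarith
  qed
  define B where "B = vnorm \<rho> + c * vnorm b"
  have B0: "0 \<le> B" using c0 by (simp add: B_def)
  have "vnorm (\<Delta> - S) \<le> B / sqrt \<sigma>"
  \<comment> \<open>The cancellation of the errors and the formula for S are available as scalar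
    products with arbitrary vectors, so the norm is found by testing.\<close>
  proof (rule vnorm_le_by_duality)
    show "\<Delta> - S \<in> carrier_vec d" using \<Delta> S by simp
    show "0 \<le> B / sqrt \<sigma>" using B0 \<sigma> by simp
    fix u :: "real vec" assume u: "u \<in> carrier_vec d"
    define z where "z = P\<^sup>T *\<^sub>v u"
    have z: "z \<in> carrier_vec d" unfolding z_def by (rule PTv(1)[OF u])
    have uP: "u \<bullet> (P *\<^sub>v y) = z \<bullet> y" if "y \<in> carrier_vec d" for y
      unfolding z_def using transpose_vec_mult_scalar[OF P that u] by simp
    have "u \<bullet> (\<Delta> - S) = u \<bullet> \<Delta> - u \<bullet> S" by (rule scalar_prod_minus_distrib[OF u \<Delta> S])
    also have "u \<bullet> \<Delta> = z \<bullet> v" using uP[OF v] Pinv[OF \<Delta>] by (simp add: v_def)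
    also have "u \<bullet> S = 1 / real m * (\<Sum>i<m. z \<bullet> q i)"
    proof -
      have "(\<Sum>i<m. u \<bullet> (K i *\<^sub>v g)) = (\<Sum>i<m. z \<bullet> q i)"
        by (intro sum.cong refl) (simp add: uP[OF q, symmetric] Pq)
      then show ?thesis by (simp only: S_eq[OF u])
    qed
    also have "(\<Sum>i<m. z \<bullet> q i) = (\<Sum>i<m. z \<bullet> b - z \<bullet> (E i *\<^sub>v b) + z \<bullet> (E i *\<^sub>v (E i *\<^sub>v q i)))"
      using second_order z by (intro sum.cong) auto
    also have "\<dots> = real m * (z \<bullet> b) + (\<Sum>i<m. z \<bullet> (E i *\<^sub>v (E i *\<^sub>v q i)))"
      by (simp add: sum.distrib sum_subtractf Esum[OF z b])
    finally have 1: "u \<bullet> (\<Delta> - S) = z \<bullet> v - z \<bullet> b - 1 / real m * (\<Sum>i<m. z \<bullet> (E i *\<^sub>v (E i *\<^sub>v q i)))"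
      using m by (simp add: distrib_left)
    have 2: "z \<bullet> v - z \<bullet> b = z \<bullet> \<rho>"
      unfolding b_eq using scalar_prod_minus_distrib[OF z v \<rho>] by simp
    have "- (\<Sum>i<m. z \<bullet> (E i *\<^sub>v (E i *\<^sub>v q i))) \<le> (\<Sum>i<m. vnorm z * (c * vnorm b))"
      unfolding sum_negf[symmetric]
    proof (rule sum_mono)
      fix i assume "i \<in> {..<m}"
      then have i: "i < m" by simp
      have "- (z \<bullet> (E i *\<^sub>v (E i *\<^sub>v q i))) \<le> vnorm z * vnorm (E i *\<^sub>v (E i *\<^sub>v q i))"
        using scalar_prod_le_vnorm[OF z Ez[OF i Ez[OF i q[OF i]]]] by linarith
      also have "\<dots> \<le> vnorm z * (\<eta> * (\<eta> * (vnorm b / (1 - \<eta>))))"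
      proof (rule mult_left_mono)
        have "vnorm (E i *\<^sub>v (E i *\<^sub>v q i)) \<le> \<eta> * vnorm (E i *\<^sub>v q i)" by (rule Ebd[OF i Ez[OF i q[OF i]]])
        also have "\<dots> \<le> \<eta> * (\<eta> * vnorm (q i))" by (rule mult_left_mono[OF Ebd[OF i q[OF i]] \<eta>(1)])
        also have "\<dots> \<le> \<eta> * (\<eta> * (vnorm b / (1 - \<eta>)))"
          by (rule mult_left_mono[OF mult_left_mono[OF q_le[OF i] \<eta>(1)] \<eta>(1)])
        finally show "vnorm (E i *\<^sub>v (E i *\<^sub>v q i)) \<le> \<eta> * (\<eta> * (vnorm b / (1 - \<eta>)))" .
      qed simp
      also have "\<dots> = vnorm z * (c * vnorm b)" by (simp add: c power2_eq_square)
      finally show "- (z \<bullet> (E i *\<^sub>v (E i *\<^sub>v q i))) \<le> vnorm z * (c * vnorm b)" .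
    qed
    then have "1 / real m * - (\<Sum>i<m. z \<bullet> (E i *\<^sub>v (E i *\<^sub>v q i))) \<le> 1 / real m * (real m * (vnorm z * (c * vnorm b)))"
      by (intro mult_left_mono) simp_all
    then have 3: "- (1 / real m * (\<Sum>i<m. z \<bullet> (E i *\<^sub>v (E i *\<^sub>v q i)))) \<le> vnorm z * (c * vnorm b)"
      using m by simp
    have "z \<bullet> \<rho> \<le> vnorm z * vnorm \<rho>" using scalar_prod_le_vnorm[OF z \<rho>] by linarith
    then have "u \<bullet> (\<Delta> - S) \<le> vnorm z * vnorm \<rho> + vnorm z * (c * vnorm b)" using 1 2 3 by linarith
    also have "\<dots> = vnorm z * B" by (simp add: B_def distrib_left)
    also have "\<dots> \<le> vnorm u / sqrt \<sigma> * B"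
      unfolding z_def by (intro mult_right_mono PT_le u B0)
    finally show "u \<bullet> (\<Delta> - S) \<le> B / sqrt \<sigma> * vnorm u" by (simp add: mult.commute)
  qed
  \<comment> \<open>Each passage through P or P^T costs a factor 1 / sqrt \<sigma>. The remainder r
    passes through both and acquires 1 / \<sigma>; \<Delta> enters through v at the price of sqrt
    \<tau>, and one further passage gives sqrt (\<tau> / \<sigma>).\<close>
  also have "\<dots> \<le> ((1 + c) * (vnorm r / sqrt \<sigma>) + c * (sqrt \<tau> * vnorm \<Delta>)) / sqrt \<sigma>"
  proof (rule divide_right_mono)
    have "c * vnorm b \<le> c * (sqrt \<tau> * vnorm \<Delta> + vnorm \<rho>)"
      using b_le v_le c0 by (intro mult_left_mono) auto
    then have "B \<le> (1 + c) * vnorm \<rho> + c * (sqrt \<tau> * vnorm \<Delta>)"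
      unfolding B_def by (simp add: distrib_left distrib_right)
    also have "(1 + c) * vnorm \<rho> \<le> (1 + c) * (vnorm r / sqrt \<sigma>)"
      unfolding \<rho>_def using c0 by (intro mult_left_mono PT_le r) simp
    finally show "B \<le> (1 + c) * (vnorm r / sqrt \<sigma>) + c * (sqrt \<tau> * vnorm \<Delta>)" by simp
  qed (use \<sigma> in simp)
  also have "\<dots> = c * sqrt (\<tau> / \<sigma>) * vnorm \<Delta> + (1 + c) / \<sigma> * vnorm r"
    using \<sigma>(1) by (simp add: add_divide_distrib real_sqrt_divide distrib_right)
  finally show ?thesis unfolding r_def .
qed

section \<open>Matrices assembled from selected rows\<close>

lemma mat_of_rows_gram:
  assumes xs: "distinct xs" and f: "\<And>t. t \<in> set xs \<Longrightarrow> f t \<in> carrier_vec d"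
  shows "(mat_of_rows d (map f xs))\<^sup>T * mat_of_rows d (map f xs) = gram d f (set xs)"
proof (rule eq_matI)
  fix i j assume "i < dim_row (gram d f (set xs))" "j < dim_col (gram d f (set xs))"
  then have ij: "i < d" "j < d" by auto
  have "((mat_of_rows d (map f xs))\<^sup>T * mat_of_rows d (map f xs)) $$ (i, j)
    = (\<Sum>k = 0..<length xs. f (xs ! k) $ i * f (xs ! k) $ j)"
    using ij by (auto simp: scalar_prod_def mat_of_rows_def intro!: sum.cong)
  also have "\<dots> = sum_list (map (\<lambda>t. f t $ i * f t $ j) xs)"
    by (simp add: sum_list_sum_nth)
  also have "\<dots> = (\<Sum>t\<in>set xs. f t $ i * f t $ j)"
    using xs by (rule sum_list_distinct_conv_sum_set)
  finally show "((mat_of_rows d (map f xs))\<^sup>T * mat_of_rows d (map f xs)) $$ (i, j) = gram d f (set xs) $$ (i, j)"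
    using ij by (simp add: index_gram)
qed auto

section \<open>The error of the update\<close>

lemma sum_scalar_prod_finsum_vec:
  fixes f :: "'a \<Rightarrow> real vec"
  assumes "finite I" and f: "\<And>i. i \<in> I \<Longrightarrow> f i \<in> carrier_vec d" and u: "u \<in> carrier_vec d"
  shows "u \<bullet> finsum_vec TYPE(real) d f I = (\<Sum>i\<in>I. u \<bullet> f i)"
proof -
  have fc: "f \<in> I \<rightarrow> carrier_vec d" using f by auto
  have fs: "finsum_vec TYPE(real) d f I \<in> carrier_vec d" by (rule finsum_vec_closed[OF fc])
  have "u \<bullet> finsum_vec TYPE(real) d f I = (\<Sum>k<d. u $ k * (\<Sum>i\<in>I. f i $ k))"
    using carrier_vecD[OF fs] index_finsum_vec[OF assms(1) _ fc]
    by (simp add: scalar_prod_def lessThan_atLeast0)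
  also have "\<dots> = (\<Sum>i\<in>I. \<Sum>k<d. u $ k * f i $ k)"
    unfolding sum_distrib_left by (rule sum.swap)
  also have "\<dots> = (\<Sum>i\<in>I. u \<bullet> f i)"
    using carrier_vecD[OF f] by (intro sum.cong refl) (simp add: scalar_prod_def lessThan_atLeast0)
  finally show ?thesis .
qed

lemma quadratic_form_sample_error:
  assumes T: "T \<subseteq> {..<n}" and y: "\<And>t. t < n \<Longrightarrow> y t \<in> carrier_vec d"
    and u: "u \<in> carrier_vec d" and z: "z \<in> carrier_vec d"
  shows "u \<bullet> (sample_error d y n T *\<^sub>v z) = 1 / real (card T) * (\<Sum>t\<in>T. (y t \<bullet> u) * (y t \<bullet> z))
    - 1 / real n * (\<Sum>t<n. (y t \<bullet> u) * (y t \<bullet> z))"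
proof -
  note g = mult_mat_vec_carrier[OF gram_carrier z]
  have "sample_error d y n T *\<^sub>v z = (1 / real (card T)) \<cdot>\<^sub>v (gram d y T *\<^sub>v z) - (1 / real n) \<cdot>\<^sub>v (gram d y {..<n} *\<^sub>v z)"
    unfolding sample_error_def using z
    by (simp add: minus_mult_distrib_mat_vec[of _ d d] smult_mat_mult_vec[of _ d d])
  also have "u \<bullet> \<dots> = 1 / real (card T) * (u \<bullet> (gram d y T *\<^sub>v z)) - 1 / real n * (u \<bullet> (gram d y {..<n} *\<^sub>v z))"
    using u g by (simp add: scalar_prod_minus_distrib[of _ d])
  also have "u \<bullet> (gram d y T *\<^sub>v z) = (\<Sum>t\<in>T. (y t \<bullet> u) * (y t \<bullet> z))"
    using T y u z by (intro quadratic_form_gram) auto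
  also have "u \<bullet> (gram d y {..<n} *\<^sub>v z) = (\<Sum>t<n. (y t \<bullet> u) * (y t \<bullet> z))"
    using y u z by (intro quadratic_form_gram) auto
  finally show ?thesis .
qed

text \<open>The workers hold disjoint sets of equal size that exhaust the data, so the average of
  their sample means is the population mean. Unequal sizes would destroy this cancellation.\<close>

lemma sum_sample_error_eq_0:
  assumes p: "p \<in> partitions n m" and m: "0 < m" and dvd: "m dvd n" and n: "0 < n"
    and y: "\<And>t. t < n \<Longrightarrow> y t \<in> carrier_vec d"
    and u: "u \<in> carrier_vec d" and z: "z \<in> carrier_vec d"
  shows "(\<Sum>i<m. u \<bullet> (sample_error d y n (worker_set n p i) *\<^sub>v z)) = 0"
proof -
  define h where "h t = (y t \<bullet> u) * (y t \<bullet> z)" for t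
  have nm: "real n = real m * real (n div m)" using dvd by (metis dvd_mult_div_cancel of_nat_mult)
  have W: "worker_set n p i \<subseteq> {..<n}" "card (worker_set n p i) = n div m" if "i < m" for i
    using worker_set_k_subsets[OF p that] by (auto simp: k_subsets_def)
  have "(\<Sum>i<m. u \<bullet> (sample_error d y n (worker_set n p i) *\<^sub>v z))
    = (\<Sum>i<m. 1 / real (n div m) * (\<Sum>t\<in>worker_set n p i. h t) - 1 / real n * (\<Sum>t<n. h t))"
    unfolding h_def using W by (intro sum.cong refl) (subst quadratic_form_sample_error[OF _ y u z], auto)
  also have "\<dots> = 1 / real (n div m) * (\<Sum>i<m. \<Sum>t\<in>worker_set n p i. h t) - real m * (1 / real n * (\<Sum>t<n. h t))"
    by (simp add: sum_subtractf sum_distrib_left)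
  also have "(\<Sum>i<m. \<Sum>t\<in>worker_set n p i. h t) = (\<Sum>t<n. h t)"
  proof -
    have "worker_set n p i = {t \<in> {..<n}. p t = i}" for i by (auto simp: worker_set_def)
    moreover have "p ` {..<n} \<subseteq> {..<m}" using p by (auto simp: partitions_def)
    ultimately show ?thesis using sum.group[of "{..<n}" "{..<m}" p h] by simp
  qed
  also have "1 / real (n div m) * (\<Sum>t<n. h t) - real m * (1 / real n * (\<Sum>t<n. h t)) = 0"
    unfolding nm using n m nm by simp
  finally show ?thesis .
qed

lemma sample_error_eq_0_imp_vnorm:
  assumes "sample_error d y n T = 0\<^sub>m d d" "z \<in> carrier_vec d"
  shows "vnorm (sample_error d y n T *\<^sub>v z) = 0"
proof -
  have "0\<^sub>m d d *\<^sub>v z = 0\<^sub>v d" using assms(2) by (intro eq_vecI) auto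
  then show ?thesis unfolding assms(1) by simp
qed

(* If m D / delta is at most e, then the union bound over the workers still gains the factor D. *)
lemma union_bound_le:
  fixes D m \<delta> a :: real
  assumes D: "0 \<le> D" and m: "0 < m" and \<delta>: "0 < \<delta>" and a: "4 * max 1 (ln (m * D / \<delta>)) \<le> a"
  shows "m * (4 * D * exp (- a)) \<le> \<delta>"
proof -
  define K where "K = max 1 (ln (m * D / \<delta>))"
  have K: "1 \<le> K" "4 * K \<le> a" using a by (auto simp: K_def)
  have "m * D / \<delta> \<le> exp K"
  \<comment> \<open>At D = 0 the argument of \<open>ln\<close> is 0 and its value carries no
    information; there the left-hand side vanishes.\<close>
  proof (cases "D = 0")
    case False
    then have "0 < m * D / \<delta>" using D m \<delta> by simp
    then have "m * D / \<delta> = exp (ln (m * D / \<delta>))" by simp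
    also have "\<dots> \<le> exp K" by (simp add: K_def)
    finally show ?thesis .
  qed simp
  then have mD: "m * D \<le> \<delta> * exp K" using \<delta> by (simp add: field_simps)
  have "m * (4 * D * exp (- a)) = 4 * (m * D) * exp (- a)" by simp
  also have "\<dots> \<le> 4 * (\<delta> * exp K) * exp (- (4 * K))"
  proof (rule mult_mono)
    show "4 * (m * D) \<le> 4 * (\<delta> * exp K)" using mD by linarith
    show "exp (- a) \<le> exp (- (4 * K))" using K by simp
    show "0 \<le> 4 * (\<delta> * exp K)" using \<delta> by simp
  qed simp
  also have "\<dots> = \<delta> * (4 * (exp K * exp (- (4 * K))))" by simp
  also have "exp K * exp (- (4 * K)) = exp (- (3 * K))" by (simp flip: exp_add)
  also have "4 * exp (- (3 * K)) \<le> 1"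
  proof -
    have "4 \<le> exp (3 * K)" using exp_ge_add_one_self[of "3 * K"] K(1) by linarith
    then show ?thesis by (simp add: exp_minus field_simps)
  qed
  finally show ?thesis using \<delta> by simp
qed

context regularised_loss
begin

lemma scaled_data_eq: "scaled_data n d l x w = mat_of_rows d (map (data_row w) [0..<n])"
  unfolding scaled_data_def
  by (intro arg_cong[of _ _ "mat_of_rows d"] map_cong refl) (simp add: data_row_def)

lemma dim_scaled_data: "dim_row (scaled_data n d l x w) = n" "dim_col (scaled_data n d l x w) = d"
  by (simp_all add: scaled_data_eq)

lemma row_scaled_data:
  assumes "j < n"
  shows "row (scaled_data n d l x w) j = data_row w j"
  unfolding scaled_data_eq using assms data_row_carrier[OF assms] by (subst mat_of_rows_row) auto

lemma gram_scaled_data: "(scaled_data n d l x w)\<^sup>T * scaled_data n d l x w = gram d (data_row w) {..<n}"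
proof -
  have "{0..<n} = {..<n}" by auto
  then show ?thesis unfolding scaled_data_eq
    using mat_of_rows_gram[of "[0..<n]" "data_row w" d] data_row_carrier by simp
qed

lemma local_hessian_scaled_data:
  "local_hessian (scaled_data n d l x w) \<gamma> s p i
    = (1 / real s) \<cdot>\<^sub>m gram d (data_row w) (worker_set n p i) + \<gamma> \<cdot>\<^sub>m 1\<^sub>m d"
proof -
  let ?xs = "filter (\<lambda>j. p j = i) [0..<n]"
  have "worker_rows (scaled_data n d l x w) p i = mat_of_rows d (map (data_row w) ?xs)"
    unfolding worker_rows_def dim_scaled_data
    by (intro arg_cong[of _ _ "mat_of_rows d"] map_cong refl) (auto simp: row_scaled_data)
  moreover have "set ?xs = worker_set n p i" by (auto simp: worker_set_def)
  moreover have "(mat_of_rows d (map (data_row w) ?xs))\<^sup>T * mat_of_rows d (map (data_row w) ?xs)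
    = gram d (data_row w) (set ?xs)"
    by (rule mat_of_rows_gram) (auto intro: data_row_carrier)
  ultimately show ?thesis
    unfolding local_hessian_def dim_scaled_data by (simp only:)
qed

lemma regularised_gram_ge:
  assumes T: "T \<subseteq> {..<n}" and c: "0 \<le> c" and z: "z \<in> carrier_vec d"
  shows "\<gamma> * (z \<bullet> z) \<le> z \<bullet> ((c \<cdot>\<^sub>m gram d (data_row w) T + \<gamma> \<cdot>\<^sub>m 1\<^sub>m d) *\<^sub>v z)"
proof -
  have "(c \<cdot>\<^sub>m gram d (data_row w) T + \<gamma> \<cdot>\<^sub>m 1\<^sub>m d) *\<^sub>v z = c \<cdot>\<^sub>v (gram d (data_row w) T *\<^sub>v z) + \<gamma> \<cdot>\<^sub>v z"
    using z by (simp add: add_mult_distrib_mat_vec[of _ d d] smult_mat_mult_vec[of _ d d])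
  then have "z \<bullet> ((c \<cdot>\<^sub>m gram d (data_row w) T + \<gamma> \<cdot>\<^sub>m 1\<^sub>m d) *\<^sub>v z)
    = c * (z \<bullet> (gram d (data_row w) T *\<^sub>v z)) + \<gamma> * (z \<bullet> z)"
    using z mult_mat_vec_carrier[OF gram_carrier z] by (simp add: scalar_prod_add_distrib[of _ d])
  moreover have "0 \<le> z \<bullet> (gram d (data_row w) T *\<^sub>v z)"
    using quadratic_form_psd_gram[of T "data_row w" d] data_row_carrier T z by (auto simp: psd_def)
  ultimately show ?thesis using c by simp
qed

end

section \<open>The loss in whitened coordinates\<close>

locale whitened_loss = regularised_loss +
  fixes w :: "real vec" and P :: "real mat"
  assumes d: "0 < d" and w: "w \<in> carrier_vec d" and P: "P \<in> carrier_mat d d"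
    and PHP: "P\<^sup>T * hessian F w * P = 1\<^sub>m d"
begin

abbreviation "A \<equiv> scaled_data n d l x w"
abbreviation "H \<equiv> hessian F w"

definition white_row :: "nat \<Rightarrow> real vec" where
  "white_row t = P\<^sup>T *\<^sub>v data_row w t"

lemma white_row_carrier: "t < n \<Longrightarrow> white_row t \<in> carrier_vec d"
  unfolding white_row_def using mult_mat_vec_carrier[of "P\<^sup>T" d d, OF _ data_row_carrier] P by simp

lemma congruence_regularised_gram:
  assumes T: "T \<subseteq> {..<n}"
  shows "P\<^sup>T * (c \<cdot>\<^sub>m gram d (data_row w) T + \<gamma> \<cdot>\<^sub>m 1\<^sub>m d) * P = c \<cdot>\<^sub>m gram d white_row T + \<gamma> \<cdot>\<^sub>m (P\<^sup>T * P)"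
proof -
  have "P\<^sup>T * gram d (data_row w) T * P = gram d white_row T"
    unfolding white_row_def using data_row_carrier T by (intro congruence_gram[OF P]) auto
  then show ?thesis using P
    by (simp add: mult_add_distrib_mat[of _ d d _ d] add_mult_distrib_mat[of _ d d _ _ d]
        mult_smult_distrib[of _ d d _ d] mult_smult_assoc_mat[of _ d d _ d])
qed

text \<open>The identity is the whitened Hessian, hence the sum of the whitened data part and the
  whitened regulariser. The latter is positive semidefinite, so the data part is at most 1; the
  potential argument rests on this.\<close>

lemma whitened_regulariser:
  "\<gamma> \<cdot>\<^sub>m (P\<^sup>T * P) = 1\<^sub>m d - (1 / real n) \<cdot>\<^sub>m gram d white_row {..<n}"
proof -
  define \<Gamma> where "\<Gamma> = \<gamma> \<cdot>\<^sub>m (P\<^sup>T * P)"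
  have \<Gamma>: "\<Gamma> \<in> carrier_mat d d" using P by (simp add: \<Gamma>_def)
  have eq: "(1 / real n) \<cdot>\<^sub>m gram d white_row {..<n} + \<Gamma> = 1\<^sub>m d"
    using PHP congruence_regularised_gram[OF order_refl, of "1 / real n"]
    unfolding hessian_objective[OF w] \<Gamma>_def by simp
  show ?thesis unfolding \<Gamma>_def[symmetric] eq[symmetric]
    using \<Gamma> by (intro eq_matI) auto
qed

text \<open>The regulariser is common to the local and the global Hessian, so after whitening only
  the sampling error of the data part remains.\<close>

lemma congruence_local_hessian:
  assumes p: "p \<in> partitions n m" and i: "i < m"
  shows "P\<^sup>T * local_hessian A \<gamma> (n div m) p i * P = 1\<^sub>m d + sample_error d white_row n (worker_set n p i)"
proof -
  have W: "worker_set n p i \<subseteq> {..<n}" "card (worker_set n p i) = n div m"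
    using worker_set_k_subsets[OF p i] by (auto simp: k_subsets_def)
  show ?thesis
    unfolding local_hessian_scaled_data congruence_regularised_gram[OF W(1)] whitened_regulariser
      sample_error_def W(2)
    by (intro eq_matI) auto
qed

text \<open>The matrix inside the pseudoinverse is n H, whose inverse is P P^T / n.\<close>

lemma ridge_leverage_eq:
  assumes j: "j < n"
  shows "ridge_leverage A \<gamma> j = (vnorm (white_row j))\<^sup>2 / real n"
proof -
  have H: "H \<in> carrier_mat d d" by (rule hessian_carrier[OF w])
  have PT: "P\<^sup>T \<in> carrier_mat d d" using P by simp
  have PP: "P * P\<^sup>T \<in> carrier_mat d d" using P by simp
  have "P * (P\<^sup>T * H) = 1\<^sub>m d"
    using mat_mult_left_right_inverse[of "P\<^sup>T * H" d P] P H PHP by simp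
  then have inv1: "(P * P\<^sup>T) * H = 1\<^sub>m d" using assoc_mult_mat[OF P PT H] by simp
  have inv2: "H * (P * P\<^sup>T) = 1\<^sub>m d" by (rule mat_mult_left_right_inverse[OF PP H inv1])
  have M: "A\<^sup>T * A + (real (dim_row A) * \<gamma>) \<cdot>\<^sub>m 1\<^sub>m (dim_col A) = real n \<cdot>\<^sub>m H"
    unfolding gram_scaled_data dim_scaled_data hessian_objective[OF w]
    using n by (intro eq_matI) (auto simp: distrib_left)
  have "pseudoinverse (real n \<cdot>\<^sub>m H) = (1 / real n) \<cdot>\<^sub>m (P * P\<^sup>T)"
  proof (rule pseudoinverse_eq_inverse)
    show "real n \<cdot>\<^sub>m H * ((1 / real n) \<cdot>\<^sub>m (P * P\<^sup>T)) = 1\<^sub>m d"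
      using H PP n by (simp only: mult_smult_distrib[of _ d d _ d] mult_smult_assoc_mat[of _ d d _ d]
          smult_smult_mat smult_carrier_mat inv2) (intro eq_matI, auto)
    show "(1 / real n) \<cdot>\<^sub>m (P * P\<^sup>T) * (real n \<cdot>\<^sub>m H) = 1\<^sub>m d"
      using H PP n by (simp only: mult_smult_distrib[of _ d d _ d] mult_smult_assoc_mat[of _ d d _ d]
          smult_smult_mat smult_carrier_mat inv1) (intro eq_matI, auto)
  qed (use H PP in auto)
  moreover have "((1 / real n) \<cdot>\<^sub>m (P * P\<^sup>T)) *\<^sub>v data_row w j = (1 / real n) \<cdot>\<^sub>v (P *\<^sub>v (P\<^sup>T *\<^sub>v data_row w j))"
    using PP data_row_carrier[OF j] assoc_mult_mat_vec[OF P PT data_row_carrier[OF j]]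
    by (simp add: smult_mat_mult_vec[of _ d d])
  ultimately show ?thesis
    unfolding ridge_leverage_def M row_scaled_data[OF j] white_row_def vnorm_square_mult_vec[OF P data_row_carrier[OF j]]
    using scalar_prod_smult_distrib[OF data_row_carrier[OF j]
        mult_mat_vec_carrier[OF P mult_mat_vec_carrier[OF PT data_row_carrier[OF j]]]] by simp
qed

lemma eff_dim_eq: "eff_dim A \<gamma> = (\<Sum>t<n. (vnorm (white_row t))\<^sup>2) / real n"
  by (simp add: eff_dim_def dim_scaled_data ridge_leverage_eq sum_divide_distrib)

lemma eff_dim_nonneg: "0 \<le> eff_dim A \<gamma>"
  unfolding eff_dim_eq by (intro divide_nonneg_nonneg sum_nonneg) auto

text \<open>The product of coherence and effective dimension is n times the largest leverage score.
  If the effective dimension is 0, the product is 0 too, and the vanishing sum of squares makes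
  every whitened row zero.\<close>

lemma vnorm_white_row_le:
  assumes t: "t < n"
  shows "(vnorm (white_row t))\<^sup>2 \<le> ridge_coherence A \<gamma> * eff_dim A \<gamma>"
proof (cases "eff_dim A \<gamma> = 0")
  case True
  then have "(\<Sum>t<n. (vnorm (white_row t))\<^sup>2) = 0" using n by (simp add: eff_dim_eq)
  then have "(vnorm (white_row t))\<^sup>2 = 0" using t by (subst (asm) sum_nonneg_eq_0_iff) auto
  then show ?thesis using True by simp
next
  case False
  have "ridge_leverage A \<gamma> t \<le> Max (ridge_leverage A \<gamma> ` {..<n})" using t by (intro Max_ge) auto
  then have "real n * ridge_leverage A \<gamma> t \<le> real n * Max (ridge_leverage A \<gamma> ` {..<n})"
    by (intro mult_left_mono) auto
  then show ?thesis using False n t by (simp add: ridge_coherence_def dim_scaled_data ridge_leverage_eq)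
qed

lemma giant_update_error_le:
  assumes p: "p \<in> partitions n m" and m: "0 < m" "m dvd n" and v: "v \<in> carrier_vec d"
    and \<eta>: "0 \<le> \<eta>" "\<eta> < 1" and c: "c = \<eta>\<^sup>2 / (1 - \<eta>)"
    and E: "\<And>i z. i < m \<Longrightarrow> z \<in> carrier_vec d \<Longrightarrow>
      vnorm (sample_error d white_row n (worker_set n p i) *\<^sub>v z) \<le> \<eta> * vnorm z"
  shows "vnorm (giant_update A \<gamma> m p (gradient F w) w - v)
    \<le> c * sqrt (sigma_max H / sigma_min H) * vnorm (w - v)
      + (1 + c) / sigma_min H * vnorm (H *\<^sub>v (w - v) - gradient F w)" "0 < sigma_min H" "0 \<le> sigma_max H"
proof -
  have H: "H \<in> carrier_mat d d" by (rule hessian_carrier[OF w])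
  have HT: "H\<^sup>T = H" unfolding hessian_objective[OF w]
    by (simp add: transpose_add[of _ d d] transpose_smult)
  have Hpos: "\<gamma> * (z \<bullet> z) \<le> z \<bullet> (H *\<^sub>v z)" if "z \<in> carrier_vec d" for z
    unfolding hessian_objective[OF w] using that by (intro regularised_gram_ge) auto
  have sigma: "0 < sigma_min H" "\<And>z. z \<in> carrier_vec d \<Longrightarrow> sigma_min H * (z \<bullet> z) \<le> z \<bullet> (H *\<^sub>v z)"
    "\<And>z. z \<in> carrier_vec d \<Longrightarrow> z \<bullet> (H *\<^sub>v z) \<le> sigma_max H * (z \<bullet> z)"
    using sigma_bounds[OF H HT d \<gamma>] Hpos by blast+
  show "0 < sigma_min H" by (rule sigma(1))
  show \<tau>: "0 \<le> sigma_max H"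
  proof -
    let ?e = "unit_vec d 0 :: real vec"
    have "sigma_min H * (?e \<bullet> ?e) \<le> sigma_max H * (?e \<bullet> ?e)"
      using sigma(2,3)[OF unit_vec_carrier] order_trans by blast
    then show ?thesis using d sigma(1) by simp
  qed
  let ?G = "\<lambda>i. local_hessian A \<gamma> (n div m) p i"
  let ?g = "gradient F w"
  let ?K = "\<lambda>i. the (mat_inverse (?G i))"
  have g: "?g \<in> carrier_vec d" by (rule gradient_carrier[OF w])
  have G: "?G i \<in> carrier_mat d d" for i unfolding local_hessian_scaled_data by simp
  have K: "?K i \<in> carrier_mat d d" "?G i * ?K i = 1\<^sub>m d" for i
  proof -
    have pos: "0 < z \<bullet> (?G i *\<^sub>v z)" if z: "z \<in> carrier_vec d" "z \<noteq> 0\<^sub>v d" for z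
    proof -
      have "0 < vnorm z" using z by (intro vnorm_pos)
      then have "0 < \<gamma> * (z \<bullet> z)" using \<gamma> by (simp flip: vnorm_square)
      also have "\<dots> \<le> z \<bullet> (?G i *\<^sub>v z)"
        unfolding local_hessian_scaled_data using z(1) by (intro regularised_gram_ge) (auto simp: worker_set_def)
      finally show ?thesis .
    qed
    show "?K i \<in> carrier_mat d d" "?G i * ?K i = 1\<^sub>m d"
      using mat_inverse_positive_definite[OF G pos] by auto
  qed
  define S where "S = (1 / real m) \<cdot>\<^sub>v finsum_vec TYPE(real) d (\<lambda>i. ?K i *\<^sub>v ?g) {..<m}"
  have Kg: "?K i *\<^sub>v ?g \<in> carrier_vec d" for i by (rule mult_mat_vec_carrier[OF K(1) g])
  have fs: "finsum_vec TYPE(real) d (\<lambda>i. ?K i *\<^sub>v ?g) {..<m} \<in> carrier_vec d"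
    using Kg by (intro finsum_vec_closed) auto
  have S: "S \<in> carrier_vec d" using fs by (simp add: S_def)
  have S_eq: "u \<bullet> S = 1 / real m * (\<Sum>i<m. u \<bullet> (?K i *\<^sub>v ?g))" if u: "u \<in> carrier_vec d" for u
    unfolding S_def using sum_scalar_prod_finsum_vec[OF finite_lessThan Kg u] fs u by simp
  have \<Delta>: "w - v \<in> carrier_vec d" using w v by simp
  have "giant_update A \<gamma> m p ?g w - v = (w - S) - v"
    unfolding giant_update_def S_def dim_scaled_data carrier_vecD[OF w] ..
  also have "\<dots> = (w - v) - S" using w v S by (intro eq_vecI) auto
  finally have eq: "giant_update A \<gamma> m p ?g w - v = (w - v) - S" .
  show "vnorm (giant_update A \<gamma> m p ?g w - v)
    \<le> c * sqrt (sigma_max H / sigma_min H) * vnorm (w - v)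
      + (1 + c) / sigma_min H * vnorm (H *\<^sub>v (w - v) - ?g)"
    unfolding eq
    by (rule averaged_newton_step[where G = ?G and K = ?K and m = m and P = P
          and E = "\<lambda>i. sample_error d white_row n (worker_set n p i)",
          OF H P PHP m(1) \<eta> G congruence_local_hessian[OF p] sample_error_carrier E
          sum_sample_error_eq_0[OF p m n white_row_carrier] K sigma(1,2) \<tau> sigma(3) \<Delta> g S S_eq c])
qed

text \<open>The tail bound requires 2s <= n and M > 0. For m = 1 the only sample is the whole data
  set, and for M = 0 all whitened rows vanish; in both cases the sampling error is 0. The constant
  384 = 4 * 96 makes the tail exponent a at least 4 times the logarithmic factor, as the union bound
  demands.\<close>

lemma card_bad_subsets_le:
  assumes m: "0 < m" "m dvd n" and \<eta>: "0 < \<eta>" "\<eta> \<le> 1" and \<delta>: "0 < \<delta>"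
    and s: "384 * (ridge_coherence A \<gamma> * eff_dim A \<gamma>) * max 1 (ln (real m * eff_dim A \<gamma> / \<delta>)) \<le> \<eta>\<^sup>2 * real (n div m)"
  shows "real m * real (card {T \<in> k_subsets n (n div m). \<exists>z\<in>carrier_vec d.
      \<eta> * vnorm z < vnorm (sample_error d white_row n T *\<^sub>v z)}) \<le> \<delta> * real (n choose (n div m))"
proof -
  let ?s = "n div m"
  let ?U = "{T \<in> k_subsets n ?s. \<exists>z\<in>carrier_vec d. \<eta> * vnorm z < vnorm (sample_error d white_row n T *\<^sub>v z)}"
  define M where "M = ridge_coherence A \<gamma> * eff_dim A \<gamma>"
  have le: "(vnorm (white_row t))\<^sup>2 \<le> M" if "t < n" for t unfolding M_def by (rule vnorm_white_row_le[OF that])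
  have nm: "n = m * ?s" using m by simp
  have s0: "0 < ?s" using n m by (metis gr0I mult_0_right nm)
  have trivial: "real m * real (card ?U) \<le> \<delta> * real (n choose ?s)"
    if zero: "\<And>T. T \<in> k_subsets n ?s \<Longrightarrow> sample_error d white_row n T = 0\<^sub>m d d"
  proof -
    have "?U = {}"
    proof (rule equals0I)
      fix T assume "T \<in> ?U"
      then obtain z where "T \<in> k_subsets n ?s" "z \<in> carrier_vec d"
        "\<eta> * vnorm z < vnorm (sample_error d white_row n T *\<^sub>v z)" by blast
      then have "\<eta> * vnorm z < 0" using sample_error_eq_0_imp_vnorm[OF zero] by metis
      then show False using \<eta>(1) vnorm_nonneg[of z] by (simp add: mult_less_0_iff)
    qed
    then show ?thesis using \<delta> by (simp only: card.empty of_nat_0 mult_zero_right) simp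
  qed
  consider "m = 1" | "M = 0" | "2 \<le> m" "0 < M"
    using m le[OF n] zero_le_power2[of "vnorm (white_row 0)"] by linarith
  then show ?thesis
  proof cases
    case 1
    show ?thesis
    proof (rule trivial)
      fix T assume "T \<in> k_subsets n ?s"
      then have "T \<subseteq> {..<n}" "card T = card {..<n}" using 1 by (auto simp: k_subsets_def)
      then have "T = {..<n}" by (intro card_subset_eq) auto
      then show "sample_error d white_row n T = 0\<^sub>m d d"
        by (intro eq_matI) (auto simp: sample_error_def)
    qed
  next
    case 2
    show ?thesis
    proof (rule trivial)
      fix T assume "T \<in> k_subsets n ?s"
      then have T: "T \<subseteq> {..<n}" by (auto simp: k_subsets_def)
      have y0: "white_row t = 0\<^sub>v d" if "t < n" for t
        using le[OF that] 2 vnorm_eq_0_iff[OF white_row_carrier[OF that]] by simp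
      have "gram d white_row V = 0\<^sub>m d d" if "V \<subseteq> {..<n}" for V
        using y0 that by (intro eq_matI) (auto simp: index_gram subset_iff intro!: sum.neutral)
      from this[OF T] this[OF order_refl] show "sample_error d white_row n T = 0\<^sub>m d d"
        by (intro eq_matI) (auto simp: sample_error_def)
    qed
  next
    case 3
    define a where "a = \<eta>\<^sup>2 * real ?s / (96 * M)"
    have a4: "4 * max 1 (ln (real m * eff_dim A \<gamma> / \<delta>)) \<le> a"
      using s 3 unfolding a_def M_def[symmetric] by (simp add: field_simps)
    have psd: "psd d (1\<^sub>m d - (1 / real n) \<cdot>\<^sub>m gram d white_row {..<n})"
      unfolding psd_def
    proof (intro conjI ballI)
      show "1\<^sub>m d - (1 / real n) \<cdot>\<^sub>m gram d white_row {..<n} \<in> carrier_mat d d"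
        by (simp add: minus_carrier_mat)
      fix z :: "real vec" assume z: "z \<in> carrier_vec d"
      have PT: "P\<^sup>T \<in> carrier_mat d d" using P by simp
      have Pz: "P *\<^sub>v z \<in> carrier_vec d" using P z by simp
      have "(\<gamma> \<cdot>\<^sub>m (P\<^sup>T * P)) *\<^sub>v z = \<gamma> \<cdot>\<^sub>v (P\<^sup>T *\<^sub>v (P *\<^sub>v z))"
        using P PT z assoc_mult_mat_vec[OF PT P z] by (simp add: smult_mat_mult_vec[of _ d d])
      then have "z \<bullet> ((\<gamma> \<cdot>\<^sub>m (P\<^sup>T * P)) *\<^sub>v z) = \<gamma> * (z \<bullet> (P\<^sup>T *\<^sub>v (P *\<^sub>v z)))"
        using z mult_mat_vec_carrier[OF PT Pz] by simp
      also have "\<dots> = \<gamma> * (vnorm (P *\<^sub>v z))\<^sup>2"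
        using transpose_vec_mult_scalar[OF PT Pz z] by (simp add: vnorm_square)
      finally show "0 \<le> z \<bullet> ((1\<^sub>m d - (1 / real n) \<cdot>\<^sub>m gram d white_row {..<n}) *\<^sub>v z)"
        unfolding whitened_regulariser using \<gamma> by simp
    qed
    have "2 * ?s \<le> n" using mult_le_mono1[OF 3(1), of ?s] nm by linarith
    moreover have "1 \<le> a" using a4 by linarith
    ultimately have "real (card ?U) \<le> 4 * eff_dim A \<gamma> * exp (- a) * real (n choose ?s)"
      unfolding eff_dim_eq
      by (intro card_large_sample_error_le[OF white_row_carrier le 3(2) psd s0 _ \<eta> a_def])
    then have "real m * real (card ?U) \<le> real m * (4 * eff_dim A \<gamma> * exp (- a) * real (n choose ?s))"
      by (intro mult_left_mono) auto
    also have "\<dots> = real m * (4 * eff_dim A \<gamma> * exp (- a)) * real (n choose ?s)" by simp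
    also have "\<dots> \<le> \<delta> * real (n choose ?s)"
      using m by (intro mult_right_mono union_bound_le[OF eff_dim_nonneg _ \<delta> a4]) auto
    finally show ?thesis .
  qed
qed

lemma giant_update_probability:
  assumes m: "0 < m" "m dvd n" and v: "v \<in> carrier_vec d"
    and min: "\<And>u. u \<in> carrier_vec d \<Longrightarrow> F v \<le> F u"
    and L: "\<And>u u'. u \<in> carrier_vec d \<Longrightarrow> u' \<in> carrier_vec d \<Longrightarrow>
      spectral_norm (hessian F u - hessian F u') \<le> L * vnorm (u - u')"
    and \<epsilon>: "0 < \<epsilon>" "\<epsilon> < 1 / 4" and \<delta>: "0 < \<delta>"
    and s: "1536 * (ridge_coherence A \<gamma> * eff_dim A \<gamma> / \<epsilon>) * max 1 (ln (real m * eff_dim A \<gamma> / \<delta>)) \<le> real (n div m)"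
  shows "1 - \<delta> \<le> measure_pmf.prob (pmf_of_set (partitions n m))
    {p. vnorm (giant_update A \<gamma> m p (gradient F w) w - v)
      \<le> \<epsilon> * sqrt (sigma_max H / sigma_min H) * vnorm (w - v) + L / sigma_min H * (vnorm (w - v))\<^sup>2}"
    (is "_ \<le> measure_pmf.prob ?Q ?good")
proof -
  let ?s = "n div m"
  \<comment> \<open>The averaged step has a relative error of order \<eta>^2. This choice gives
    \<eta>^2 / (1 - \<eta>) <= \<epsilon>, and \<eta>^2 = \<epsilon> / 4 accounts for 1536 = 4 *
    384.\<close>
  define \<eta> where "\<eta> = sqrt \<epsilon> / 2"
  have \<eta>2: "\<eta>\<^sup>2 = \<epsilon> / 4" using \<epsilon> by (simp add: \<eta>_def power_divide)
  have sqrt: "sqrt \<epsilon> \<le> 1 / 2"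
    using \<epsilon> by (intro real_le_lsqrt) (auto simp: power2_eq_square)
  have \<eta>: "0 < \<eta>" "\<eta> \<le> 1 / 4" using \<epsilon> sqrt by (auto simp: \<eta>_def)
  define c where "c = \<eta>\<^sup>2 / (1 - \<eta>)"
  have c: "0 \<le> c" "c \<le> \<epsilon>"
  proof -
    show "0 \<le> c" using \<eta> by (simp add: c_def)
    have "\<epsilon> / 4 \<le> \<epsilon> * (1 - \<eta>)" using \<eta> mult_left_mono[of "1 / 4" "1 - \<eta>" \<epsilon>] \<epsilon> by simp
    moreover have "0 < 1 - \<eta>" using \<eta> by simp
    ultimately show "c \<le> \<epsilon>" unfolding c_def \<eta>2 by (simp only: pos_divide_le_eq)
  qed
  define U where "U = {T \<in> k_subsets n ?s. \<exists>z\<in>carrier_vec d. \<eta> * vnorm z < vnorm (sample_error d white_row n T *\<^sub>v z)}"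
  define bad where "bad i = {p. worker_set n p i \<in> U}" for i
  have U: "real m * real (card U) \<le> \<delta> * real (n choose ?s)"
    unfolding U_def
  proof (rule card_bad_subsets_le[OF m \<eta>(1) _ \<delta>])
    show "384 * (ridge_coherence A \<gamma> * eff_dim A \<gamma>) * max 1 (ln (real m * eff_dim A \<gamma> / \<delta>)) \<le> \<eta>\<^sup>2 * real ?s"
      using mult_left_mono[OF s, of "\<epsilon> / 4"] \<epsilon> unfolding \<eta>2 by (simp add: mult_ac)
  qed (use \<eta> in simp)
  have choose: "0 < real (n choose ?s)" by simp
  have ne: "partitions n m \<noteq> {}" by (rule partitions_nonempty[OF m])
  \<comment> \<open>The workers are dependent; the union bound works with the uniform law of each
    single worker.\<close>
  have "measure_pmf.prob ?Q (\<Union>i<m. bad i) \<le> (\<Sum>i<m. measure_pmf.prob ?Q (bad i))"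
    by (intro measure_pmf.finite_measure_subadditive_finite) auto
  also have "\<dots> = (\<Sum>i<m. real (card U) / real (n choose ?s))"
  proof (intro sum.cong refl)
    fix i assume "i \<in> {..<m}"
    then have "measure_pmf.prob ?Q (bad i) * real (n choose ?s) = real (card U)"
      unfolding bad_def using m by (intro prob_worker_set_in) (auto simp: U_def)
    then show "measure_pmf.prob ?Q (bad i) = real (card U) / real (n choose ?s)"
      using choose by (metis less_irrefl nonzero_eq_divide_eq)
  qed
  also have "\<dots> \<le> \<delta>" using U choose by (simp add: pos_divide_le_eq)
  finally have prob_bad: "measure_pmf.prob ?Q (\<Union>i<m. bad i) \<le> \<delta>" .
  have good: "p \<in> ?good" if p: "p \<in> partitions n m" and notbad: "p \<notin> (\<Union>i<m. bad i)" for p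
  proof -
    have E: "vnorm (sample_error d white_row n (worker_set n p i) *\<^sub>v z) \<le> \<eta> * vnorm z"
      if "i < m" "z \<in> carrier_vec d" for i z
      using notbad that worker_set_k_subsets[OF p that(1)] unfolding bad_def U_def
      by (auto simp: not_less)
    have \<eta>1: "0 \<le> \<eta>" "\<eta> < 1" using \<eta> by auto
    note step = giant_update_error_le[OF p m v \<eta>1 c_def E]
    let ?X = "vnorm (H *\<^sub>v (w - v) - gradient F w)"
    have X: "?X \<le> L / 2 * (vnorm (w - v))\<^sup>2"
      by (rule newton_remainder[OF w v gradient_minimizer[OF v min] L])
    \<comment> \<open>The factor 1 + c <= 2 is paid for by the 1 / 2 in the Newton remainder, which
      leaves L as in the claim.\<close>
    have "(1 + c) * ?X \<le> 2 * ?X" using c \<epsilon> by (intro mult_right_mono) auto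
    also have "\<dots> \<le> L * (vnorm (w - v))\<^sup>2" using X by simp
    finally have "(1 + c) / sigma_min H * ?X \<le> L / sigma_min H * (vnorm (w - v))\<^sup>2"
      using step(2) by (simp add: divide_right_mono)
    moreover have "c * sqrt (sigma_max H / sigma_min H) * vnorm (w - v)
      \<le> \<epsilon> * sqrt (sigma_max H / sigma_min H) * vnorm (w - v)"
    proof (intro mult_right_mono c)
      show "0 \<le> sqrt (sigma_max H / sigma_min H)" using step(2,3) by simp
    qed simp
    ultimately show ?thesis using step(1) by simp
  qed
  have "1 - \<delta> \<le> 1 - measure_pmf.prob ?Q (\<Union>i<m. bad i)" using prob_bad by simp
  also have "\<dots> = measure_pmf.prob ?Q (UNIV - (\<Union>i<m. bad i))"
    using measure_pmf.prob_compl[of "\<Union>i<m. bad i" ?Q] by simp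
  also have "\<dots> \<le> measure_pmf.prob ?Q ?good"
  \<comment> \<open>The inclusion is known on the support only, that is, for assignments that are
    balanced partitions.\<close>
  proof (rule measure_pmf.finite_measure_mono_AE)
    show "AE p in measure_pmf ?Q. p \<in> UNIV - (\<Union>i<m. bad i) \<longrightarrow> p \<in> ?good"
      using good ne by (intro AE_pmfI impI) (auto simp: set_pmf_of_set)
  qed simp
  finally show ?thesis .
qed

end

theorem theorem5:
  shows "\<exists>C>0. \<forall>(n::nat) (d::nat) (m::nat) (x :: nat \<Rightarrow> real vec) (l :: nat \<Rightarrow> real \<Rightarrow> real)
      (\<gamma>::real) (L::real) (w_star :: real vec) (w :: real vec) (\<epsilon>::real) (\<delta>::real).
    let F = objective n l x \<gamma>;
        s = n div m;
        A = scaled_data n d l x w;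
        H = hessian F w;
        \<kappa> = sigma_max H / sigma_min H;
        d_eff = eff_dim A \<gamma>;
        \<mu> = ridge_coherence A \<gamma>
    in
      0 < n \<longrightarrow> 0 < d \<longrightarrow> 0 < m \<longrightarrow> m dvd n \<longrightarrow>
      (\<forall>j<n. x j \<in> carrier_vec d) \<longrightarrow>
      0 < \<gamma> \<longrightarrow>
      (\<forall>j<n. convex_on UNIV (l j)) \<longrightarrow>
      (\<forall>j<n. \<forall>z. l j differentiable (at z) \<and> deriv (l j) differentiable (at z)) \<longrightarrow>
      w_star \<in> carrier_vec d \<longrightarrow>
      (\<forall>v\<in>carrier_vec d. v \<noteq> w_star \<longrightarrow> F w_star < F v) \<longrightarrow>
      (\<forall>v\<in>carrier_vec d. \<forall>v'\<in>carrier_vec d.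
         spectral_norm (hessian F v - hessian F v') \<le> L * vnorm (v - v')) \<longrightarrow>
      w \<in> carrier_vec d \<longrightarrow>
      0 < \<epsilon> \<longrightarrow> \<epsilon> < 1 / 4 \<longrightarrow>
      0 < \<delta> \<longrightarrow> \<delta> < 1 \<longrightarrow>
      real s \<ge> C * (\<mu> * d_eff / \<epsilon>) * max 1 (ln (real m * d_eff / \<delta>)) \<longrightarrow>
      measure_pmf.prob (pmf_of_set (partitions n m))
        {p. vnorm (giant_update A \<gamma> m p (gradient F w) w - w_star)
              \<le> \<epsilon> * sqrt \<kappa> * vnorm (w - w_star)
                + L / sigma_min H * (vnorm (w - w_star))\<^sup>2}
        \<ge> 1 - \<delta>"
proof (unfold Let_def, intro exI[of _ 1536] conjI allI impI)
  fix n d m :: nat and x :: "nat \<Rightarrow> real vec" and l :: "nat \<Rightarrow> real \<Rightarrow> real"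
    and \<gamma> L \<epsilon> \<delta> :: real and w_star w :: "real vec"
  let ?F = "objective n l x \<gamma>" and ?A = "scaled_data n d l x w"
  assume n: "0 < n" and d: "0 < d" and m: "0 < m" "m dvd n"
    and x: "\<forall>j<n. x j \<in> carrier_vec d" and \<gamma>: "0 < \<gamma>"
    and convex: "\<forall>j<n. convex_on UNIV (l j)"
    and diff: "\<forall>j<n. \<forall>z. l j differentiable (at z) \<and> deriv (l j) differentiable (at z)"
    and w_star: "w_star \<in> carrier_vec d"
    and min: "\<forall>v\<in>carrier_vec d. v \<noteq> w_star \<longrightarrow> ?F w_star < ?F v"
    and L: "\<forall>v\<in>carrier_vec d. \<forall>v'\<in>carrier_vec d.
         spectral_norm (hessian ?F v - hessian ?F v') \<le> L * vnorm (v - v')"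
    and w: "w \<in> carrier_vec d" and \<epsilon>: "0 < \<epsilon>" "\<epsilon> < 1 / 4" and \<delta>: "0 < \<delta>" "\<delta> < 1"
    and s: "1536 * (ridge_coherence ?A \<gamma> * eff_dim ?A \<gamma> / \<epsilon>) * max 1 (ln (real m * eff_dim ?A \<gamma> / \<delta>)) \<le> real (n div m)"
  interpret regularised_loss n d x l \<gamma>
    using n x \<gamma> convex diff by unfold_locales auto
  obtain P where P: "P \<in> carrier_mat d d" and PHP: "P\<^sup>T * hessian ?F w * P = 1\<^sub>m d"
    unfolding hessian_objective[OF w]
    using inverse_congruence_exists[of "{..<n}" "data_row w" d \<gamma> "1 / real n"] data_row_carrier \<gamma>
    by (metis finite_lessThan lessThan_iff of_nat_0_le_iff zero_le_divide_1_iff)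
  interpret whitened_loss n d x l \<gamma> w P
    using d w P PHP by unfold_locales auto
  show "1 - \<delta> \<le> measure_pmf.prob (pmf_of_set (partitions n m))
        {p. vnorm (giant_update ?A \<gamma> m p (gradient ?F w) w - w_star)
              \<le> \<epsilon> * sqrt (sigma_max (hessian ?F w) / sigma_min (hessian ?F w)) * vnorm (w - w_star)
                + L / sigma_min (hessian ?F w) * (vnorm (w - w_star))\<^sup>2}"
  proof (rule giant_update_probability[OF m w_star _ _ \<epsilon> \<delta>(1) s])
    show "?F w_star \<le> ?F u" if "u \<in> carrier_vec d" for u
      using min that by (cases "u = w_star") (auto simp: less_imp_le)
    show "spectral_norm (hessian ?F u - hessian ?F u') \<le> L * vnorm (u - u')"
      if "u \<in> carrier_vec d" "u' \<in> carrier_vec d" for u u' using L that by blast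
  qed
qed simp

end
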